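(* Let $\mathrm{M}$ be a (loopless) matroid of rank $d+1$ and let $k\ge0$ be an integer. Then \[ \mathbb{E}\Big[\big(\mathcal{X}_{\mathrm{M}}-\tfrac d2\big)^k\Big]\le\mathbb{E}\Big[\mathcal{N}\big(0,\tfrac{d+2}{12}\big)^k\Big]=\begin{cases}0 & k\text{ odd},\\ \left(\frac{d+2}{12}\right)^{k/2}(k-1)!! & k\text{ even},\end{cases} \] where $\mathcal{N}(0,\sigma^2)$ is a centered normal random variable with variance $\sigma^2$.
   Context: All matroids are loopless. For a matroid $\mathrm{M}$ on ground set $E$, its Chow ring is $A^*(\mathrm{M})=\mathbb{Z}[x_F : F \text{ a nonempty proper flat}]/(I+J)$, where $I$ is generated by $x_Fx_G$ for incomparable flats $F,G$ and $J$ by $\sum_{F\ni i}x_F-\sum_{F\ni j}x_F$ for $i,j\in E$; it is graded by degree. For $\mathrm{M}$ of rank $d+1$, $a_k(\mathrm{M})=\dim_{\mathbb{Q}}A^k(\mathrm{M})\otimes\mathbb{Q}$, and $\mathcal{X}_{\mathrm{M}}$ is the random variable with $\Pr(\mathcal{X}_{\mathrm{M}}=k)=a_k(\mathrm{M})/\sum_i a_i(\mathrm{M})$, $k=0,\dots,d$. The convention $0^0=1$ is used. *)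

theory Defs
  imports "HOL-Probability.Probability" "HOL-Library.Function_Algebras"
begin

definition matroid :: "'a set \<Rightarrow> ('a set \<Rightarrow> bool) \<Rightarrow> bool" where
  "matroid E indep \<longleftrightarrow> finite E \<and> indep {} \<and> (\<forall>X. indep X \<longrightarrow> X \<subseteq> E)
     \<and> (\<forall>X Y. indep X \<and> Y \<subseteq> X \<longrightarrow> indep Y)
     \<and> (\<forall>X Y. indep X \<and> indep Y \<and> card X < card Y \<longrightarrow> (\<exists>e\<in>Y - X. indep (insert e X)))"

definition loopless :: "'a set \<Rightarrow> ('a set \<Rightarrow> bool) \<Rightarrow> bool" where
  "loopless E indep \<longleftrightarrow> (\<forall>e\<in>E. indep {e})"

definition mrank :: "('a set \<Rightarrow> bool) \<Rightarrow> 'a set \<Rightarrow> nat" where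
  "mrank indep X = Max {card I | I. I \<subseteq> X \<and> indep I}"

definition is_flat :: "'a set \<Rightarrow> ('a set \<Rightarrow> bool) \<Rightarrow> 'a set \<Rightarrow> bool" where
  "is_flat E indep F \<longleftrightarrow> F \<subseteq> E \<and> (\<forall>e\<in>E - F. mrank indep F < mrank indep (insert e F))"

definition chow_vars :: "'a set \<Rightarrow> ('a set \<Rightarrow> bool) \<Rightarrow> 'a set set" where
  "chow_vars E indep = {F. is_flat E indep F \<and> F \<noteq> {} \<and> F \<noteq> E}"

text \<open>A monomial is a multiset of flats; a polynomial is a coefficient function
  (monomial \<Rightarrow> real). The real vector space structure is pointwise.\<close>

definition pscale :: "real \<Rightarrow> ('b multiset \<Rightarrow> real) \<Rightarrow> ('b multiset \<Rightarrow> real)" where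
  "pscale c f = (\<lambda>n. c * f n)"

definition monomials_deg :: "'b set \<Rightarrow> nat \<Rightarrow> 'b multiset set" where
  "monomials_deg V k = {m. set_mset m \<subseteq> V \<and> size m = k}"

definition homog :: "'b set \<Rightarrow> nat \<Rightarrow> ('b multiset \<Rightarrow> real) set" where
  "homog V k = {f. \<forall>n. f n \<noteq> 0 \<longrightarrow> n \<in> monomials_deg V k}"

definition mono_mult :: "'b multiset \<Rightarrow> ('b multiset \<Rightarrow> real) \<Rightarrow> ('b multiset \<Rightarrow> real)" where
  "mono_mult m g = (\<lambda>n. if m \<subseteq># n then g (n - m) else 0)"

definition chow_gens :: "'a set \<Rightarrow> ('a set \<Rightarrow> bool) \<Rightarrow> (nat \<times> ('a set multiset \<Rightarrow> real)) set" where
  "chow_gens E indep =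
     {(2, \<lambda>n. if n = {#F, G#} then 1 else 0) | F G.
        F \<in> chow_vars E indep \<and> G \<in> chow_vars E indep \<and> \<not> F \<subseteq> G \<and> \<not> G \<subseteq> F}
   \<union> {(1, \<lambda>n. \<Sum>F\<in>chow_vars E indep.
            (if n = {#F#} then (if i \<in> F then 1 else 0) - (if j \<in> F then 1 else 0) else 0)) | i j.
        i \<in> E \<and> j \<in> E}"

definition chow_ideal_deg :: "'a set \<Rightarrow> ('a set \<Rightarrow> bool) \<Rightarrow> nat \<Rightarrow> ('a set multiset \<Rightarrow> real) set" where
  "chow_ideal_deg E indep k =
     module.span pscale
       {mono_mult m g | m e g. (e, g) \<in> chow_gens E indep \<and> m \<in> monomials_deg (chow_vars E indep) (k - e) \<and> e \<le> k}"

text \<open>a_k(M) = dim A^k(M) (tensor a field of characteristic 0): dimension of the degree-k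
  homogeneous polynomials modulo the degree-k part of I + J.\<close>
definition chow_dim :: "'a set \<Rightarrow> ('a set \<Rightarrow> bool) \<Rightarrow> nat \<Rightarrow> nat" where
  "chow_dim E indep k =
     vector_space.dim pscale (homog (chow_vars E indep) k)
     - vector_space.dim pscale (chow_ideal_deg E indep k)"

fun dfact :: "nat \<Rightarrow> nat" where
  "dfact 0 = 1"
| "dfact (Suc 0) = 1"
| "dfact (Suc (Suc n)) = Suc (Suc n) * dfact n"

end

theory Submission
  imports Defs
begin

text \<open>
  The elements \<open>h\<^sub>F = \<Sum>\<^bsub>G \<supseteq> F\<^esub> x\<^sub>G\<close>, one for each nonempty flat \<open>F\<close>, generate the Chow ring, subject
  to \<open>h\<^sub>F = 0\<close> for rank one flats and \<open>(h\<^sub>F - h\<^sub>H) (h\<^sub>G - h\<^sub>H) = 0\<close> for the join \<open>H\<close> of \<open>F\<close> and \<open>G\<close>. These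
  relations reduce every monomial in the \<open>h\<^sub>F\<close> to the nested ones, whose support is a chain and in
  which the exponent of \<open>F\<close> is less than the rank difference between \<open>F\<close> and its predecessor. Products
  of dragon Hall--Rado functionals along a flag of flats respect the relations and are unitriangular on
  the nested monomials, so these form a basis.

  Splitting chains of flats at the first flat that has \<open>i\<close> as a coloop gives, for the Hilbert series
  and an element \<open>i\<close> that is not a coloop,
  \<open>H\<^sub>M = H\<^bsub>M - i\<^esub> + t \<Sum>\<^sub>G H\<^bsub>M|G\<^esub> H\<^bsub>M/(G + i)\<^esub>\<close>.
  Put \<open>t = exp s\<close> and centre. The bound \<open>H\<^sub>M(1) exp ((d + 2) s\<^sup>2 / 24)\<close>, coefficientwise in \<open>s\<close>, is
  multiplicative in the right way, so it follows for \<open>M\<close> from smaller matroids. If all elements are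
  coloops, \<open>H\<^sub>M\<close> is an Eulerian polynomial, and the same recursion, now for a coloop, together with
  sharper estimates of its extreme terms, gives the bound.
\<close>

section \<open>Rank functions and nested multisets\<close>

text \<open>If \<open>i\<close> is not a coloop, the two factors of a product in the recursion have
  ranks that add up to one less than the rank of \<open>M\<close>. So their constants rank + 1 add
  up exactly, and the factor \<open>t = exp s\<close> corrects the centre. For a coloop the flat
  \<open>M - i\<close> leaves a factor of rank zero, where the bound is false. That term is a second
  copy of the deletion, and \<open>1 + t = 2 exp (s/2) cosh (s/2)\<close>; since
  \<open>cosh (s/2)\<close> is not below \<open>exp (s^2/24)\<close>, the Boolean case needs an
  estimate of its own. It has little room: the Eulerian variance is \<open>(n + 1)/12\<close> for
  \<open>n\<close> at least 2, so the coefficients of \<open>s^2\<close> agree. This is the origin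
  of the constant \<open>d + 2\<close>.

  No quotient ring is formed. A functional is a function on monomials, and the functionals
  considered are those that kill the ideal. Spanning then means that such a functional is zero once
  it vanishes on the nested monomials, and independence means exhibiting enough of them. Both are
  checked on products of the \<open>h_F\<close>; Moebius inversion carries the result back to the
  variables \<open>x_F\<close>.\<close>

lemma mrank_props:
  assumes "matroid E indep"
  shows mrank_ge: "\<And>I X. indep I \<Longrightarrow> I \<subseteq> X \<Longrightarrow> card I \<le> mrank indep X"
    and mrank_extend: "\<And>I X. indep I \<Longrightarrow> I \<subseteq> X \<Longrightarrow> \<exists>J. I \<subseteq> J \<and> J \<subseteq> X \<and> indep J \<and> card J = mrank indep X"
proof -
  have fE: "finite E" and ie: "indep {}" and iE: "\<And>X. indep X \<Longrightarrow> X \<subseteq> E"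
    and aug: "\<And>X Y. indep X \<Longrightarrow> indep Y \<Longrightarrow> card X < card Y \<Longrightarrow> \<exists>e\<in>Y - X. indep (insert e X)"
    using assms by (auto simp: matroid_def)
  have fin: "finite {card I | I. I \<subseteq> X \<and> indep I}" for X
    by (rule finite_subset[of _ "card ` Pow E"]) (use fE iE in auto)
  show ge: "card I \<le> mrank indep X" if "indep I" "I \<subseteq> X" for I X
    unfolding mrank_def using that by (intro Max_ge[OF fin]) auto
  have ex: "\<exists>J. J \<subseteq> X \<and> indep J \<and> card J = mrank indep X" for X
  proof -
    have "mrank indep X \<in> {card I | I. I \<subseteq> X \<and> indep I}"
      unfolding mrank_def by (rule Max_in[OF fin]) (use ie in blast)
    then show ?thesis by auto
  qed
  show "\<exists>J. I \<subseteq> J \<and> J \<subseteq> X \<and> indep J \<and> card J = mrank indep X" if "indep I" "I \<subseteq> X" for I X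
    using that
  proof (induction "mrank indep X - card I" arbitrary: I rule: less_induct)
    case less
    show ?case
    proof (cases "card I = mrank indep X")
      case True
      then show ?thesis using less.prems by blast
    next
      case False
      then have lt: "card I < mrank indep X" using ge[OF less.prems] by simp
      obtain J where J: "J \<subseteq> X" "indep J" "card J = mrank indep X" using ex by blast
      obtain e where e: "e \<in> J - I" "indep (insert e I)" using aug[OF less.prems(1) J(2)] J lt by auto
      have fI: "finite I" using iE[OF less.prems(1)] fE finite_subset by blast
      have "card (insert e I) = Suc (card I)" using e fI by simp
      then have "mrank indep X - card (insert e I) < mrank indep X - card I" using lt by simp
      moreover have "insert e I \<subseteq> X" using e J less.prems by blast
      ultimately have "\<exists>K. insert e I \<subseteq> K \<and> K \<subseteq> X \<and> indep K \<and> card K = mrank indep X"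
        using less.hyps[of "insert e I"] e(2) by simp
      then show ?thesis by auto
    qed
  qed
qed

text \<open>Arguments are arbitrary sets, so minors need no rank function of their own: restriction
  to \<open>X\<close> and contraction by \<open>A\<close> are expressed by the pair of sets and the
  same \<open>r\<close>.\<close>

locale ranked =
  fixes r :: "'a set \<Rightarrow> nat"
  assumes r_empty: "r {} = 0"
    and r_mono: "A \<subseteq> B \<Longrightarrow> r A \<le> r B"
    and r_submod: "r (A \<union> B) + r (A \<inter> B) \<le> r A + r B"
    and r_single: "r {e} \<le> 1"

lemma ranked_mrank:
  assumes M: "matroid E indep"
  shows "ranked (mrank indep)"
proof
  note ge = mrank_ge[OF M] and ext = mrank_extend[OF M]
  have ie: "indep {}" and iE: "\<And>X. indep X \<Longrightarrow> finite X"
    and sub: "\<And>X Y. indep X \<Longrightarrow> Y \<subseteq> X \<Longrightarrow> indep Y"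
    using M by (auto simp: matroid_def dest: finite_subset)
  show "mrank indep {} = 0" using ext[OF ie, of "{}"] by auto
  show "mrank indep A \<le> mrank indep B" if "A \<subseteq> B" for A B
    using ext[OF ie, of A] ge[of _ B] that by force
  show "mrank indep {e} \<le> 1" for e
    using ext[OF ie, of "{e}"] by (auto simp: subset_singleton_iff)
  show "mrank indep (A \<union> B) + mrank indep (A \<inter> B) \<le> mrank indep A + mrank indep B" for A B
  proof -
    obtain I where I: "I \<subseteq> A \<inter> B" "indep I" "card I = mrank indep (A \<inter> B)"
      using ext[OF ie, of "A \<inter> B"] by auto
    obtain J where J: "I \<subseteq> J" "J \<subseteq> A \<union> B" "indep J" "card J = mrank indep (A \<union> B)"
      using ext[OF I(2), of "A \<union> B"] I by auto
    have fJ: "finite J" using J iE by auto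
    have "card J + card (J \<inter> A \<inter> B) = card (J \<inter> A) + card (J \<inter> B)"
    proof -
      have "J = (J \<inter> A) \<union> (J \<inter> B)" "J \<inter> A \<inter> B = (J \<inter> A) \<inter> (J \<inter> B)" using J by auto
      then show ?thesis using card_Un_Int[of "J \<inter> A" "J \<inter> B"] fJ by simp
    qed
    moreover have "card I \<le> card (J \<inter> A \<inter> B)" using I J fJ by (intro card_mono) auto
    moreover have "card (J \<inter> A) \<le> mrank indep A" "card (J \<inter> B) \<le> mrank indep B"
      using ge sub[OF J(3)] by auto
    ultimately show ?thesis using I J by simp
  qed
qed

text \<open>In a chain the union of the members below \<open>G\<close> is the largest of them;
  joined with \<open>A\<close> it is the predecessor of \<open>G\<close>, or \<open>A\<close> if
  there is none. These are the exponents of the Feichtner-Yuzvinsky basis after contraction by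
  \<open>A\<close>.\<close>

definition nested :: "('a set \<Rightarrow> nat) \<Rightarrow> 'a set set \<Rightarrow> 'a set \<Rightarrow> 'a set multiset set" where
  "nested r P A = {m. set_mset m \<subseteq> {G \<in> P. A \<subset> G} \<and> (\<forall>F\<in>#m. \<forall>G\<in>#m. F \<subseteq> G \<or> G \<subseteq> F) \<and>
     (\<forall>G\<in>#m. count m G < r G - r (A \<union> \<Union>{F \<in> set_mset m. F \<subset> G}))}"

text \<open>A general semiring is used because \<open>t\<close> is both the number 1, where this
  counts, and the power series \<open>fps_exp 1\<close>, where it is a moment generating
  series.\<close>

definition chow_sum :: "'b::comm_semiring_1 \<Rightarrow> ('a set \<Rightarrow> nat) \<Rightarrow> 'a set set \<Rightarrow> 'a set \<Rightarrow> 'b" where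
  "chow_sum t r P A = (\<Sum>m\<in>nested r P A. t ^ size m)"

definition step_weight :: "'b::comm_semiring_1 \<Rightarrow> nat \<Rightarrow> 'b" where
  "step_weight t n = (\<Sum>a\<in>{1..<n}. t ^ a)"

lemma upward_induct:
  assumes "finite P" and "\<And>A. (\<And>G. G \<in> P \<Longrightarrow> A \<subset> G \<Longrightarrow> Q G) \<Longrightarrow> Q A"
  shows "Q A"
proof (induction "card {G \<in> P. A \<subset> G}" arbitrary: A rule: less_induct)
  case less
  show ?case
  proof (rule assms(2))
    fix G assume "G \<in> P" "A \<subset> G"
    then have "{H \<in> P. G \<subset> H} \<subset> {H \<in> P. A \<subset> H}" by auto
    then show "Q G" using less psubset_card_mono[of "{H \<in> P. A \<subset> H}"] assms(1) by simp
  qed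
qed

lemma nested_empty [simp]: "{#} \<in> nested r P A"
  by (simp add: nested_def)

lemma nested_above: "m \<in> nested r P A \<Longrightarrow> G \<in># m \<Longrightarrow> G \<in> P \<and> A \<subset> G"
  by (auto simp: nested_def)

text \<open>The smallest flat \<open>G\<close> of the support is split off with its multiplicity
  \<open>a\<close>. For the flats above it \<open>G\<close> takes over the role of \<open>A\<close>,
  since it belongs to every union of lower members.\<close>

lemma nested_rec:
  "nested r P A = insert {#} (\<Union>G\<in>{G \<in> P. A \<subset> G}. \<Union>a\<in>{1..<r G - r A}. (+) (replicate_mset a G) ` nested r P G)"
  (is "_ = ?R")
proof (intro equalityI subsetI)
  fix m assume m: "m \<in> nested r P A"
  show "m \<in> ?R"
  proof (cases "m = {#}")
    case False
    have "finite (set_mset m)" "set_mset m \<noteq> {}" using False by auto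
    from finite_has_minimal[OF this] obtain G where G: "G \<in># m" "\<And>F. F \<in># m \<Longrightarrow> F \<subseteq> G \<Longrightarrow> F = G" by blast
    have chain: "\<And>F H. F \<in># m \<Longrightarrow> H \<in># m \<Longrightarrow> F \<subseteq> H \<or> H \<subseteq> F"
      and cnt: "\<And>H. H \<in># m \<Longrightarrow> count m H < r H - r (A \<union> \<Union>{F \<in> set_mset m. F \<subset> H})"
      using m by (auto simp: nested_def)
    have GP: "G \<in> P" "A \<subset> G" using nested_above[OF m G(1)] by auto
    have min: "G \<subseteq> F" if "F \<in># m" for F using chain[OF that G(1)] G(2)[OF that] by auto
    let ?m = "filter_mset (\<lambda>F. F \<noteq> G) m"
    have eq: "m = replicate_mset (count m G) G + ?m"
      by (simp add: multiset_eq_iff)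
    have "{F \<in> set_mset m. F \<subset> G} = {}" using min by auto
    then have c: "count m G < r G - r A" using cnt[OF G(1)] by (metis Sup_empty sup_bot.right_neutral)
    have "?m \<in> nested r P G"
      unfolding nested_def
    proof (intro CollectI conjI ballI)
      show "set_mset ?m \<subseteq> {H \<in> P. G \<subset> H}" using nested_above[OF m] min by auto
    next
      fix F H assume "F \<in># ?m" "H \<in># ?m"
      then show "F \<subseteq> H \<or> H \<subseteq> F" using chain by auto
    next
      fix H assume H: "H \<in># ?m"
      then have "G \<subset> H" using min by auto
      then have "A \<union> \<Union>{F \<in> set_mset m. F \<subset> H} = G \<union> \<Union>{F \<in> set_mset ?m. F \<subset> H}"
        using GP G(1) by auto
      then show "count ?m H < r H - r (G \<union> \<Union>{F \<in> set_mset ?m. F \<subset> H})"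
        using cnt[of H] H by auto
    qed
    then have "replicate_mset (count m G) G + ?m \<in> ?R"
      using GP c G(1) by (intro insertI2 UN_I[of G] UN_I[of "count m G"] imageI) auto
    then show ?thesis using eq by simp
  qed simp
next
  fix m assume "m \<in> ?R"
  moreover have "replicate_mset a G + m' \<in> nested r P A"
    if G: "G \<in> P" "A \<subset> G" and a: "a \<in> {1..<r G - r A}" and m': "m' \<in> nested r P G" for G a m'
    unfolding nested_def
  proof (intro CollectI conjI ballI)
    let ?m = "replicate_mset a G + m'"
    have set: "set_mset ?m = insert G (set_mset m')" using a by auto
    have ab: "\<And>H. H \<in># m' \<Longrightarrow> H \<in> P \<and> G \<subset> H" using nested_above[OF m'] by auto
    have Gm: "G \<notin># m'" using ab by blast
    show "set_mset ?m \<subseteq> {H \<in> P. A \<subset> H}" unfolding set using ab G by auto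
    fix H assume H: "H \<in># ?m"
    { fix F assume F: "F \<in># ?m"
      then show "F \<subseteq> H \<or> H \<subseteq> F" using H m' ab unfolding set nested_def by blast }
    show "count ?m H < r H - r (A \<union> \<Union>{F \<in> set_mset ?m. F \<subset> H})"
    proof (cases "H = G")
      case True
      have "{F \<in> set_mset ?m. F \<subset> H} = {}" unfolding set True using ab by auto
      then have "r (A \<union> \<Union>{F \<in> set_mset ?m. F \<subset> H}) = r A" by (simp only: Sup_empty sup_bot.right_neutral)
      then show ?thesis using a True Gm by (simp add: not_in_iff)
    next
      case False
      then have "H \<in># m'" using H set by auto
      moreover then have "A \<union> \<Union>{F \<in> set_mset ?m. F \<subset> H} = G \<union> \<Union>{F \<in> set_mset m'. F \<subset> H}"
        unfolding set using ab[of H] G by auto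
      ultimately show ?thesis using m' False by (auto simp: nested_def)
    qed
  qed
  ultimately show "m \<in> nested r P A" using nested_empty[of r P A] by blast
qed

lemma finite_nested:
  assumes "finite P"
  shows "finite (nested r P A)"
proof (rule upward_induct[OF assms])
  fix A assume IH: "\<And>G. G \<in> P \<Longrightarrow> A \<subset> G \<Longrightarrow> finite (nested r P G)"
  show "finite (nested r P A)" by (subst nested_rec) (use IH assms in auto)
qed

lemma chow_sum_rec:
  fixes t :: "'b::comm_semiring_1"
  assumes "finite P"
  shows "chow_sum t r P A = 1 + (\<Sum>G\<in>{G \<in> P. A \<subset> G}. step_weight t (r G - r A) * chow_sum t r P G)"
proof -
  let ?U = "{G \<in> P. A \<subset> G}"
  let ?S = "SIGMA G:?U. {1..<r G - r A} \<times> nested r P G"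
  let ?f = "\<lambda>(G, a, m). replicate_mset a G + m"
  have fin: "finite ?U" "\<And>A. finite (nested r P A)" using assms finite_nested by auto
  have inj: "inj_on ?f ?S"
  proof (rule inj_onI)
    fix x y assume x: "x \<in> ?S" and y: "y \<in> ?S" and xy: "?f x = ?f y"
    obtain G a m where Gam: "x = (G, a, m)" by (cases x)
    obtain H b n where Hbn: "y = (H, b, n)" by (cases y)
    have G: "G \<in> P" "1 \<le> a" "m \<in> nested r P G" and H: "H \<in> P" "1 \<le> b" "n \<in> nested r P H"
      and eq: "replicate_mset a G + m = replicate_mset b H + n"
      using x y xy Gam Hbn by auto
    have Gm: "\<And>F. F \<in># m \<Longrightarrow> G \<subset> F" and Hn: "\<And>F. F \<in># n \<Longrightarrow> H \<subset> F"
      using nested_above G(3) H(3) by blast+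
    have "insert G (set_mset m) = insert H (set_mset n)"
      using arg_cong[OF eq, of set_mset] G(2) H(2) by simp
    then have GH: "G = H" using Gm Hn by (metis insert_iff psubset_imp_subset subset_antisym insertI1)
    have "G \<notin># m" "G \<notin># n" using Gm Hn GH by blast+
    then have "a = b" using arg_cong[OF eq, of "\<lambda>m. count m G"] GH by (simp add: not_in_iff)
    then show "x = y" using GH eq Gam Hbn by simp
  qed
  have img: "nested r P A = insert {#} (?f ` ?S)"
  proof -
    have "(\<Union>G\<in>?U. \<Union>a\<in>{1..<r G - r A}. (+) (replicate_mset a G) ` nested r P G) = ?f ` ?S"
    proof (intro equalityI subsetI)
      fix m assume "m \<in> (\<Union>G\<in>?U. \<Union>a\<in>{1..<r G - r A}. (+) (replicate_mset a G) ` nested r P G)"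
      then obtain G a m' where "G \<in> ?U" "a \<in> {1..<r G - r A}" "m' \<in> nested r P G" "m = replicate_mset a G + m'"
        by blast
      then show "m \<in> ?f ` ?S" by (intro image_eqI[of _ _ "(G, a, m')"]) auto
    next
      fix m assume "m \<in> ?f ` ?S"
      then obtain x where x: "x \<in> ?S" "m = ?f x" by blast
      obtain G a m' where "x = (G, a, m')" by (cases x)
      then have "G \<in> ?U" "a \<in> {1..<r G - r A}" "m' \<in> nested r P G" "m = replicate_mset a G + m'"
        using x by auto
      then show "m \<in> (\<Union>G\<in>?U. \<Union>a\<in>{1..<r G - r A}. (+) (replicate_mset a G) ` nested r P G)"
        by blast
    qed
    then show ?thesis by (subst nested_rec) simp
  qed
  have nm: "{#} \<notin> ?f ` ?S" by auto
  have "chow_sum t r P A = 1 + (\<Sum>m\<in>?f ` ?S. t ^ size m)"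
    unfolding chow_sum_def img using nm fin by (subst sum.insert) auto
  also have "(\<Sum>m\<in>?f ` ?S. t ^ size m) = (\<Sum>(G, a, m)\<in>?S. t ^ a * t ^ size m)"
    by (subst sum.reindex[OF inj]) (auto intro!: sum.cong simp: power_add)
  also have "\<dots> = (\<Sum>G\<in>?U. \<Sum>(a, m)\<in>{1..<r G - r A} \<times> nested r P G. t ^ a * t ^ size m)"
    by (subst sum.Sigma) (use fin in auto)
  also have "\<dots> = (\<Sum>G\<in>?U. step_weight t (r G - r A) * chow_sum t r P G)"
    by (simp add: step_weight_def chow_sum_def sum_product sum.cartesian_product)
  finally show ?thesis .
qed

section \<open>Deletion\<close>

lemma step_weight_simps [simp]: "step_weight t 0 = 0" "step_weight t (Suc 0) = 0"
  by (simp_all add: step_weight_def)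

lemma step_weight_Suc:
  assumes "n > 0"
  shows "step_weight t (Suc n) = t * (1 + step_weight t n)"
proof -
  have "step_weight t (Suc n) = (\<Sum>a\<in>{0..<n}. t ^ Suc a)"
    unfolding step_weight_def One_nat_def by (subst sum.shift_bounds_Suc_ivl) simp
  also have "\<dots> = t * (\<Sum>a\<in>{0..<n}. t ^ a)" by (simp add: sum_distrib_left)
  also have "(\<Sum>a\<in>{0..<n}. t ^ a) = 1 + step_weight t n"
    using assms by (simp add: sum.atLeast_Suc_lessThan step_weight_def)
  finally show ?thesis .
qed

lemma chow_sum_cong:
  assumes "{G \<in> P. A \<subset> G} = {G \<in> P'. A \<subset> G}"
  shows "chow_sum t r P A = chow_sum t r P' A"
  unfolding chow_sum_def nested_def assms ..

lemma chow_sum_top: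
  assumes "{G \<in> P. A \<subset> G} = {}"
  shows "chow_sum t r P A = 1"
proof -
  have "nested r P A = {{#}}" unfolding nested_def assms by auto
  then show ?thesis by (simp add: chow_sum_def)
qed

lemma chow_sum_iso:
  assumes fin: "finite P" "finite P'" and bij: "bij_betw \<phi> P P'"
    and ord: "\<And>F G. F \<in> P \<Longrightarrow> G \<in> P \<Longrightarrow> \<phi> F \<subset> \<phi> G \<longleftrightarrow> F \<subset> G"
    and rk: "\<And>F. F \<in> P \<Longrightarrow> r (\<phi> F) = r F"
  shows "A \<in> P \<Longrightarrow> chow_sum t r P' (\<phi> A) = chow_sum t r P A"
proof (induction rule: upward_induct[OF fin(1), where A = A])
  case (1 A)
  have im: "{G \<in> P'. \<phi> A \<subset> G} = \<phi> ` {G \<in> P. A \<subset> G}"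
    using bij ord[OF 1(2)] unfolding bij_betw_def by blast
  have inj: "inj_on \<phi> {G \<in> P. A \<subset> G}" using bij by (auto simp: bij_betw_def inj_on_def)
  show ?case
    unfolding chow_sum_rec[OF fin(1), of _ _ A] chow_sum_rec[OF fin(2), of _ _ "\<phi> A"] im
    by (subst sum.reindex[OF inj]) (use 1 rk in \<open>auto intro!: sum.cong\<close>)
qed

text \<open>Chains are sorted by their first member \<open>G\<close> in \<open>T\<close>.
  \<open>Q F G\<close> is the weight of the pieces from \<open>F\<close> to \<open>G\<close> with
  all intermediate members in \<open>P\<close>, and the hypothesis is its recursion over the first
  step above \<open>F\<close>.\<close>

lemma chow_sum_split:
  fixes t :: "'b::comm_semiring_1"
  assumes fin: "finite P" "finite T" and disj: "P \<inter> T = {}"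
    and Q: "\<And>F G. F \<in> P \<Longrightarrow> G \<in> T \<Longrightarrow> F \<subset> G \<Longrightarrow>
      Q F G = step_weight t (r G - r F) + (\<Sum>H\<in>{H \<in> P. F \<subset> H \<and> H \<subset> G}. step_weight t (r H - r F) * Q H G)"
  shows "A \<in> P \<Longrightarrow> chow_sum t r (P \<union> T) A =
    chow_sum t r P A + (\<Sum>G\<in>{G \<in> T. A \<subset> G}. Q A G * chow_sum t r (P \<union> T) G)"
proof (induction rule: upward_induct[OF fin(1), where A = A])
  case (1 A)
  let ?w = "\<lambda>F G. step_weight t (r G - r F)" and ?K = "chow_sum t r (P \<union> T)"
  let ?PA = "{G \<in> P. A \<subset> G}" and ?TA = "{G \<in> T. A \<subset> G}"
  have finA: "finite ?PA" "finite ?TA" using fin by auto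
  have "{G \<in> P \<union> T. A \<subset> G} = ?PA \<union> ?TA" "?PA \<inter> ?TA = {}" using disj by auto
  then have "?K A = 1 + ((\<Sum>H\<in>?PA. ?w A H * ?K H) + (\<Sum>G\<in>?TA. ?w A G * ?K G))"
    using fin finA by (subst chow_sum_rec) (simp_all add: sum.union_disjoint)
  also have "(\<Sum>H\<in>?PA. ?w A H * ?K H) =
      (\<Sum>H\<in>?PA. ?w A H * chow_sum t r P H) + (\<Sum>H\<in>?PA. \<Sum>G\<in>{G \<in> T. H \<subset> G}. ?w A H * Q H G * ?K G)"
    unfolding sum.distrib[symmetric]
    by (rule sum.cong) (use 1 in \<open>auto simp: distrib_left sum_distrib_left mult.assoc\<close>)
  also have "(\<Sum>H\<in>?PA. \<Sum>G\<in>{G \<in> T. H \<subset> G}. ?w A H * Q H G * ?K G) =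
      (\<Sum>G\<in>?TA. \<Sum>H\<in>{H \<in> P. A \<subset> H \<and> H \<subset> G}. ?w A H * Q H G * ?K G)"
  proof -
    have "(\<Sum>H\<in>?PA. \<Sum>G\<in>{G \<in> T. H \<subset> G}. ?w A H * Q H G * ?K G) =
      (\<Sum>H\<in>?PA. \<Sum>G\<in>{G \<in> ?TA. H \<subset> G}. ?w A H * Q H G * ?K G)"
      by (intro sum.cong) auto
    also have "\<dots> = (\<Sum>G\<in>?TA. \<Sum>H\<in>{H \<in> ?PA. H \<subset> G}. ?w A H * Q H G * ?K G)"
      by (rule sum.swap_restrict) (use finA in auto)
    finally show ?thesis by (simp add: conj_ac)
  qed
  also have "1 + (((\<Sum>H\<in>?PA. ?w A H * chow_sum t r P H) +
       (\<Sum>G\<in>?TA. \<Sum>H\<in>{H \<in> P. A \<subset> H \<and> H \<subset> G}. ?w A H * Q H G * ?K G)) + (\<Sum>G\<in>?TA. ?w A G * ?K G)) =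
     chow_sum t r P A + (\<Sum>G\<in>?TA. (?w A G + (\<Sum>H\<in>{H \<in> P. A \<subset> H \<and> H \<subset> G}. ?w A H * Q H G)) * ?K G)"
    unfolding chow_sum_rec[OF fin(1), of _ _ A]
    by (simp add: distrib_right sum.distrib sum_distrib_right add_ac)
  also have "(\<Sum>G\<in>?TA. (?w A G + (\<Sum>H\<in>{H \<in> P. A \<subset> H \<and> H \<subset> G}. ?w A H * Q H G)) * ?K G) =
     (\<Sum>G\<in>?TA. Q A G * ?K G)"
    by (rule sum.cong) (use Q[OF 1(2)] in auto)
  finally show ?case .
qed

context ranked
begin

lemma r_insert_le: "r (insert e A) \<le> Suc (r A)"
  using r_submod[of "{e}" A] r_single[of e] by simp

lemma r_insert_same_mono:
  assumes "A \<subseteq> B" "r (insert e A) = r A"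
  shows "r (insert e B) = r B"
proof -
  have "insert e A \<union> B = insert e B" using assms by auto
  moreover have "r A \<le> r (insert e A \<inter> B)" using assms by (intro r_mono) auto
  moreover have "r B \<le> r (insert e B)" by (intro r_mono) auto
  ultimately show ?thesis using r_submod[of "insert e A" B] assms by simp
qed

lemma r_less_insert: "r (insert e A) \<noteq> r A \<Longrightarrow> r A < r (insert e A)"
  using r_mono[OF subset_insertI, of A e] by auto

section \<open>Flats of a minor, and its Hilbert series\<close>

definition lat :: "'a set \<Rightarrow> 'a set \<Rightarrow> 'a set set" where
  "lat A X = {F. A \<subseteq> F \<and> F \<subseteq> X \<and> (\<forall>e\<in>X - F. r F < r (insert e F))}"

text \<open>The Hilbert series of the minor obtained by restriction to \<open>X\<close> and
  contraction by \<open>A\<close>; its flats are represented by the flats of the restriction that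
  contain \<open>A\<close>.\<close>

definition chow :: "'b::comm_semiring_1 \<Rightarrow> 'a set \<Rightarrow> 'a set \<Rightarrow> 'b" where
  "chow t A X = chow_sum t r (lat A X) A"

lemma finite_lat: "finite X \<Longrightarrow> finite (lat A X)"
  by (rule finite_subset[of _ "Pow X"]) (auto simp: lat_def)

lemma lat_subset: "F \<in> lat A X \<Longrightarrow> A \<subseteq> F" "F \<in> lat A X \<Longrightarrow> F \<subseteq> X"
  by (auto simp: lat_def)

lemma latI: "A \<subseteq> F \<Longrightarrow> F \<subseteq> X \<Longrightarrow> (\<And>e. e \<in> X \<Longrightarrow> e \<notin> F \<Longrightarrow> r F < r (insert e F)) \<Longrightarrow> F \<in> lat A X"
  by (auto simp: lat_def)

lemma lat_less: "F \<in> lat A X \<Longrightarrow> e \<in> X \<Longrightarrow> e \<notin> F \<Longrightarrow> r F < r (insert e F)"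
  by (auto simp: lat_def)

lemma lat_mem: "F \<in> lat A X \<Longrightarrow> e \<in> X \<Longrightarrow> r (insert e F) = r F \<Longrightarrow> e \<in> F"
  using lat_less by force

lemma lat_strict:
  assumes F: "F \<in> lat A X" and G: "G \<subseteq> X" "F \<subset> G"
  shows "r F < r G"
proof -
  obtain e where e: "e \<in> G" "e \<notin> F" using G by auto
  then have "r F < r (insert e F)" using lat_less[OF F] G by auto
  also have "\<dots> \<le> r G" using e G by (intro r_mono) auto
  finally show ?thesis .
qed

lemma lat_insert_rank: "F \<in> lat A X \<Longrightarrow> e \<in> X - F \<Longrightarrow> r (insert e F) = Suc (r F)"
  using r_insert_le[of e F] lat_less[of F A X e] by auto

lemma lat_restrict:
  assumes G: "G \<in> lat A X"
  shows "lat A G = {F \<in> lat A X. F \<subseteq> G}"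
proof (intro equalityI subsetI)
  fix F assume F: "F \<in> lat A G"
  note sub = lat_subset[OF F] lat_subset[OF G]
  have "F \<in> lat A X"
  proof (rule latI)
    fix e assume e: "e \<in> X" "e \<notin> F"
    show "r F < r (insert e F)"
    proof (cases "e \<in> G")
      case True
      then show ?thesis using lat_less[OF F] e by blast
    next
      case False
      then have "r (insert e F) \<noteq> r F"
        using r_insert_same_mono[OF sub(2)] lat_mem[OF G e(1)] by blast
      then show ?thesis by (rule r_less_insert)
    qed
  qed (use sub in auto)
  then show "F \<in> {F \<in> lat A X. F \<subseteq> G}" using sub by auto
next
  fix F assume "F \<in> {F \<in> lat A X. F \<subseteq> G}"
  then show "F \<in> lat A G" using lat_subset[OF G] by (intro latI) (auto dest: lat_subset lat_less)
qed

lemma chow_sum_lat_above: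
  assumes "A \<subseteq> G"
  shows "chow_sum t r (lat A X) G = chow t G X"
  unfolding chow_def by (rule chow_sum_cong) (use assms in \<open>auto simp: lat_def\<close>)

lemma chow_self: "chow t X X = 1"
  unfolding chow_def by (rule chow_sum_top) (auto simp: lat_def)

text \<open>Removing \<open>i\<close> maps the flats without \<open>i\<close> as a coloop
  isomorphically onto the flats of the deletion and preserves rank. The inverse keeps
  \<open>F'\<close> if it is a flat of \<open>X\<close> and adds \<open>i\<close> otherwise.\<close>

lemma chow_delete_iso:
  assumes X: "finite X" and A: "A \<in> lat A X" and i: "i \<in> X - A"
  shows "chow_sum t r {F \<in> lat A X. \<not> (i \<in> F \<and> F - {i} \<in> lat A X)} A = chow t A (X - {i})"
proof -
  let ?P = "{F \<in> lat A X. \<not> (i \<in> F \<and> F - {i} \<in> lat A X)}"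
  have rk: "r (F - {i}) = r F" if F: "F \<in> ?P" for F
  proof (cases "i \<in> F")
    case True
    have FL: "F \<in> lat A X" and n: "F - {i} \<notin> lat A X" using F True by auto
    have "A \<subseteq> F - {i}" "F - {i} \<subseteq> X" using lat_subset[OF FL] i by auto
    then obtain e where e: "e \<in> X" "e \<notin> F - {i}" "\<not> r (F - {i}) < r (insert e (F - {i}))"
      using n latI by blast
    then have e2: "r (insert e (F - {i})) = r (F - {i})" using r_less_insert by blast
    have "r (insert e F) = r F" using r_insert_same_mono[OF _ e2, of F] by auto
    then have "e \<in> F" using lat_mem[OF FL e(1)] by blast
    then have "e = i" using e by auto
    then show ?thesis using e2 True by (simp add: insert_absorb)
  qed simp
  have above: "i \<in> G" if F: "F \<in> ?P" and G: "G \<in> ?P" and FG: "F - {i} \<subseteq> G" and iF: "i \<in> F" for F G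
  proof -
    have "r (insert i (F - {i})) = r (F - {i})" using rk[OF F] iF by (simp add: insert_absorb)
    then have "r (insert i G) = r G" using r_insert_same_mono FG by blast
    then show ?thesis using lat_mem[of G A X i] G i by blast
  qed
  have sub: "F \<subseteq> G \<longleftrightarrow> F - {i} \<subseteq> G - {i}" if "F \<in> ?P" "G \<in> ?P" for F G
    using above[OF that] by blast
  have inj: "inj_on (\<lambda>F. F - {i}) ?P"
  proof (rule inj_onI)
    fix F G assume "F \<in> ?P" "G \<in> ?P" "F - {i} = G - {i}"
    then show "F = G" using sub[of F G] sub[of G F] by blast
  qed
  have img: "(\<lambda>F. F - {i}) ` ?P = lat A (X - {i})"
  proof (intro equalityI subsetI)
    fix F' assume "F' \<in> (\<lambda>F. F - {i}) ` ?P"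
    then obtain F where F: "F \<in> lat A X" "F' = F - {i}" by auto
    show "F' \<in> lat A (X - {i})"
    proof (rule latI)
      fix e assume e: "e \<in> X - {i}" "e \<notin> F'"
      then have "r (insert e F) \<noteq> r F" using lat_mem[OF F(1), of e] F(2) by auto
      then have "r (insert e F') \<noteq> r F'" using r_insert_same_mono[of F' F e] F by auto
      then show "r F' < r (insert e F')" by (rule r_less_insert)
    qed (use F i lat_subset[OF F(1)] in auto)
  next
    fix F' assume F': "F' \<in> lat A (X - {i})"
    note sub = lat_subset[OF F']
    have iF': "i \<notin> F'" using sub by auto
    show "F' \<in> (\<lambda>F. F - {i}) ` ?P"
    proof (cases "r (insert i F') = r F'")
      case False
      have "F' \<in> lat A X"
      proof (rule latI)
        fix e assume "e \<in> X" "e \<notin> F'"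
        then show "r F' < r (insert e F')" using lat_less[OF F', of e] r_less_insert[OF False] by (cases "e = i") auto
      qed (use sub in auto)
      then show ?thesis using iF' by (intro image_eqI[of _ _ F']) auto
    next
      case True
      have "insert i F' \<in> lat A X"
      proof (rule latI)
        fix e assume e: "e \<in> X" "e \<notin> insert i F'"
        then have "r F' < r (insert e F')" using lat_less[OF F', of e] by auto
        also have "\<dots> \<le> r (insert e (insert i F'))" by (intro r_mono) auto
        finally show "r (insert i F') < r (insert e (insert i F'))" using True by simp
      qed (use sub i in auto)
      moreover have "F' \<notin> lat A X" using True iF' i lat_mem[of F' A X i] by blast
      ultimately have "insert i F' \<in> ?P" using iF' by auto
      then show ?thesis using iF' by (intro image_eqI[of _ _ "insert i F'"]) auto
    qed
  qed
  have AP: "A \<in> ?P" using A i by auto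
  have "chow_sum t r (lat A (X - {i})) (A - {i}) = chow_sum t r ?P A"
  proof (rule chow_sum_iso[where \<phi> = "\<lambda>F. F - {i}"])
    show "finite ?P" "finite (lat A (X - {i}))" using X finite_lat by auto
    show "bij_betw (\<lambda>F. F - {i}) ?P (lat A (X - {i}))" using inj img by (simp add: bij_betw_def)
    show "F - {i} \<subset> G - {i} \<longleftrightarrow> F \<subset> G" if "F \<in> ?P" "G \<in> ?P" for F G
      using sub[OF that] sub[OF that(2,1)] by blast
  qed (use rk AP in blast)+
  then show ?thesis using i by (simp add: chow_def)
qed

text \<open>Chains of flats that meet the set of flats containing \<^term>\<open>i\<close> as a coloop are grouped by
  their smallest such member \<^term>\<open>insert i G\<close>; the chains below it add up to \<^term>\<open>t * chow t A G\<close>.\<close>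

theorem chow_deletion:
  fixes t :: "'b::comm_semiring_1"
  assumes X: "finite X" and A: "A \<in> lat A X" and i: "i \<in> X - A"
  shows "chow t A X = chow t A (X - {i}) +
    t * (\<Sum>G\<in>{G \<in> lat A X. i \<notin> G \<and> A \<subset> G \<and> insert i G \<in> lat A X}. chow t A G * chow t (insert i G) X)"
proof -
  let ?P = "{F \<in> lat A X. \<not> (i \<in> F \<and> F - {i} \<in> lat A X)}"
  let ?T = "{F \<in> lat A X. i \<in> F \<and> F - {i} \<in> lat A X}"
  \<comment> \<open>A last step of rank one admits no exponent, whence the value 0. Otherwise
    \<open>step_weight_Suc\<close> applies to the last step: it contributes \<open>t\<close> times
    the choice between stopping and a further step to \<open>G - {i}\<close>, which produces the
    chains of the smaller lattice.\<close>
  define Q :: "'a set \<Rightarrow> 'a set \<Rightarrow> 'b" where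
    "Q F G = (if F = G - {i} then 0 else t * chow_sum t r (lat A (G - {i})) F)" for F G
  have fin: "finite ?P" "finite ?T" using finite_lat[OF X] by auto
  have PT: "?P \<union> ?T = lat A X" "?P \<inter> ?T = {}" by auto
  \<comment> \<open>A coloop of a flat is a coloop of every smaller flat that contains it, so a
    member of \<open>?P\<close> below a member of \<open>?T\<close> must avoid
    \<open>i\<close>.\<close>
  have notin: "i \<notin> F" if F: "F \<in> ?P" and G: "G \<in> ?T" and FG: "F \<subset> G" for F G
  proof
    assume iF: "i \<in> F"
    have G': "G - {i} \<in> lat A X" and F': "F \<in> lat A X" using F G by auto
    have "F - {i} \<in> lat A X"
    proof (rule latI)
      fix e assume e: "e \<in> X" "e \<notin> F - {i}"
      have "r (insert e (F - {i})) \<noteq> r (F - {i})"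
      proof (cases "e = i")
        case True
        have "r (insert i (G - {i})) \<noteq> r (G - {i})" using lat_mem[OF G' e(1)] True by auto
        then show ?thesis using True r_insert_same_mono[of "F - {i}" "G - {i}" i] FG by blast
      next
        case False
        then have "r (insert e F) \<noteq> r F" using lat_mem[OF F' e(1)] e(2) by auto
        then show ?thesis using r_insert_same_mono[of "F - {i}" F e] by auto
      qed
      then show "r (F - {i}) < r (insert e (F - {i}))" by (rule r_less_insert)
    qed (use lat_subset[OF F'] i in auto)
    then show False using F iF by auto
  qed
  have "chow_sum t r (?P \<union> ?T) A =
    chow_sum t r ?P A + (\<Sum>G\<in>{G \<in> ?T. A \<subset> G}. Q A G * chow_sum t r (?P \<union> ?T) G)"
  proof (rule chow_sum_split[OF fin PT(2)])
    show "A \<in> ?P" using A i by auto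
    fix F G assume F: "F \<in> ?P" and G: "G \<in> ?T" and FG: "F \<subset> G"
    let ?G = "G - {i}"
    have G': "?G \<in> lat A X" "i \<in> G" using G by auto
    have GX: "G \<subseteq> X" using G by (auto simp: lat_def)
    have rG: "r G = Suc (r ?G)" using lat_insert_rank[OF G'(1), of i] G' i by (simp add: insert_absorb)
    have iF: "i \<notin> F" using notin[OF F G FG] .
    have FG': "F \<subseteq> ?G" using FG iF by auto
    have fG: "finite (lat A ?G)" using finite_lat X GX finite_subset by (metis Diff_subset)
    have set: "{H \<in> ?P. F \<subset> H \<and> H \<subset> G} = {H \<in> lat A ?G. F \<subset> H}"
    proof -
      have "H \<subset> G \<longleftrightarrow> H \<subseteq> ?G" if "H \<in> ?P" for H using notin[OF that G] G'(2) by blast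
      moreover have "H \<in> ?P" if "H \<in> lat A X" "H \<subseteq> ?G" for H using that by auto
      ultimately show ?thesis unfolding lat_restrict[OF G'(1)] by blast
    qed
    show "Q F G = step_weight t (r G - r F) +
        (\<Sum>H\<in>{H \<in> ?P. F \<subset> H \<and> H \<subset> G}. step_weight t (r H - r F) * Q H G)"
    proof (cases "F = ?G")
      case True
      then have e: "{H \<in> lat A ?G. F \<subset> H} = {}" by (auto simp: lat_def)
      show ?thesis unfolding set e sum.empty using True rG by (simp add: Q_def)
    next
      case False
      then have lt: "r F < r ?G" using lat_strict[of F A X ?G] F FG' GX by auto
      have Gin: "?G \<in> {H \<in> lat A ?G. F \<subset> H}" using False FG' G' by (auto simp: lat_def)
      have top: "chow_sum t r (lat A ?G) ?G = 1"
        by (rule chow_sum_top) (auto simp: lat_def)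
      let ?S = "{H \<in> lat A ?G. F \<subset> H} - {?G}"
      have fS: "finite {H \<in> lat A ?G. F \<subset> H}" using fG by auto
      have "(\<Sum>H\<in>{H \<in> lat A ?G. F \<subset> H}. step_weight t (r H - r F) * Q H G) =
         (\<Sum>H\<in>?S. step_weight t (r H - r F) * (t * chow_sum t r (lat A ?G) H))"
        unfolding sum.remove[OF fS Gin] by (auto simp: Q_def intro!: sum.cong)
      moreover have "chow_sum t r (lat A ?G) F = 1 + (step_weight t (r ?G - r F) +
         (\<Sum>H\<in>?S. step_weight t (r H - r F) * chow_sum t r (lat A ?G) H))"
        by (subst chow_sum_rec[OF fG]) (simp add: sum.remove[OF fS Gin] top)
      moreover have "step_weight t (r G - r F) = t * (1 + step_weight t (r ?G - r F))"
        using step_weight_Suc[of "r ?G - r F" t] lt rG by (simp add: Suc_diff_le)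
      ultimately show ?thesis unfolding set using False
        by (simp add: Q_def distrib_left sum_distrib_left mult_ac add_ac)
    qed
  qed
  moreover have "(\<Sum>G\<in>{G \<in> ?T. A \<subset> G}. Q A G * chow_sum t r (?P \<union> ?T) G) =
    t * (\<Sum>G\<in>{G \<in> lat A X. i \<notin> G \<and> A \<subset> G \<and> insert i G \<in> lat A X}. chow t A G * chow t (insert i G) X)"
  proof -
    let ?S = "{G \<in> lat A X. i \<notin> G \<and> A \<subset> G \<and> insert i G \<in> lat A X}"
    \<comment> \<open>The flat \<open>insert i A\<close> is left out because \<open>Q\<close>
      vanishes there; this is why \<open>G\<close> runs over flats strictly above
      \<open>A\<close>.\<close>
    have eq: "{G \<in> ?T. A \<subset> G} - {insert i A} = insert i ` ?S"
    proof (intro equalityI subsetI)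
      fix G assume G: "G \<in> {G \<in> ?T. A \<subset> G} - {insert i A}"
      then have "A \<subset> G - {i}" using i by auto
      then have "G - {i} \<in> ?S" using G by (auto simp: insert_absorb)
      then show "G \<in> insert i ` ?S" using G by (intro image_eqI[of _ _ "G - {i}"]) auto
    next
      fix G assume "G \<in> insert i ` ?S"
      then obtain H where "H \<in> ?S" "G = insert i H" by auto
      then show "G \<in> {G \<in> ?T. A \<subset> G} - {insert i A}" using i by auto
    qed
    have inj: "inj_on (insert i) ?S" by (rule inj_onI) auto
    have "(\<Sum>G\<in>{G \<in> ?T. A \<subset> G}. Q A G * chow_sum t r (?P \<union> ?T) G) =
       (\<Sum>G\<in>insert i ` ?S. Q A G * chow_sum t r (?P \<union> ?T) G)"
      unfolding eq[symmetric] by (rule sum.mono_neutral_right) (use finite_lat[OF X] i in \<open>auto simp: Q_def\<close>)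
    also have "\<dots> = (\<Sum>G\<in>?S. t * (chow t A G * chow t (insert i G) X))"
      unfolding sum.reindex[OF inj] PT(1)
    proof (rule sum.cong[OF refl])
      fix G assume G: "G \<in> ?S"
      then have "insert i G - {i} = G" "A \<noteq> G" by auto
      moreover have "chow_sum t r (lat A X) (insert i G) = chow t (insert i G) X"
        using G by (intro chow_sum_lat_above) auto
      ultimately show "((\<lambda>G. Q A G * chow_sum t r (lat A X) G) \<circ> insert i) G = t * (chow t A G * chow t (insert i G) X)"
        by (simp add: Q_def chow_def mult.assoc)
    qed
    finally show ?thesis by (simp add: sum_distrib_left)
  qed
  ultimately show ?thesis unfolding chow_delete_iso[OF assms] PT(1) by (simp add: chow_def)
qed

end

section \<open>Coefficientwise bounds for power series\<close>

unbundle no vec_syntax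
unbundle fps_syntax

text \<open>Nonnegativity is part of the relation so that it is preserved by products.\<close>

definition dominated :: "real fps \<Rightarrow> real fps \<Rightarrow> bool" where
  "dominated f g \<longleftrightarrow> (\<forall>n. 0 \<le> f $ n \<and> f $ n \<le> g $ n)"

lemma dominated_self: "dominated f g \<Longrightarrow> dominated g g"
  unfolding dominated_def by (meson order_refl order_trans)

lemma dominated_trans: "dominated f g \<Longrightarrow> dominated g h \<Longrightarrow> dominated f h"
  unfolding dominated_def by (meson order_trans)

lemma dominated_add: "dominated f g \<Longrightarrow> dominated f' g' \<Longrightarrow> dominated (f + f') (g + g')"
  unfolding dominated_def by (auto intro: add_mono)

lemma dominated_mult:
  assumes "dominated f g" "dominated f' g'"
  shows "dominated (f * f') (g * g')"
proof -
  have nn: "0 \<le> f $ n" "0 \<le> f' $ n" "0 \<le> g $ n" and le: "f $ n \<le> g $ n" "f' $ n \<le> g' $ n" for n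
    using assms dominated_self[OF assms(1)] by (simp_all add: dominated_def)
  show ?thesis unfolding dominated_def fps_mult_nth
    by (intro allI conjI sum_nonneg sum_mono mult_mono mult_nonneg_nonneg nn le)
qed

lemma dominated_const_mult: "0 \<le> c \<Longrightarrow> dominated f g \<Longrightarrow> dominated (fps_const c * f) (fps_const c * g)"
  unfolding dominated_def by (auto intro: mult_left_mono)

lemma dominated_sum:
  "(\<And>x. x \<in> S \<Longrightarrow> dominated (f x) (g x)) \<Longrightarrow> dominated (sum f S) (sum g S)"
  unfolding dominated_def by (auto simp: fps_sum_nth intro!: sum_nonneg sum_mono)

text \<open>The moment generating series of the centred normal law of variance
  \<open>a / 12\<close>. In the bounds \<open>a\<close> is the rank plus one.\<close>

definition gauss :: "real \<Rightarrow> real fps" where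
  "gauss a = fps_exp (a / 24) oo fps_X ^ 2"

lemma compose_X_square_nth: "(f oo fps_X ^ 2) $ n = (if even n then f $ (n div 2) else (0::real))"
proof -
  have "(f oo fps_X ^ 2) $ n = (\<Sum>i = 0..n. if 2 * i = n then f $ i else 0)"
    unfolding fps_compose_nth power_mult[symmetric] by (intro sum.cong) (auto simp: fps_X_power_nth)
  also have "\<dots> = (\<Sum>i\<in>(if even n then {n div 2} else {}). f $ i)"
    by (rule sum.mono_neutral_cong_right) (auto split: if_splits)
  finally show ?thesis by simp
qed

lemma gauss_nth: "gauss a $ n = (if even n then (a / 24) ^ (n div 2) / fact (n div 2) else 0)"
  by (simp add: gauss_def compose_X_square_nth)

lemma gauss_nth_even: "gauss a $ (2 * k) = a ^ k / (24 ^ k * fact k)"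
  by (simp add: gauss_nth power_divide)

lemma gauss_add: "gauss (a + b) = gauss a * gauss b"
  unfolding gauss_def by (simp add: add_divide_distrib fps_exp_add_mult fps_compose_mult_distrib)

lemma gauss_self: "0 \<le> a \<Longrightarrow> dominated (gauss a) (gauss a)"
  by (auto simp: dominated_def gauss_nth)

text \<open>In the scale \<open>24 ^ k * fact k\<close> the coefficients of \<open>gauss a\<close>
  are the powers of \<open>a\<close>, so that only numerical inequalities remain.\<close>

lemma dominated_gaussI:
  assumes "\<And>n. odd n \<Longrightarrow> f $ n = 0"
    and "\<And>k. f $ (2 * k) = \<phi> k / (24 ^ k * fact k)"
    and "\<And>k. 0 \<le> \<phi> k" "\<And>k. \<phi> k \<le> c * a ^ k"
  shows "dominated f (fps_const c * gauss a)"
  unfolding dominated_def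
proof
  fix n
  show "0 \<le> f $ n \<and> f $ n \<le> (fps_const c * gauss a) $ n"
  proof (cases "even n")
    case True
    then obtain k where n: "n = 2 * k" by auto
    have "(fps_const c * gauss a) $ n = c * a ^ k / (24 ^ k * fact k)"
      by (simp add: n gauss_nth power_divide)
    then show ?thesis using assms(2)[of k] assms(3,4)[of k] by (simp add: n divide_right_mono)
  qed (use assms in \<open>simp add: gauss_nth\<close>)
qed

section \<open>Hyperbolic cosines compared with Gaussian series\<close>

definition cosh_fps :: "real \<Rightarrow> real fps" where
  "cosh_fps m = fps_const (1 / 2) * (fps_exp (m / 2) + fps_exp (- (m / 2)))"

text \<open>The quotient of the coefficients of degree \<open>2 * k\<close> in
  \<open>cosh (s/2)\<close> and in \<open>gauss 1\<close>. It exceeds 1 only for \<open>k\<close> =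
  1, 2, 3.\<close>

definition cosh_ratio :: "nat \<Rightarrow> real" where
  "cosh_ratio k = 6 ^ k * fact k / fact (2 * k)"

lemma cosh_fps_nth_odd: "odd n \<Longrightarrow> cosh_fps m $ n = 0"
  by (simp add: cosh_fps_def power_minus_odd)

lemma cosh_fps_nth_even: "cosh_fps m $ (2 * k) = (m\<^sup>2) ^ k * cosh_ratio k / (24 ^ k * fact k)"
proof -
  have "cosh_fps m $ (2 * k) = (m / 2) ^ (2 * k) / fact (2 * k)"
    by (simp add: cosh_fps_def)
  moreover have "(m / 2) ^ (2 * k) = (m\<^sup>2) ^ k / 4 ^ k" by (simp add: power_mult power_divide)
  moreover have "(24::real) ^ k = 4 ^ k * 6 ^ k" by (simp flip: power_mult_distrib)
  ultimately show ?thesis by (simp add: cosh_ratio_def)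
qed

lemma cosh_fps_mult:
  "cosh_fps a * cosh_fps b = fps_const (1 / 2) * (cosh_fps (a + b) + cosh_fps (a - b))"
proof -
  have e: "fps_exp (x / 2) * fps_exp (y / 2) = fps_exp ((x + y) / 2 :: real)" for x y
    by (simp add: add_divide_distrib fps_exp_add_mult)
  have ring: "(h * (x + x')) * (h * (y + y')) = h * (h * (x * y + x' * y') + h * (x * y' + x' * y))"
    for h x x' y y' :: "real fps"
    by (simp add: algebra_simps)
  show ?thesis
    unfolding cosh_fps_def minus_divide_left ring e by (simp add: algebra_simps)
qed

lemma cosh_fps_0: "cosh_fps 0 = 1"
  by (simp add: cosh_fps_def numeral_fps_const)

lemma cosh_ratio_0: "cosh_ratio 0 = 1"
  by (simp add: cosh_ratio_def)

lemma cosh_ratio_Suc: "cosh_ratio (Suc k) = cosh_ratio k * (3 / (2 * real k + 1))"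
proof -
  have frac: "6 * a * (p * b) / (2 * p * (w * c)) = a * b / c * (3 / w)" if "p \<noteq> 0" for a b c p w :: real
    using that by simp
  have "fact (2 * Suc k) = 2 * (real k + 1) * ((2 * real k + 1) * fact (2 * k))"
    by (simp add: algebra_simps)
  moreover have "fact (Suc k) = (real k + 1) * fact k" by (simp add: algebra_simps)
  ultimately show ?thesis unfolding cosh_ratio_def power_Suc by (simp only:) (rule frac, simp)
qed

lemma cosh_ratio_nonneg: "0 \<le> cosh_ratio k"
  by (simp add: cosh_ratio_def)

lemma cosh_ratio_1: "cosh_ratio 1 = 3" and cosh_ratio_2: "cosh_ratio 2 = 3"
  and cosh_ratio_3: "cosh_ratio 3 = 9 / 5" and cosh_ratio_4: "cosh_ratio 4 = 27 / 35"
  by (simp_all add: cosh_ratio_def fact_numeral)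

lemma cosh_ratio_le_1: "4 \<le> k \<Longrightarrow> cosh_ratio k \<le> 1"
proof (induction k rule: dec_induct)
  case (step k)
  then have "3 / (2 * real k + 1) \<le> 1" by simp
  then have "cosh_ratio k * (3 / (2 * real k + 1)) \<le> 1 * 1" using step by (intro mult_mono) auto
  then show ?case by (simp add: cosh_ratio_Suc)
qed (simp add: cosh_ratio_4)

lemma nat_cases_4:
  assumes "P 0" "P 1" "P 2" "P 3" "\<And>k. 4 \<le> k \<Longrightarrow> P k"
  shows "P (k::nat)"
proof -
  consider "k = 0" | "k = 1" | "k = 2" | "k = 3" | "4 \<le> k" by linarith
  then show ?thesis using assms by cases auto
qed

lemma cosh_ratio_le_3: "cosh_ratio k \<le> 3"
proof (induction k rule: nat_cases_4)
  case (5 k)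
  then show ?case using cosh_ratio_le_1[of k] by simp
qed (simp_all only: cosh_ratio_0 cosh_ratio_1 cosh_ratio_2 cosh_ratio_3)

lemma cosh_le_gauss: "dominated (cosh_fps 1) (gauss 3)"
proof -
  have "cosh_ratio k \<le> 3 ^ k" for k
  proof (cases "k = 0")
    case False
    then have "(3::real) ^ 1 \<le> 3 ^ k" by (intro power_increasing) auto
    then show ?thesis using cosh_ratio_le_3[of k] by simp
  qed (simp add: cosh_ratio_0)
  then have "dominated (cosh_fps 1) (fps_const 1 * gauss 3)"
    by (intro dominated_gaussI[of _ cosh_ratio])
      (simp_all add: cosh_fps_nth_odd cosh_fps_nth_even cosh_ratio_nonneg)
  then show ?thesis by simp
qed

text \<open>The summand 2 affects only the constant coefficient. From \<open>k = 1\<close> on the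
  claim is \<open>cosh_ratio_le_3\<close>, with equality for \<open>k\<close> = 1 and 2.\<close>

lemma eulerian3_le_gauss: "dominated (fps_const (1 / 3) * (cosh_fps 2 + 2)) (gauss 4)"
proof -
  have "dominated (fps_const (1 / 3) * (cosh_fps 2 + 2 * cosh_fps 0)) (fps_const 1 * gauss 4)"
  proof (rule dominated_gaussI[of _ "\<lambda>k. (4 ^ k + 2 * 0 ^ k) * cosh_ratio k / 3"])
    fix k
    show "(fps_const (1 / 3) * (cosh_fps 2 + 2 * cosh_fps 0)) $ (2 * k) =
        (4 ^ k + 2 * 0 ^ k) * cosh_ratio k / 3 / (24 ^ k * fact k)"
      by (simp add: numeral_fps_const cosh_fps_nth_even) (simp add: field_simps)
    show "(4 ^ k + 2 * 0 ^ k) * cosh_ratio k / 3 \<le> 1 * 4 ^ k"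
      using cosh_ratio_le_3[of k] by (cases k) (simp_all add: cosh_ratio_0)
  qed (auto simp: cosh_fps_nth_odd cosh_ratio_nonneg numeral_fps_const)
  then show ?thesis by (simp add: cosh_fps_0)
qed

lemma eulerian4_le_gauss: "dominated (fps_const (1 / 12) * (cosh_fps 3 + 11 * cosh_fps 1)) (gauss 5)"
proof -
  have "(9 ^ k + 11) * cosh_ratio k \<le> 12 * 5 ^ k" for k
  proof (cases "k < 3")
    case True
    then consider "k = 0" | "k = 1" | "k = 2" by linarith
    then show ?thesis by cases (simp_all add: cosh_ratio_0 cosh_ratio_1 cosh_ratio_2 del: One_nat_def)
  next
    case False
    then have "3 \<le> k" by simp
    then show ?thesis
    proof (induction k rule: dec_induct)
      case base
      show ?case by (simp add: cosh_ratio_3)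
    next
      case (step k)
      \<comment> \<open>From \<open>k = 3\<close> on \<open>cosh_ratio\<close> shrinks at least by
        the factor \<open>3 / 7\<close>, so the left side grows by at most \<open>27 / 7\<close>,
        less than the factor 5 on the right.\<close>
      have "(9 ^ Suc k + 11) * cosh_ratio (Suc k) \<le> (9 * (9 ^ k + 11)) * (cosh_ratio k * (3 / 7))"
        using step.hyps cosh_ratio_nonneg[of k] unfolding cosh_ratio_Suc
        by (intro mult_mono) (auto simp: field_simps)
      also have "\<dots> = (27 / 7) * ((9 ^ k + 11) * cosh_ratio k)" by simp
      also have "\<dots> \<le> 5 * ((9 ^ k + 11) * cosh_ratio k)"
        by (intro mult_right_mono) (auto simp: cosh_ratio_nonneg)
      also have "\<dots> \<le> 5 * (12 * 5 ^ k)" using step.IH by (intro mult_left_mono) auto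
      also have "\<dots> = 12 * 5 ^ Suc k" by simp
      finally show ?case .
    qed
  qed
  note bound = this
  have "dominated (fps_const (1 / 12) * (cosh_fps 3 + 11 * cosh_fps 1)) (fps_const 1 * gauss 5)"
  proof (rule dominated_gaussI[of _ "\<lambda>k. (9 ^ k + 11) * cosh_ratio k / 12"])
    fix k
    show "(fps_const (1 / 12) * (cosh_fps 3 + 11 * cosh_fps 1)) $ (2 * k) =
        (9 ^ k + 11) * cosh_ratio k / 12 / (24 ^ k * fact k)"
      by (simp add: numeral_fps_const cosh_fps_nth_even) (simp add: field_simps)
    show "(9 ^ k + 11) * cosh_ratio k / 12 \<le> 1 * 5 ^ k" using bound[of k] by simp
  qed (auto simp: cosh_fps_nth_odd cosh_ratio_nonneg numeral_fps_const)
  then show ?thesis by simp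
qed

text \<open>The series of \<open>cosh (s/2)\<close> exceeds that of \<^term>\<open>gauss 1\<close> only in the terms of degree 2, 4 and 6.\<close>

definition cosh_excess :: "real fps" where
  "cosh_excess = fps_const (1 / 12) * fps_X ^ 2 + fps_const (1 / 576) * fps_X ^ 4 + fps_const (1 / 103680) * fps_X ^ 6"

lemma cosh_le_excess: "dominated (cosh_fps 1) (gauss 1 + cosh_excess)"
  unfolding dominated_def
proof
  fix n
  show "0 \<le> cosh_fps 1 $ n \<and> cosh_fps 1 $ n \<le> (gauss 1 + cosh_excess) $ n"
  proof (cases "even n")
    case True
    then obtain k where n: "n = 2 * k" by auto
    have "cosh_ratio k / (24 ^ k * fact k) \<le> (gauss 1 + cosh_excess) $ (2 * k)"
    proof (induction k rule: nat_cases_4)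
      case (5 k)
      then have "cosh_ratio k / (24 ^ k * fact k) \<le> 1 / (24 ^ k * fact k)"
        by (intro divide_right_mono cosh_ratio_le_1) auto
      moreover have "0 \<le> cosh_excess $ (2 * k)" by (simp add: cosh_excess_def fps_X_power_nth)
      ultimately show ?case by (simp add: gauss_nth power_divide)
    qed (simp_all only: cosh_ratio_0 cosh_ratio_1 cosh_ratio_2 cosh_ratio_3,
        simp_all add: gauss_nth cosh_excess_def fps_X_power_nth fact_numeral power_divide)
    then show ?thesis by (simp add: n cosh_fps_nth_even cosh_ratio_nonneg)
  next
    case False
    then show ?thesis by (simp add: cosh_fps_nth_odd gauss_nth cosh_excess_def fps_X_power_nth)
  qed
qed

lemma cosh_excess_poly_bound:
  assumes "4 \<le> k"
  shows "2 ^ k * (real k + real k * (real k - 1) / 4 + real k * (real k - 1) * (real k - 2) / 60) + 3 / 2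
    \<le> 3 / 2 * 3 ^ k"
  using assms
proof (induction k rule: dec_induct)
  case (step k)
  define q :: "real \<Rightarrow> real" where "q x = x + x * (x - 1) / 4 + x * (x - 1) * (x - 2) / 60" for x
  \<comment> \<open>Counting from 4 makes all coefficients of \<open>3 * q k - 2 * q (k + 1)\<close>
    nonnegative.\<close>
  define y where "y = real k - 4"
  have y: "0 \<le> y" "real k = y + 4" using step by (auto simp: y_def)
  have "3 * q (real k) - 2 * q (real k + 1) = (y ^ 3 + 18 * y\<^sup>2 + 89 * y + 12) / 60"
    unfolding y(2) q_def by (simp add: field_simps power2_eq_square power3_eq_cube)
  moreover have "0 \<le> (y ^ 3 + 18 * y\<^sup>2 + 89 * y + 12) / 60" using y(1) by simp
  ultimately have q: "2 * q (real k + 1) \<le> 3 * q (real k)" by linarith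
  have "2 ^ Suc k * q (real (Suc k)) = 2 ^ k * (2 * q (real k + 1))" by (simp add: add.commute)
  also have "\<dots> \<le> 2 ^ k * (3 * q (real k))" using q by (intro mult_left_mono) auto
  finally have "2 ^ Suc k * q (real (Suc k)) \<le> 3 * (2 ^ k * q (real k))" by simp
  moreover have "2 ^ k * q (real k) + 3 / 2 \<le> 3 / 2 * 3 ^ k" using step.IH by (simp only: q_def)
  moreover have "(3::real) / 2 * 3 ^ Suc k = 3 * (3 / 2 * 3 ^ k)" by simp
  ultimately have "2 ^ Suc k * q (real (Suc k)) + 3 / 2 \<le> 3 / 2 * 3 ^ Suc k" by linarith
  then show ?case by (simp only: q_def)
qed simp

text \<open>A factor \<open>fps_X ^ (2 * i)\<close> shifts the coefficients of
  \<open>gauss 2\<close>; in the scale \<open>24 ^ k * fact k\<close> the shift becomes a falling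
  factorial of \<open>k\<close>. These vanish for small \<open>k\<close>, so the formula also holds
  where the shift leaves the range.\<close>

lemma cosh_excess_gauss_nth:
  "(cosh_excess * gauss 2) $ (2 * k) =
    2 ^ k * (real k + real k * (real k - 1) / 4 + real k * (real k - 1) * (real k - 2) / 60) / (24 ^ k * fact k)"
proof -
  have X: "(cosh_excess * gauss 2) $ n = 1 / 12 * (if n < 2 then 0 else gauss 2 $ (n - 2)) +
      1 / 576 * (if n < 4 then 0 else gauss 2 $ (n - 4)) + 1 / 103680 * (if n < 6 then 0 else gauss 2 $ (n - 6))" for n
    unfolding cosh_excess_def distrib_right mult.assoc by (simp only: fps_add_nth fps_mult_left_const_nth fps_X_power_mult_nth)
  consider "k = 0" | "k = 1" | "k = 2" | "3 \<le> k" by linarith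
  then show ?thesis
  proof cases
    case k3: 4
    define j where "j = k - 3"
    have 4: "k = j + 3" using k3 by (simp add: j_def)
    have "2 * k - 2 = 2 * (j + 2)" "2 * k - 4 = 2 * (j + 1)" "2 * k - 6 = 2 * j" using 4 by auto
    then have "(cosh_excess * gauss 2) $ (2 * k) = 1 / 12 * ((1 / 12) ^ (j + 2) / fact (j + 2)) +
      1 / 576 * ((1 / 12) ^ (j + 1) / fact (j + 1)) + 1 / 103680 * ((1 / 12) ^ j / fact j)"
      unfolding X using 4 by (simp only: gauss_nth) simp
    also have "\<dots> = (1 / 12) ^ k / fact k * (real k + real k * (real k - 1) / 4 + real k * (real k - 1) * (real k - 2) / 60)"
    proof -
      define x where "x = real j"
      have f: "fact (j + 2) = (x + 2) * ((x + 1) * fact j)" "fact (j + 1) = (x + 1) * fact j"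
        "fact (j + 3) = (x + 3) * ((x + 2) * ((x + 1) * fact j))"
        by (simp_all add: x_def numeral_3_eq_3 numeral_2_eq_2 algebra_simps)
      have k: "real k = x + 3" by (simp add: 4 x_def)
      have nz: "x + 1 \<noteq> 0" "x + 2 \<noteq> 0" "x + 3 \<noteq> 0" by (auto simp: x_def)
      show ?thesis unfolding k unfolding 4 f power_add
        using nz by (simp add: divide_simps) (simp add: algebra_simps)
    qed
    also have "(1 / 12) ^ k = (2 ^ k / 24 ^ k :: real)" by (simp flip: power_divide)
    finally show ?thesis by simp
  qed (simp_all only: X, simp_all add: gauss_nth fact_numeral)
qed

text \<open>The induction step of \<open>eulerian_le_gauss\<close> with the factor
  \<open>gauss (m - 1)\<close> cancelled: the cosine term, both products with
  \<open>eulerian 1\<close> and one with \<open>eulerian 2\<close>. The sides agree in degrees 0 and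
  2. Replacing \<open>cosh_fps 1\<close> by \<open>gauss 3\<close> in the first term would already
  fail in degree 4, hence the finer \<open>cosh_excess\<close>.\<close>

lemma cosh_gauss_bound:
  "dominated (fps_const 2 * (cosh_fps 1 * gauss 2) + fps_const 2 * gauss 1 + cosh_fps 1) (fps_const 5 * gauss 3)"
proof -
  define p where "p k = 2 ^ k * (real k + real k * (real k - 1) / 4 + real k * (real k - 1) * (real k - 2) / 60)" for k
  have p_nonneg: "0 \<le> p k" for k
    by (induction k rule: nat_cases_4) (auto simp: p_def intro!: mult_nonneg_nonneg add_nonneg_nonneg)
  have bound: "2 * 3 ^ k + 2 * p k + 2 + cosh_ratio k \<le> 5 * 3 ^ k" for k
  proof (induction k rule: nat_cases_4)
    case (5 k)
    then show ?case using cosh_excess_poly_bound[of k] cosh_ratio_le_1[of k] unfolding p_def by linarith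
  qed (simp_all only: cosh_ratio_0 cosh_ratio_1 cosh_ratio_2 cosh_ratio_3, simp_all add: p_def)
  have g3: "gauss 1 * gauss 2 = gauss 3" by (simp flip: gauss_add)
  have "dominated (fps_const 2 * (cosh_fps 1 * gauss 2) + fps_const 2 * gauss 1 + cosh_fps 1)
      (fps_const 2 * ((gauss 1 + cosh_excess) * gauss 2) + fps_const 2 * gauss 1 + cosh_fps 1)"
    using cosh_le_excess cosh_le_gauss
    by (intro dominated_add dominated_const_mult dominated_mult gauss_self)
      (auto simp: dominated_def)
  also have "fps_const 2 * ((gauss 1 + cosh_excess) * gauss 2) =
      fps_const 2 * gauss 3 + fps_const 2 * (cosh_excess * gauss 2)"
    by (simp add: distrib_left distrib_right g3)
  finally have "dominated (fps_const 2 * (cosh_fps 1 * gauss 2) + fps_const 2 * gauss 1 + cosh_fps 1)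
      (fps_const 2 * gauss 3 + fps_const 2 * (cosh_excess * gauss 2) + fps_const 2 * gauss 1 + cosh_fps 1)" .
  moreover have "dominated (fps_const 2 * gauss 3 + fps_const 2 * (cosh_excess * gauss 2) + fps_const 2 * gauss 1 + cosh_fps 1)
      (fps_const 5 * gauss 3)"
  proof (rule dominated_gaussI[of _ "\<lambda>k. 2 * 3 ^ k + 2 * p k + 2 + cosh_ratio k"])
    fix n :: nat assume "odd n"
    then have "(fps_X ^ 2 * gauss 2) $ n = 0" "(fps_X ^ 4 * gauss 2) $ n = 0" "(fps_X ^ 6 * gauss 2) $ n = 0"
      by (auto simp: fps_X_power_mult_nth gauss_nth)
    then have "(cosh_excess * gauss 2) $ n = 0"
      unfolding cosh_excess_def distrib_right mult.assoc by (simp only: fps_add_nth fps_mult_left_const_nth)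
    then show "(fps_const 2 * gauss 3 + fps_const 2 * (cosh_excess * gauss 2) + fps_const 2 * gauss 1 + cosh_fps 1) $ n = 0"
      using \<open>odd n\<close> by (simp add: gauss_nth cosh_fps_nth_odd)
  next
    fix k
    show "(fps_const 2 * gauss 3 + fps_const 2 * (cosh_excess * gauss 2) + fps_const 2 * gauss 1 + cosh_fps 1) $ (2 * k) =
      (2 * 3 ^ k + 2 * p k + 2 + cosh_ratio k) / (24 ^ k * fact k)"
      unfolding fps_add_nth fps_mult_left_const_nth cosh_excess_gauss_nth cosh_fps_nth_even p_def[symmetric]
      gauss_nth_even by (simp add: add_divide_distrib)
    show "0 \<le> 2 * 3 ^ k + 2 * p k + 2 + cosh_ratio k" using p_nonneg[of k] cosh_ratio_nonneg[of k] by simp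
    show "2 * 3 ^ k + 2 * p k + 2 + cosh_ratio k \<le> 5 * 3 ^ k" by (rule bound)
  qed
  ultimately show ?thesis by (rule dominated_trans)
qed

text \<open>The centred Eulerian distributions: \<^term>\<open>eulerian n\<close> is the moment generating series of
  \<open>des - (n-1)/2\<close> on the symmetric group; the recursion is the Riccati equation
  \<open>F' = 1 + 2 cosh(s/2) F + F^2\<close> of their generating function.\<close>

function eulerian :: "nat \<Rightarrow> real fps" where
  "eulerian 0 = 0"
| "eulerian (Suc n) = fps_const (1 / real (Suc n)) *
     ((if n = 0 then 1 else 0) + fps_const 2 * (cosh_fps 1 * eulerian n) + (\<Sum>k\<le>n. eulerian k * eulerian (n - k)))"
  by pat_completeness auto
termination by (relation "Wellfounded.measure id") auto

declare eulerian.simps(2) [simp del]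

lemma eulerian_Suc:
  assumes "0 < n"
  shows "fps_const (real (Suc n)) * eulerian (Suc n) =
    fps_const 2 * (cosh_fps 1 * eulerian n) + (\<Sum>k\<in>{0<..<n}. eulerian k * eulerian (n - k))"
proof -
  have "(\<Sum>k\<le>n. eulerian k * eulerian (n - k)) = (\<Sum>k\<in>{0<..<n}. eulerian k * eulerian (n - k))"
    by (rule sum.mono_neutral_right) (auto simp: not_less le_less_Suc_eq intro: gr0I)
  then show ?thesis
    using assms by (simp add: eulerian.simps(2) mult.assoc[symmetric] del: of_nat_Suc)
qed

lemma eulerian_1: "eulerian 1 = 1"
  by (simp add: eulerian.simps(2))

lemma eulerian_eqI: "0 < n \<Longrightarrow> fps_const (real n) * f = fps_const (real n) * eulerian n \<Longrightarrow> eulerian n = f"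
  by simp

lemma eulerian_2: "eulerian 2 = cosh_fps 1"
  using eulerian_Suc[of 1] eulerian_1
  by (intro eulerian_eqI) (simp_all add: numeral_2_eq_2 greaterThanLessThan_def)

lemma eulerian_3: "eulerian 3 = fps_const (1 / 3) * (cosh_fps 2 + 2)"
proof (rule eulerian_eqI)
  have "{0<..<2::nat} = {1}" by auto
  then have "fps_const 3 * eulerian 3 = fps_const 2 * (cosh_fps 1 * cosh_fps 1) + 1"
    using eulerian_Suc[of 2] by (simp add: eulerian_1[unfolded One_nat_def] eulerian_2)
  also have "\<dots> = cosh_fps 2 + 2"
    unfolding cosh_fps_mult by (simp add: cosh_fps_0 mult.assoc[symmetric])
  finally show "fps_const (real 3) * (fps_const (1 / 3) * (cosh_fps 2 + 2)) = fps_const (real 3) * eulerian 3"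
    by (simp add: mult.assoc[symmetric])
qed simp

lemma eulerian_4: "eulerian 4 = fps_const (1 / 12) * (cosh_fps 3 + 11 * cosh_fps 1)"
proof (rule eulerian_eqI)
  have "{0<..<3::nat} = {1, 2}" by auto
  then have "fps_const 4 * eulerian 4 = fps_const 2 * (cosh_fps 1 * eulerian 3) + fps_const 2 * cosh_fps 1"
    using eulerian_Suc[of 3] by (simp add: eulerian_1[unfolded One_nat_def] eulerian_2 flip: numeral_fps_const)
  also have "cosh_fps 1 * eulerian 3 = fps_const (1 / 3) * (cosh_fps 1 * cosh_fps 2 + fps_const 2 * cosh_fps 1)"
    by (simp add: eulerian_3 algebra_simps numeral_fps_const)
  also have "cosh_fps 1 * cosh_fps 2 = fps_const (1 / 2) * (cosh_fps 3 + cosh_fps 1)"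
  proof -
    have "cosh_fps (- 1) = cosh_fps 1" by (simp add: cosh_fps_def add.commute)
    then show ?thesis unfolding cosh_fps_mult by simp
  qed
  finally have "(fps_const 4 * eulerian 4) $ n = (1 / 3) * cosh_fps 3 $ n + (11 / 3) * cosh_fps 1 $ n" for n
    by (simp add: fps_eq_iff field_simps)
  then show "fps_const (real 4) * (fps_const (1 / 12) * (cosh_fps 3 + 11 * cosh_fps 1)) = fps_const (real 4) * eulerian 4"
    by (simp add: fps_eq_iff numeral_fps_const)
qed simp

lemma eulerian_nth_0: "0 < n \<Longrightarrow> eulerian n $ 0 = 1"
proof (induction n rule: less_induct)
  case (less n)
  show ?case
  proof (cases "n = 1")
    case True
    then show ?thesis using eulerian_1 by simp
  next
    case False
    then obtain m where n: "n = Suc m" "0 < m" using less.prems by (cases n) auto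
    have "(\<Sum>k\<in>{0<..<m}. (eulerian k * eulerian (m - k)) $ 0) = (\<Sum>k\<in>{0<..<m}. 1)"
      by (rule sum.cong) (use less.IH n in auto)
    then have "real n * eulerian n $ 0 = 2 * eulerian m $ 0 + real (m - 1)"
      using arg_cong[OF eulerian_Suc[OF n(2)], of "\<lambda>f. f $ 0"] unfolding n(1)
      by (simp add: fps_sum_nth cosh_fps_def del: of_nat_Suc)
    then show ?thesis using less.IH[of m] n by (simp add: of_nat_diff)
  qed
qed

text \<open>For \<open>n = m + 1\<close> a generic product in the recursion is bounded by
  \<open>gauss (m + 2)\<close>, exactly the target. The cosine term is too large for that. The loss
  is recovered from \<open>eulerian 1 = 1\<close>, which is far below \<open>gauss 2\<close>, and
  from the exact value of \<open>eulerian 2\<close>.\<close>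

theorem eulerian_le_gauss: "0 < n \<Longrightarrow> dominated (eulerian n) (gauss (real n + 1))"
proof (induction n rule: less_induct)
  case (less n)
  consider "n = 1" | "n = 2" | "n = 3" | "n = 4" | m where "n = Suc m" "4 \<le> m"
    using less.prems by (cases n) (auto, linarith)
  then show ?case
  proof cases
    case 1
    then show ?thesis using eulerian_1 by (auto simp: dominated_def gauss_nth)
  next
    case 2
    then show ?thesis using cosh_le_gauss by (simp add: eulerian_2)
  next
    case 3
    then show ?thesis using eulerian3_le_gauss by (simp add: eulerian_3)
  next
    case 4
    then show ?thesis using eulerian4_le_gauss by (simp add: eulerian_4)
  next
    case (5 m)
    let ?B = "\<lambda>k. gauss (real k + 1)"
    have IH: "dominated (eulerian k) (?B k)" if "0 < k" "k \<le> m" for k using less.IH[of k] that 5 by simp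
    have cosh: "dominated (cosh_fps 1) (cosh_fps 1)" using cosh_le_gauss by (auto simp: dominated_def)
    \<comment> \<open>Exact values are used at \<open>k = 1\<close>, \<open>k = m - 1\<close> and
      \<open>k = 2\<close> only. The other \<open>m - 4\<close> indices keep the generic bound, and
      \<open>5 + (m - 4)\<close> is the required factor \<open>m + 1\<close>.\<close>
    have set: "{0<..<m} = insert 1 (insert 2 (insert (m - 1) {3..m - 2}))" using 5 by auto
    have 1: "1 \<notin> insert 2 (insert (m - 1) {3..m - 2})" "2 \<notin> insert (m - 1) {3..m - 2}" "m - 1 \<notin> {3..m - 2}"
      using 5 by auto
    have "(\<Sum>k\<in>{0<..<m}. eulerian k * eulerian (m - k)) =
        fps_const 2 * eulerian (m - 1) + cosh_fps 1 * eulerian (m - 2) + (\<Sum>k\<in>{3..m - 2}. eulerian k * eulerian (m - k))"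
      unfolding set using 1 5 eulerian_1 by (simp add: eulerian_2 flip: numeral_fps_const)
    then have "fps_const (real (Suc m)) * eulerian (Suc m) = fps_const 2 * (cosh_fps 1 * eulerian m) +
        (fps_const 2 * eulerian (m - 1) + cosh_fps 1 * eulerian (m - 2) + (\<Sum>k\<in>{3..m - 2}. eulerian k * eulerian (m - k)))"
      using eulerian_Suc[of m] 5 by simp
    moreover have "dominated \<dots> (fps_const 2 * (cosh_fps 1 * ?B m) +
        (fps_const 2 * ?B (m - 1) + cosh_fps 1 * ?B (m - 2) + (\<Sum>k\<in>{3..m - 2}. ?B k * ?B (m - k))))"
      using 5 by (intro dominated_add dominated_const_mult dominated_mult dominated_sum cosh IH) auto
    moreover have "fps_const 2 * (cosh_fps 1 * ?B m) +
        (fps_const 2 * ?B (m - 1) + cosh_fps 1 * ?B (m - 2) + (\<Sum>k\<in>{3..m - 2}. ?B k * ?B (m - k))) =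
      gauss (real m - 1) * ((fps_const 2 * (cosh_fps 1 * gauss 2) + fps_const 2 * gauss 1 + cosh_fps 1) +
        fps_const (real m - 4) * gauss 3)"
    proof -
      have "?B m = gauss (real m - 1) * gauss 2" "?B (m - 1) = gauss (real m - 1) * gauss 1"
        "?B (m - 2) = gauss (real m - 1)"
        using 5 by (simp_all flip: gauss_add add: of_nat_diff add.commute)
      moreover have "(\<Sum>k\<in>{3..m - 2}. ?B k * ?B (m - k)) = fps_const (real m - 4) * (gauss (real m - 1) * gauss 3)"
      proof -
        have "(\<Sum>k\<in>{3..m - 2}. ?B k * ?B (m - k)) = (\<Sum>k\<in>{3..m - 2}. gauss (real m - 1) * gauss 3)"
          using 5 by (intro sum.cong) (auto simp flip: gauss_add simp: of_nat_diff)
        moreover have "real (m - 4) = real m - 4" using 5 by (simp add: of_nat_diff)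
        ultimately show ?thesis using 5 by (simp add: fps_of_nat[symmetric])
      qed
      ultimately show ?thesis by (simp add: algebra_simps)
    qed
    moreover have "dominated (gauss (real m - 1) * ((fps_const 2 * (cosh_fps 1 * gauss 2) + fps_const 2 * gauss 1 + cosh_fps 1) +
        fps_const (real m - 4) * gauss 3)) (gauss (real m - 1) * (fps_const 5 * gauss 3 + fps_const (real m - 4) * gauss 3))"
      using 5 by (intro dominated_add dominated_const_mult dominated_mult gauss_self cosh_gauss_bound) auto
    moreover have "gauss (real m - 1) * (fps_const 5 * gauss 3 + fps_const (real m - 4) * gauss 3) =
       fps_const (real (Suc m)) * gauss (real n + 1)"
    proof -
      have "gauss (real n + 1) = gauss (real m - 1) * gauss 3" using 5 by (simp flip: gauss_add)
      moreover have "fps_const 5 * gauss 3 + fps_const (real m - 4) * gauss 3 = fps_const (real (Suc m)) * gauss 3"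
        by (simp add: distrib_right[symmetric])
      ultimately show ?thesis by (simp add: mult_ac)
    qed
    ultimately have "dominated (fps_const (real (Suc m)) * eulerian (Suc m)) (fps_const (real (Suc m)) * gauss (real n + 1))"
      using dominated_trans by simp
    then show ?thesis using 5 by (simp add: dominated_def zero_le_mult_iff del: of_nat_Suc)
  qed
qed

section \<open>Moment bounds for nested multisets\<close>

lemma sum_Pow_card:
  fixes f :: "nat \<Rightarrow> 'b::comm_semiring_1"
  assumes "finite S"
  shows "(\<Sum>G\<in>Pow S. f (card G)) = (\<Sum>k\<le>card S. of_nat (card S choose k) * f k)"
proof -
  have "(\<Sum>G\<in>Pow S. f (card G)) = (\<Sum>k\<le>card S. \<Sum>G\<in>{G \<in> Pow S. card G = k}. f (card G))"
    by (rule sum.group[symmetric]) (use assms card_mono in auto)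
  also have "\<dots> = (\<Sum>k\<le>card S. of_nat (card {G. G \<subseteq> S \<and> card G = k}) * f k)"
    by (rule sum.cong) auto
  finally show ?thesis by (simp add: n_subsets[OF assms])
qed

context ranked
begin

lemma chow_fps_exp_nth_0: "chow (fps_exp c :: real fps) A X $ 0 = chow 1 A X"
  by (simp add: chow_def chow_sum_def fps_sum_nth fps_power_zeroth)

text \<open>All elements of \<open>X - A\<close> are coloops, so the minor is Boolean: every set
  between \<open>A\<close> and \<open>X\<close> is a flat.\<close>

definition free :: "'a set \<Rightarrow> 'a set \<Rightarrow> bool" where
  "free A X \<longleftrightarrow> A \<subseteq> X \<and> (\<forall>i\<in>X - A. r (X - {i}) < r X)"

lemma free_insert:
  assumes "free A X" "F \<subseteq> X" "i \<in> X" "i \<notin> F" "i \<notin> A"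
  shows "r F < r (insert i F)"
proof (rule r_less_insert, rule notI)
  assume "r (insert i F) = r F"
  then have "r (insert i (X - {i})) = r (X - {i})"
    using assms r_insert_same_mono[of F "X - {i}" i] by blast
  moreover have "insert i (X - {i}) = X" using assms by auto
  ultimately show False using assms by (auto simp: free_def)
qed

lemma free_mono:
  assumes "free A X" "A \<subseteq> B" "B \<subseteq> Y" "Y \<subseteq> X"
  shows "free B Y"
  unfolding free_def
proof (intro conjI ballI)
  fix i assume i: "i \<in> Y - B"
  then have "r (Y - {i}) < r (insert i (Y - {i}))" using assms by (intro free_insert[OF assms(1)]) auto
  then show "r (Y - {i}) < r Y" using i by (simp add: insert_absorb)
qed (use assms in auto)

lemma free_lat:
  assumes "free A X" "A \<subseteq> F" "F \<subseteq> X"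
  shows "F \<in> lat A X"
  by (rule latI) (use assms free_insert[OF assms(1,3)] in auto)

lemma free_rank:
  assumes "free A X" "finite X" "S \<subseteq> X - A"
  shows "r (A \<union> S) = r A + card S"
proof -
  have "finite S" using assms finite_subset by blast
  then show ?thesis using assms(3)
  proof (induction S rule: finite_induct)
    case (insert i S)
    have "A \<union> S \<subseteq> X" using assms(1) insert by (auto simp: free_def)
    then have "r (A \<union> S) < r (insert i (A \<union> S))" using insert by (intro free_insert[OF assms(1)]) auto
    then have "r (insert i (A \<union> S)) = Suc (r (A \<union> S))" using r_insert_le[of i "A \<union> S"] by simp
    then show ?case using insert by simp
  qed simp
qed

text \<open>Deletion of a coloop \<open>i\<close>. The term \<open>G = Y\<close> repeats the series
  of the deletion, and \<open>1 + t\<close> becomes a cosine after centring. The remaining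
  \<open>G\<close> are arbitrary proper intermediate sets and give a binomial convolution; dividing
  by factorials leaves the recursion of \<open>eulerian\<close>.\<close>

lemma free_chow:
  assumes "finite X" "free A X" "A \<noteq> X"
  shows "chow (fps_exp 1) A X =
    fps_const (fact (card (X - A))) * fps_exp ((real (card (X - A)) - 1) / 2) * eulerian (card (X - A))"
  using assms
proof (induction "card (X - A)" arbitrary: A X rule: less_induct)
  case less
  have AX: "A \<subseteq> X" using less.prems by (simp add: free_def)
  then obtain i where i: "i \<in> X" "i \<notin> A" using less.prems by auto
  define Y where "Y = X - {i}"
  define m where "m = card (Y - A)"
  define t :: "real fps" where "t = fps_exp 1"
  have AY: "A \<subseteq> Y" "Y \<subseteq> X" "i \<notin> Y" and XY: "X = insert i Y" using AX i by (auto simp: Y_def)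
  have fY: "finite Y" using less.prems AY finite_subset by blast
  have n: "card (X - A) = Suc m"
  proof -
    have "X - A = insert i (Y - A)" using XY i by auto
    then show ?thesis using fY AY by (simp add: m_def)
  qed
  have AL: "A \<in> lat A X" using free_lat[OF less.prems(2)] AX by auto
  let ?S = "{G \<in> lat A X. i \<notin> G \<and> A \<subset> G \<and> insert i G \<in> lat A X}"
  have S: "?S = {G. A \<subset> G \<and> G \<subseteq> Y}"
  proof (intro equalityI subsetI)
    fix G assume "G \<in> ?S"
    then show "G \<in> {G. A \<subset> G \<and> G \<subseteq> Y}" using lat_subset[of G A X] by (auto simp: Y_def)
  next
    fix G assume G: "G \<in> {G. A \<subset> G \<and> G \<subseteq> Y}"
    then have "G \<in> lat A X" "insert i G \<in> lat A X" using AY i by (auto intro!: free_lat[OF less.prems(2)])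
    then show "G \<in> ?S" using G AY by auto
  qed
  have del: "chow t A X = chow t A Y + t * (\<Sum>G | A \<subset> G \<and> G \<subseteq> Y. chow t A G * chow t (insert i G) X)"
    unfolding Y_def using chow_deletion[OF less.prems(1) AL, of i t] i unfolding S by (simp add: Y_def)
  show ?case
  proof (cases "m = 0")
    case True
    then have YA: "Y = A" using fY AY by (auto simp: m_def)
    then have e: "{G. A \<subset> G \<and> G \<subseteq> Y} = {}" by auto
    show ?thesis using del unfolding e sum.empty unfolding n True YA
      by (simp add: chow_self t_def eulerian_1[unfolded One_nat_def])
  next
    case False
    then have YA: "Y \<noteq> A" by (auto simp: m_def)
    \<comment> \<open>Zero for \<open>k = 0\<close> and \<open>k = m\<close> because
      \<open>eulerian 0 = 0\<close>. So the sum over proper intermediate sets extends to all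
      subsets, which are then grouped by size.\<close>
    define f where "f k = fps_const (fact k * fact (m - k)) * fps_exp ((real m - 2) / 2) * (eulerian k * eulerian (m - k))" for k
    have IHY: "chow t A Y = fps_const (fact m) * fps_exp ((real m - 1) / 2) * eulerian m"
      unfolding m_def t_def
      by (rule less.hyps) (use n m_def fY free_mono[OF less.prems(2)] AY YA in auto)
    have trm: "chow t A G * chow t (insert i G) X = f (card (G - A))" if G: "A \<subset> G" "G \<subset> Y" for G
    proof -
      define k where "k = card (G - A)"
      have fG: "finite G" using G fY finite_subset by blast
      have "card (Y - A) = card (G - A) + card (Y - G)"
      proof -
        have "Y - A = (G - A) \<union> (Y - G)" using G by auto
        moreover have "(G - A) \<inter> (Y - G) = {}" by auto
        ultimately show ?thesis using fG fY by (simp add: card_Un_disjoint)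
      qed
      then have mk: "card (Y - G) = m - k" "k \<le> m" by (auto simp: m_def k_def)
      have k0: "0 < k" using G fG by (auto simp: k_def card_gt_0_iff)
      have "card (Y - G) > 0" using G fY by (auto simp: card_gt_0_iff)
      then have km: "k < m" using mk by simp
      have XG: "X - insert i G = Y - G" by (auto simp: Y_def)
      have "chow t A G = fps_const (fact k) * fps_exp ((real k - 1) / 2) * eulerian k"
        unfolding k_def t_def
        by (rule less.hyps) (use n k_def km fG free_mono[OF less.prems(2)] AY G in auto)
      moreover have "chow t (insert i G) X = fps_const (fact (m - k)) * fps_exp ((real (m - k) - 1) / 2) * eulerian (m - k)"
        unfolding mk(1)[symmetric] XG[symmetric] t_def
      proof (rule less.hyps)
        show "free (insert i G) X" using AY G i by (intro free_mono[OF less.prems(2)]) auto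
        show "insert i G \<noteq> X" using G AY XY by auto
      qed (use n mk XG k0 less.prems(1) in auto)
      moreover have "fps_exp ((real k - 1) / 2) * fps_exp ((real (m - k) - 1) / 2) = fps_exp ((real m - 2) / 2)"
        using km by (simp flip: fps_exp_add_mult add: of_nat_diff field_simps)
      ultimately show ?thesis unfolding f_def k_def[symmetric]
        by (simp add: mult_ac fps_const_mult[symmetric] del: fps_const_mult)
    qed
    have f0: "f 0 = 0" "f m = 0" by (auto simp: f_def)
    have "{G. A \<subset> G \<and> G \<subseteq> Y} = insert Y {G. A \<subset> G \<and> G \<subset> Y}" using YA AY by auto
    moreover have fin: "finite {G. A \<subseteq> G \<and> G \<subseteq> Y}" "finite {G. A \<subset> G \<and> G \<subset> Y}"
      by (rule finite_subset[of _ "Pow Y"]; use fY in auto)+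
    ultimately have "(\<Sum>G | A \<subset> G \<and> G \<subseteq> Y. chow t A G * chow t (insert i G) X) =
       chow t A Y + (\<Sum>G | A \<subset> G \<and> G \<subset> Y. f (card (G - A)))"
      using trm XY by (simp add: chow_self)
    also have "(\<Sum>G | A \<subset> G \<and> G \<subset> Y. f (card (G - A))) = (\<Sum>G | A \<subseteq> G \<and> G \<subseteq> Y. f (card (G - A)))"
      by (rule sum.mono_neutral_left[OF fin(1)]) (auto simp: f0 m_def[symmetric])
    also have "\<dots> = (\<Sum>S\<in>Pow (Y - A). f (card S))"
      by (rule sum.reindex_bij_witness[of _ "\<lambda>S. A \<union> S" "\<lambda>G. G - A"]) (use AY in auto)
    also have "\<dots> = (\<Sum>k\<le>m. of_nat (m choose k) * f k)"
      unfolding m_def by (rule sum_Pow_card) (use fY in auto)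
    also have "\<dots> = fps_const (fact m) * fps_exp ((real m - 2) / 2) * (\<Sum>k\<le>m. eulerian k * eulerian (m - k))"
      unfolding sum_distrib_left
    proof (rule sum.cong[OF refl])
      fix k assume "k \<in> {..m}"
      then have "real (m choose k) * (fact k * fact (m - k)) = fact m"
        using binomial_fact_lemma[of k m] by (metis (no_types) atMost_iff mult.commute of_nat_fact of_nat_mult)
      then show "of_nat (m choose k) * f k = fps_const (fact m) * fps_exp ((real m - 2) / 2) * (eulerian k * eulerian (m - k))"
        unfolding f_def by (simp add: fps_of_nat[symmetric] mult.assoc[symmetric])
    qed
    finally have sum: "(\<Sum>G | A \<subset> G \<and> G \<subseteq> Y. chow t A G * chow t (insert i G) X) =
      fps_const (fact m) * fps_exp ((real m - 1) / 2) * eulerian m +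
      fps_const (fact m) * fps_exp ((real m - 2) / 2) * (\<Sum>k\<le>m. eulerian k * eulerian (m - k))"
      by (simp add: IHY)
    define u where "u = fps_exp (real m / 2)"
    have u: "fps_exp ((real m - 1) / 2) = u * fps_exp (- (1 / 2))"
      "t * fps_exp ((real m - 1) / 2) = u * fps_exp (1 / 2)" "t * fps_exp ((real m - 2) / 2) = u"
      unfolding u_def t_def by (simp_all flip: fps_exp_add_mult add: field_simps)
    let ?S = "\<Sum>k\<le>m. eulerian k * eulerian (m - k)"
    have "chow t A X = fps_const (fact m) * (fps_exp ((real m - 1) / 2) * eulerian m) +
       fps_const (fact m) * ((t * fps_exp ((real m - 1) / 2)) * eulerian m + (t * fps_exp ((real m - 2) / 2)) * ?S)"
      unfolding del IHY sum by (simp add: algebra_simps)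
    also have "\<dots> = fps_const (fact m) * u * ((fps_exp (1 / 2) + fps_exp (- (1 / 2))) * eulerian m + ?S)"
      unfolding u(2,3) unfolding u(1) by (simp add: algebra_simps)
    also have "fps_exp (1 / 2) + fps_exp (- (1 / 2)) = fps_const 2 * cosh_fps 1"
      by (simp add: cosh_fps_def mult.assoc[symmetric])
    also have "fps_const 2 * cosh_fps 1 * eulerian m + ?S = fps_const (real (Suc m)) * eulerian (Suc m)"
      using False by (simp add: eulerian.simps(2) mult.assoc[symmetric] del: of_nat_Suc)
    finally show ?thesis unfolding n u_def t_def
      by (simp add: mult_ac fps_const_mult[symmetric] del: fps_const_mult of_nat_Suc)
  qed
qed

text \<open>Deleting an element that is not a coloop keeps the rank, so the first term of
  \<open>chow_deletion\<close> has the right centre and variance by induction. If all elements are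
  coloops, the minor is Boolean and \<open>eulerian_le_gauss\<close> applies.\<close>

lemma chow_bound:
  assumes "finite X" "A \<in> lat A X" "A \<noteq> X"
  shows "dominated (fps_exp (- (real (r X) - real (r A) - 1) / 2) * chow (fps_exp 1) A X)
    (fps_const (chow 1 A X) * gauss (real (r X) - real (r A) + 1))"
  using assms
proof (induction "card (X - A)" arbitrary: A X rule: less_induct)
  case less
  have AX: "A \<subset> X" using lat_subset(2)[OF less.prems(2)] less.prems(3) by auto
  define t :: "real fps" where "t = fps_exp 1"
  have ac: "(a * x) * (b * y) = (a * b) * (x * y)" for a b x y :: "real fps" by (simp add: mult_ac)
  show ?case
  proof (cases "\<exists>i\<in>X - A. r (X - {i}) = r X")
    case True
    then obtain i where i: "i \<in> X - A" and ri: "r (X - {i}) = r X" by blast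
    let ?Y = "X - {i}"
    let ?S = "{G \<in> lat A X. i \<notin> G \<and> A \<subset> G \<and> insert i G \<in> lat A X}"
    let ?e = "fps_exp (- (real (r X) - real (r A) - 1) / 2)" and ?g = "gauss (real (r X) - real (r A) + 1)"
    have AY: "A \<noteq> ?Y" using lat_strict[OF less.prems(2), of X] AX ri by auto
    have AL: "A \<in> lat A ?Y" using lat_less[OF less.prems(2)] AX i by (intro latI) auto
    have card: "card (?Y - A) < card (X - A)"
      using less.prems(1) i by (intro psubset_card_mono) auto
    have "dominated (?e * chow t A ?Y) (fps_const (chow 1 A ?Y) * ?g)"
      using less.hyps[OF card _ AL AY] less.prems(1) unfolding ri t_def by simp
    moreover have "dominated (?e * t * (chow t A G * chow t (insert i G) X))
        (fps_const (chow 1 A G * chow 1 (insert i G) X) * ?g)" if G: "G \<in> ?S" for G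
    proof -
      have GL: "G \<in> lat A X" "insert i G \<in> lat A X" "i \<notin> G" "A \<subset> G" using G by auto
      note GX = lat_subset[OF GL(1)]
      have rG: "r (insert i G) = Suc (r G)" using lat_insert_rank[OF GL(1), of i] i GL by auto
      \<comment> \<open>The induction hypothesis excludes rank zero, where the bound fails. Equality
        here would make \<open>i\<close> a coloop of \<open>X\<close>.\<close>
      have ne: "insert i G \<noteq> X"
      proof
        assume "insert i G = X"
        then have "G = ?Y" using GL by auto
        then show False using ri rG \<open>insert i G = X\<close> by simp
      qed
      have "dominated (fps_exp (- (real (r G) - real (r A) - 1) / 2) * chow t A G)
        (fps_const (chow 1 A G) * gauss (real (r G) - real (r A) + 1))"
        unfolding t_def
      proof (rule less.hyps)
        show "card (G - A) < card (X - A)" using less.prems(1) GX GL i by (intro psubset_card_mono) auto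
        show "A \<in> lat A G" using lat_restrict[OF GL(1)] less.prems(2) GX by auto
        show "finite G" using less.prems(1) GX finite_subset by blast
      qed (use GL in auto)
      moreover have "dominated (fps_exp (- (real (r X) - real (r (insert i G)) - 1) / 2) * chow t (insert i G) X)
        (fps_const (chow 1 (insert i G) X) * gauss (real (r X) - real (r (insert i G)) + 1))"
        unfolding t_def
      proof (rule less.hyps)
        show "card (X - insert i G) < card (X - A)" using less.prems(1) GX GL i by (intro psubset_card_mono) auto
        show "insert i G \<in> lat (insert i G) X" using GL(2) by (auto simp: lat_def)
      qed (use less.prems ne in auto)
      moreover have "fps_exp (- (real (r G) - real (r A) - 1) / 2) * chow t A G *
          (fps_exp (- (real (r X) - real (r (insert i G)) - 1) / 2) * chow t (insert i G) X) =
          ?e * t * (chow t A G * chow t (insert i G) X)"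
      proof -
        \<comment> \<open>With \<open>a\<close> and \<open>b\<close> the ranks of the two factors
          the total rank is \<open>a + b + 1\<close>. The centres \<open>(a - 1) / 2\<close> and
          \<open>(b - 1) / 2\<close> fall short of \<open>(a + b) / 2\<close> by 1, which is the
          exponent of \<open>t\<close>.\<close>
        have e: "fps_exp (- (real (r G) - real (r A) - 1) / 2) * fps_exp (- (real (r X) - real (r (insert i G)) - 1) / 2) = ?e * t"
          unfolding t_def rG by (simp flip: fps_exp_add_mult add: field_simps)
        show ?thesis by (subst ac, subst e) (rule refl)
      qed
      moreover have "fps_const (chow 1 A G) * gauss (real (r G) - real (r A) + 1) *
         (fps_const (chow 1 (insert i G) X) * gauss (real (r X) - real (r (insert i G)) + 1)) =
         fps_const (chow 1 A G * chow 1 (insert i G) X) * ?g"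
      proof -
        have g: "gauss (real (r G) - real (r A) + 1) * gauss (real (r X) - real (r (insert i G)) + 1) = ?g"
          unfolding rG gauss_add[symmetric] by (rule arg_cong[of _ _ gauss]) simp
        show ?thesis by (subst ac, subst g, subst fps_const_mult) (rule refl)
      qed
      ultimately show ?thesis using dominated_mult by (metis (no_types))
    qed
    ultimately have "dominated (?e * chow t A ?Y + (\<Sum>G\<in>?S. ?e * t * (chow t A G * chow t (insert i G) X)))
       (fps_const (chow 1 A ?Y) * ?g + (\<Sum>G\<in>?S. fps_const (chow 1 A G * chow 1 (insert i G) X) * ?g))"
      by (intro dominated_add dominated_sum) auto
    moreover have "?e * chow t A ?Y + (\<Sum>G\<in>?S. ?e * t * (chow t A G * chow t (insert i G) X)) = ?e * chow t A X"
      unfolding chow_deletion[OF less.prems(1,2) i] by (simp add: distrib_left sum_distrib_left mult.assoc)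
    moreover have "fps_const (chow 1 A ?Y) * ?g + (\<Sum>G\<in>?S. fps_const (chow 1 A G * chow 1 (insert i G) X) * ?g) =
        fps_const (chow 1 A X) * ?g"
      unfolding chow_deletion[OF less.prems(1,2) i]
      by (rule fps_ext) (simp add: fps_sum_nth distrib_right sum_distrib_right)
    ultimately show ?thesis by (simp add: t_def)
  next
    case False
    have "r (X - {i}) \<le> r X" for i by (intro r_mono) auto
    then have free: "free A X" using False AX by (auto simp: free_def order.order_iff_strict)
    define n where "n = card (X - A)"
    have "r (A \<union> (X - A)) = r A + n" unfolding n_def by (rule free_rank[OF free less.prems(1)]) auto
    then have rX: "r X = r A + n" using AX by (simp add: Un_absorb1 less_imp_le)
    have n0: "0 < n" using AX less.prems(1) by (auto simp: n_def card_gt_0_iff)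
    have c: "chow (fps_exp 1) A X = fps_const (fact n) * fps_exp ((real n - 1) / 2) * eulerian n"
      unfolding n_def by (rule free_chow[OF less.prems(1) free less.prems(3)])
    have c1: "chow 1 A X = (fact n :: real)"
      using arg_cong[OF c, of "\<lambda>f. f $ 0"] n0 by (simp add: chow_fps_exp_nth_0 eulerian_nth_0)
    have "fps_exp (- (real (r X) - real (r A) - 1) / 2) * chow (fps_exp 1) A X =
        fps_const (fact n) * ((fps_exp (- (real n - 1) / 2) * fps_exp ((real n - 1) / 2)) * eulerian n)"
      unfolding c rX by (simp add: mult_ac)
    also have "fps_exp (- (real n - 1) / 2) * fps_exp ((real n - 1) / 2) = 1"
      by (simp flip: fps_exp_add_mult add: field_simps)
    finally show ?thesis
      using dominated_const_mult[OF _ eulerian_le_gauss[OF n0], of "fact n"] by (simp add: c1 rX)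
  qed
qed

text \<open>The coefficient of degree \<open>k\<close> of the centred series is the sum of
  \<open>k\<close>-th centred powers divided by \<open>fact k\<close>, and domination bounds each
  coefficient separately.\<close>

theorem nested_moment_bound:
  assumes "finite E" "{} \<in> lat {} E" "r E = d + 1"
  shows "(\<Sum>m\<in>nested r (lat {} E) {}. (real (size m) - real d / 2) ^ k) \<le>
    real (card (nested r (lat {} E) {})) *
      (if even k then fact k * ((real d + 2) / 24) ^ (k div 2) / fact (k div 2) else 0)"
proof -
  let ?N = "nested r (lat {} E) {}"
  have E: "{} \<noteq> E" using assms r_empty by auto
  have "fps_exp (- (real d / 2)) * chow (fps_exp 1) {} E = (\<Sum>m\<in>?N. fps_exp (real (size m) - real d / 2))"
    unfolding chow_def chow_sum_def sum_distrib_left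
    by (rule sum.cong) (simp_all add: fps_exp_power_mult flip: fps_exp_add_mult)
  moreover have "chow 1 {} E = real (card ?N)" by (simp add: chow_def chow_sum_def)
  ultimately have "dominated (\<Sum>m\<in>?N. fps_exp (real (size m) - real d / 2)) (fps_const (real (card ?N)) * gauss (real d + 2))"
    using chow_bound[OF assms(1,2) E] assms(3) r_empty by (simp add: add.commute)
  then have "(\<Sum>m\<in>?N. fps_exp (real (size m) - real d / 2)) $ k \<le> (fps_const (real (card ?N)) * gauss (real d + 2)) $ k"
    unfolding dominated_def by blast
  then have "fact k * (\<Sum>m\<in>?N. (real (size m) - real d / 2) ^ k / fact k) \<le> fact k * (real (card ?N) * gauss (real d + 2) $ k)"
    by (intro mult_left_mono) (simp_all add: fps_sum_nth)
  moreover have "fact k * (\<Sum>m\<in>?N. (real (size m) - real d / 2) ^ k / fact k) = (\<Sum>m\<in>?N. (real (size m) - real d / 2) ^ k)"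
    by (simp add: sum_divide_distrib[symmetric])
  ultimately show ?thesis by (simp add: gauss_nth mult_ac split: if_splits)
qed

end

section \<open>Linear functionals on polynomials\<close>

text \<open>With \<open>L\<close> given by its values on monomials, this is \<open>L\<close> after
  multiplication by the linear form with coefficients \<open>v\<close>.\<close>

definition shift :: "'b set \<Rightarrow> ('b \<Rightarrow> real) \<Rightarrow> ('b multiset \<Rightarrow> real) \<Rightarrow> 'b multiset \<Rightarrow> real" where
  "shift V v L = (\<lambda>m. \<Sum>G\<in>V. v G * L (add_mset G m))"

text \<open>A function on multisets is viewed as a linear functional on the polynomial ring in the variables
  \<^term>\<open>V\<close>. Then \<^term>\<open>hat V c L m\<close> is its value on the product of the linear forms
  with coefficients \<^term>\<open>c F\<close>, for \<^term>\<open>F\<close> in \<^term>\<open>m\<close>.\<close>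

definition hat :: "'b set \<Rightarrow> ('c \<Rightarrow> 'b \<Rightarrow> real) \<Rightarrow> ('b multiset \<Rightarrow> real) \<Rightarrow> 'c multiset \<Rightarrow> real" where
  "hat V c L m = fold_mset (\<lambda>F. shift V (c F)) L m {#}"

lemma shift_commute: "shift V v (shift V w L) = shift V w (shift V v L)"
proof
  fix m
  show "shift V v (shift V w L) m = shift V w (shift V v L) m"
    unfolding shift_def sum_distrib_left
    by (subst sum.swap) (simp add: mult.left_commute add_mset_commute)
qed

lemma hat_empty [simp]: "hat V c L {#} = L {#}"
  by (simp add: hat_def)

lemma hat_add: "hat V c L (add_mset F m) = hat V c (shift V (c F) L) m"
proof -
  interpret comp_fun_commute "\<lambda>F. shift V (c F)"
    by standard (auto simp: fun_eq_iff shift_commute[THEN fun_cong])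
  show ?thesis unfolding hat_def by (simp add: fold_mset_fun_left_comm)
qed

lemma shift_sum: "shift V v (\<lambda>n. \<Sum>i\<in>I. a i * L i n) = (\<lambda>n. \<Sum>i\<in>I. a i * shift V v (L i) n)"
  unfolding shift_def sum_distrib_left
  by (rule ext, subst sum.swap) (simp add: mult.left_commute)

lemma hat_sum: "hat V c (\<lambda>n. \<Sum>i\<in>I. a i * L i n) m = (\<Sum>i\<in>I. a i * hat V c (L i) m)"
  by (induction m arbitrary: L) (simp_all add: hat_add shift_sum)

lemma hat_zero [simp]: "hat V c (\<lambda>n. 0) m = 0"
  using hat_sum[of V c "\<lambda>_. 0" "\<lambda>_ _. 0" "{}" m] by simp

lemma hat_eq_0I: "(\<And>n. L n = 0) \<Longrightarrow> hat V c L m = 0"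
  using hat_zero[of V c m] by (metis ext)

text \<open>The offset \<open>a\<close> counts the linear forms already multiplied in: each
  \<open>shift\<close> lowers by one the degree in which the functional lives.\<close>

lemma hat_size:
  assumes "\<And>n. size n + a \<noteq> k \<Longrightarrow> L n = 0" "size m + a \<noteq> k"
  shows "hat V c L m = 0"
  using assms
proof (induction m arbitrary: L a)
  case (add F m)
  have "hat V c (shift V (c F) L) m = 0"
    by (rule add.IH[of "Suc a"]) (use add.prems in \<open>auto simp: shift_def\<close>)
  then show ?case by (simp add: hat_add)
qed auto

section \<open>Moebius inversion for inclusion\<close>

lemma zeta_inverse_left:
  assumes "finite P"
  shows "\<exists>f. \<forall>H\<in>P. (\<Sum>G\<in>{G \<in> P. G \<subseteq> H}. f G) = (g H :: real)"
  using assms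
proof (induction P rule: finite_psubset_induct)
  case (psubset P)
  show ?case
  proof (cases "P = {}")
    case False
    then obtain M where M: "M \<in> P" "\<And>F. F \<in> P \<Longrightarrow> M \<subseteq> F \<Longrightarrow> M = F"
      using finite_has_maximal[OF psubset.hyps] by metis
    obtain f where f: "\<forall>H\<in>P - {M}. (\<Sum>G\<in>{G \<in> P - {M}. G \<subseteq> H}. f G) = g H"
      using psubset.IH[of "P - {M}"] M(1) by blast
    define f' where "f' = f(M := g M - (\<Sum>G\<in>{G \<in> P - {M}. G \<subseteq> M}. f G))"
    have "(\<Sum>G\<in>{G \<in> P. G \<subseteq> H}. f' G) = g H" if H: "H \<in> P" for H
    proof (cases "H = M")
      case True
      have "{G \<in> P. G \<subseteq> H} = insert M {G \<in> P - {M}. G \<subseteq> M}" using M True by auto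
      moreover have "(\<Sum>G\<in>{G \<in> P - {M}. G \<subseteq> M}. f' G) = (\<Sum>G\<in>{G \<in> P - {M}. G \<subseteq> M}. f G)"
        by (rule sum.cong) (auto simp: f'_def)
      ultimately show ?thesis using psubset.hyps True by (simp add: f'_def)
    next
      case False
      then have "{G \<in> P. G \<subseteq> H} = {G \<in> P - {M}. G \<subseteq> H}" using M H by auto
      moreover have "(\<Sum>G\<in>{G \<in> P - {M}. G \<subseteq> H}. f' G) = (\<Sum>G\<in>{G \<in> P - {M}. G \<subseteq> H}. f G)"
        by (rule sum.cong) (auto simp: f'_def)
      ultimately show ?thesis using f H False by auto
    qed
    then show ?thesis by blast
  qed simp
qed

lemma zeta_inverse_right:
  assumes "finite P"
  shows "\<exists>f. \<forall>H\<in>P. (\<Sum>G\<in>{G \<in> P. H \<subseteq> G}. f G) = (g H :: real)"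
proof -
  have inj: "inj_on uminus Q" for Q :: "'a set set" by (rule inj_onI) auto
  obtain f where f: "\<forall>H\<in>uminus ` P. (\<Sum>G\<in>{G \<in> uminus ` P. G \<subseteq> H}. f G) = g (- H)"
    using zeta_inverse_left[of "uminus ` P" "\<lambda>H. g (- H)"] assms by auto
  have "(\<Sum>G\<in>{G \<in> P. H \<subseteq> G}. f (- G)) = g H" if "H \<in> P" for H
  proof -
    have "{G \<in> uminus ` P. G \<subseteq> - H} = uminus ` {G \<in> P. H \<subseteq> G}" by auto
    then show ?thesis using f that sum.reindex[OF inj, of f "{G \<in> P. H \<subseteq> G}"] by (auto simp: o_def)
  qed
  then show ?thesis by (intro exI[of _ "\<lambda>G. f (- G)"]) auto
qed

text \<open>A left and a right inverse of the zeta matrix exist by removing maximal members and by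
  passing to complements. Evaluating the triple product in two ways shows that they
  coincide.\<close>

lemma moebius_exists:
  assumes fin: "finite P"
  obtains \<mu> :: "'a set \<Rightarrow> 'a set \<Rightarrow> real"
  where "\<And>F H. F \<in> P \<Longrightarrow> H \<in> P \<Longrightarrow> (\<Sum>G\<in>{G \<in> P. G \<subseteq> H}. \<mu> F G) = (if F = H then 1 else 0)"
    and "\<And>F H. F \<in> P \<Longrightarrow> H \<in> P \<Longrightarrow> (\<Sum>G\<in>{G \<in> P. F \<subseteq> G}. \<mu> G H) = (if F = H then 1 else 0)"
proof -
  obtain a where a: "\<forall>H\<in>P. (\<Sum>G\<in>{G \<in> P. G \<subseteq> H}. a F G) = (if F = H then 1 else 0 :: real)" for F
    using zeta_inverse_left[OF fin, of "\<lambda>H. if F = H then 1 else 0" for F] by metis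
  obtain b where b: "\<forall>F\<in>P. (\<Sum>G\<in>{G \<in> P. F \<subseteq> G}. b H G) = (if F = H then 1 else 0 :: real)" for H
    using zeta_inverse_right[OF fin, of "\<lambda>F. if F = H then 1 else 0" for H] by metis
  have restr: "(\<Sum>G\<in>{G \<in> P. Q G}. f G) = (\<Sum>G\<in>P. f G * (if Q G then 1 else 0))" for Q and f :: "'a set \<Rightarrow> real"
    by (rule sum.mono_neutral_cong_left) (use fin in auto)
  have ab: "a F H = b H F" if F: "F \<in> P" and H: "H \<in> P" for F H
  proof -
    have "(\<Sum>G\<in>P. a F G * (if G = H then 1 else 0)) =
        (\<Sum>G\<in>P. a F G * (\<Sum>K\<in>P. b H K * (if G \<subseteq> K then 1 else 0)))"
      using b[of H] unfolding restr by (intro sum.cong) auto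
    also have "\<dots> = (\<Sum>K\<in>P. \<Sum>G\<in>P. a F G * (b H K * (if G \<subseteq> K then 1 else 0)))"
      unfolding sum_distrib_left by (rule sum.swap)
    also have "\<dots> = (\<Sum>K\<in>P. b H K * (\<Sum>G\<in>P. a F G * (if G \<subseteq> K then 1 else 0)))"
      by (simp add: sum_distrib_left mult_ac)
    also have "\<dots> = (\<Sum>K\<in>P. b H K * (if F = K then 1 else 0))"
      using a[of F] unfolding restr by (intro sum.cong) auto
    finally show ?thesis using F H fin by (simp add: if_distrib[of "\<lambda>x. _ * x"] cong: if_cong)
  qed
  show ?thesis
  proof (rule that[of a])
    fix F H assume F: "F \<in> P" and H: "H \<in> P"
    show "(\<Sum>G\<in>{G \<in> P. G \<subseteq> H}. a F G) = (if F = H then 1 else 0)" using a H by blast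
    have "(\<Sum>G\<in>{G \<in> P. F \<subseteq> G}. a G H) = (\<Sum>G\<in>{G \<in> P. F \<subseteq> G}. b H G)"
      using ab H by (intro sum.cong) auto
    then show "(\<Sum>G\<in>{G \<in> P. F \<subseteq> G}. a G H) = (if F = H then 1 else 0)" using b F by simp
  qed
qed

text \<open>If the values \<^term>\<open>b A B\<close> on products \<open>h\<^sub>A h\<^sub>B\<close> satisfy the quadratic relation, then
  the values on the products \<open>x\<^sub>A x\<^sub>B\<close> of incomparable variables vanish, where \<open>h\<^sub>A\<close> is the sum of \<open>x\<^sub>F\<close>
  over the members \<open>F\<close> above \<open>A\<close>.\<close>

lemma moebius_incomparable:
  fixes b :: "'a set \<Rightarrow> 'a set \<Rightarrow> real"
  assumes fin: "finite P" "\<And>F. F \<in> P \<Longrightarrow> finite F" "finite E" "\<And>F. F \<in> P \<Longrightarrow> F \<subseteq> E"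
    and join: "\<And>A B. A \<in> P \<Longrightarrow> B \<in> P \<Longrightarrow> j A B \<in> P"
      "\<And>A B F. A \<in> P \<Longrightarrow> B \<in> P \<Longrightarrow> F \<in> P \<Longrightarrow> j A B \<subseteq> F \<longleftrightarrow> A \<subseteq> F \<and> B \<subseteq> F"
    and rel: "\<And>A B. A \<in> P \<Longrightarrow> B \<in> P \<Longrightarrow> b A B + b (j A B) (j A B) = b A (j A B) + b (j A B) B"
    and beta: "\<And>A B. A \<in> P \<Longrightarrow> B \<in> P \<Longrightarrow> (\<Sum>F\<in>{F \<in> P. A \<subseteq> F}. \<Sum>G\<in>{G \<in> P. B \<subseteq> G}. \<beta> F G) = b A B"
    and AB: "A \<in> P" "B \<in> P" "\<not> A \<subseteq> B" "\<not> B \<subseteq> A"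
  shows "\<beta> A B = 0"
  using AB
proof (induction "2 * card E - (card A + card B)" arbitrary: A B rule: less_induct)
  case less
  let ?U = "\<lambda>A. {F \<in> P. A \<subseteq> F}" and ?H = "j A B"
  have HP: "?H \<in> P" using join less.prems by blast
  have sub: "?U ?H \<subseteq> ?U A" "?U ?H \<subseteq> ?U B" using join(2)[OF less.prems(1,2)] by auto
  have diffA: "?U A - ?U ?H = {F \<in> P. A \<subseteq> F \<and> \<not> B \<subseteq> F}"
    and diffB: "?U B - ?U ?H = {F \<in> P. B \<subseteq> F \<and> \<not> A \<subseteq> F}"
    using join(2)[OF less.prems(1,2)] by auto
  have fU: "finite (?U A)" for A using fin by auto
  \<comment> \<open>This partial sum is the value on \<open>(h_A - h_H) * (h_B - h_H)\<close> and
    hence zero. All its pairs are incomparable, so by induction upwards only the pair of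
    \<open>A\<close> and \<open>B\<close> itself can contribute.\<close>
  have "(\<Sum>F\<in>?U A - ?U ?H. \<Sum>G\<in>?U B - ?U ?H. \<beta> F G) =
      (\<Sum>F\<in>?U A - ?U ?H. (\<Sum>G\<in>?U B. \<beta> F G) - (\<Sum>G\<in>?U ?H. \<beta> F G))"
    by (intro sum.cong refl sum_diff fU sub)
  also have "\<dots> = b A B - b ?H B - (b A ?H - b ?H ?H)"
    unfolding sum_subtractf sum_diff[OF fU sub(1)] using beta less.prems HP by simp
  also have "\<dots> = 0" using rel[OF less.prems(1,2)] by simp
  finally have zero: "(\<Sum>F\<in>?U A - ?U ?H. \<Sum>G\<in>?U B - ?U ?H. \<beta> F G) = 0" .
  have smaller: "\<beta> F G = 0" if F: "F \<in> ?U A - ?U ?H" and G: "G \<in> ?U B - ?U ?H" and ne: "F \<noteq> A \<or> G \<noteq> B" for F G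
  proof -
    have FG: "F \<in> P" "A \<subseteq> F" "\<not> B \<subseteq> F" "G \<in> P" "B \<subseteq> G" "\<not> A \<subseteq> G" using F G diffA diffB by auto
    have "card A \<le> card F" "card B \<le> card G" using FG fin(2) by (auto intro: card_mono)
    moreover have "card A < card F \<or> card B < card G" using FG fin(2) ne by (auto intro: psubset_card_mono)
    moreover have "card F \<le> card E" "card G \<le> card E" using FG(1,4) card_mono[OF fin(3) fin(4)] by auto
    ultimately have "2 * card E - (card F + card G) < 2 * card E - (card A + card B)" by linarith
    then show ?thesis using less.hyps[of F G] FG by blast
  qed
  have A: "A \<in> ?U A - ?U ?H" and B: "B \<in> ?U B - ?U ?H" using less.prems diffA diffB by auto
  have "(\<Sum>F\<in>?U A - ?U ?H. \<Sum>G\<in>?U B - ?U ?H. \<beta> F G) = (\<Sum>G\<in>?U B - ?U ?H. \<beta> A G)"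
    using A fU smaller by (subst sum.remove[of _ A]) (auto intro!: sum.neutral)
  also have "\<dots> = \<beta> A B"
    using B fU smaller A by (subst sum.remove[of _ B]) (auto intro!: sum.neutral)
  finally show ?case using zero by simp
qed

section \<open>Straightening monomials\<close>

locale flats = ranked r for r :: "'a set \<Rightarrow> nat" +
  fixes E :: "'a set"
  assumes finite_E: "finite E" and empty_flat: "{} \<in> lat {} E" and E_nonempty: "E \<noteq> {}"
begin

text \<open>Index set of the \<open>h_F\<close>, including \<open>E\<close>. The variables of the
  Chow ring are indexed by \<open>V\<close>.\<close>

definition Vp :: "'a set set" where "Vp = lat {} E - {{}}"

definition V :: "'a set set" where "V = Vp - {E}"

definition cl :: "'a set \<Rightarrow> 'a set" where "cl X = {e \<in> E. r (insert e X) = r X}"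

definition join :: "'a set \<Rightarrow> 'a set \<Rightarrow> 'a set" where "join F G = cl (F \<union> G)"

lemma finite_Vp: "finite Vp" and finite_V: "finite V"
  using finite_lat[OF finite_E] by (auto simp: Vp_def V_def)

lemma E_Vp: "E \<in> Vp"
  using E_nonempty by (auto simp: Vp_def lat_def)

lemma VpD: "F \<in> Vp \<Longrightarrow> F \<in> lat {} E" "F \<in> Vp \<Longrightarrow> F \<subseteq> E" "F \<in> Vp \<Longrightarrow> finite F"
  using finite_E finite_subset by (auto simp: Vp_def lat_def)

lemma cl_superset: "X \<subseteq> E \<Longrightarrow> X \<subseteq> cl X"
  by (auto simp: cl_def insert_absorb)

lemma cl_subset_E: "cl X \<subseteq> E"
  by (auto simp: cl_def)

lemma r_Un_same:
  assumes "finite Y" "\<And>e. e \<in> Y \<Longrightarrow> r (insert e X) = r X"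
  shows "r (X \<union> Y) = r X"
  using assms
proof (induction Y rule: finite_induct)
  case (insert e Y)
  then have "r (insert e (X \<union> Y)) = r (X \<union> Y)" using r_insert_same_mono[of X "X \<union> Y" e] by simp
  then show ?case using insert by simp
qed simp

lemma r_cl:
  assumes "X \<subseteq> E"
  shows "r (cl X) = r X"
proof -
  have "r (X \<union> cl X) = r X"
    by (rule r_Un_same) (use finite_E cl_subset_E finite_subset in \<open>auto simp: cl_def\<close>)
  then show ?thesis using cl_superset[OF assms] by (simp add: Un_absorb1)
qed

lemma cl_flat:
  assumes "X \<subseteq> E"
  shows "cl X \<in> lat {} E"
proof (rule latI)
  fix e assume e: "e \<in> E" "e \<notin> cl X"
  show "r (cl X) < r (insert e (cl X))"
  proof (rule r_less_insert, rule notI)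
    assume "r (insert e (cl X)) = r (cl X)"
    moreover have "r (insert e X) \<le> r (insert e (cl X))"
      using cl_superset[OF assms] by (intro r_mono) auto
    moreover have "r X \<le> r (insert e X)" by (intro r_mono) auto
    ultimately have "r (insert e X) = r X" using r_cl[OF assms] by simp
    then show False using e by (simp add: cl_def)
  qed
qed (use cl_subset_E in auto)

lemma cl_least:
  assumes "X \<subseteq> F" "F \<in> lat {} E"
  shows "cl X \<subseteq> F"
proof
  fix e assume "e \<in> cl X"
  then have "e \<in> E" "r (insert e F) = r F" using r_insert_same_mono[OF assms(1)] by (auto simp: cl_def)
  then show "e \<in> F" using lat_mem[OF assms(2)] by blast
qed

lemma join_Vp:
  assumes "F \<in> Vp" "G \<in> Vp"
  shows "join F G \<in> Vp" "F \<subseteq> join F G" "G \<subseteq> join F G"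
proof -
  have sub: "F \<union> G \<subseteq> E" using assms VpD by blast
  show s: "F \<subseteq> join F G" "G \<subseteq> join F G" using cl_superset[OF sub] by (auto simp: join_def)
  show "join F G \<in> Vp" using cl_flat[OF sub] s assms unfolding join_def Vp_def by auto
qed

lemma join_subset_iff:
  assumes "F \<in> Vp" "G \<in> Vp" "H \<in> lat {} E"
  shows "join F G \<subseteq> H \<longleftrightarrow> F \<subseteq> H \<and> G \<subseteq> H"
  using join_Vp[OF assms(1,2)] cl_least[of "F \<union> G" H] assms(3) unfolding join_def by blast

lemma Vp_strict: "F \<in> Vp \<Longrightarrow> G \<in> Vp \<Longrightarrow> F \<subset> G \<Longrightarrow> r F < r G"
  using lat_strict[of F "{}" E G] VpD by auto

lemma rank_one_flat:
  assumes "i \<in> E"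
  shows "cl {i} \<in> Vp" "r (cl {i}) = 1" "F \<in> lat {} E \<Longrightarrow> cl {i} \<subseteq> F \<longleftrightarrow> i \<in> F"
proof -
  have i: "{i} \<subseteq> E" "i \<in> cl {i}" using assms cl_superset[of "{i}"] by auto
  show "cl {i} \<in> Vp" using cl_flat[OF i(1)] i(2) by (auto simp: Vp_def)
  have "r {i} = 1" using lat_insert_rank[OF empty_flat, of i] assms r_empty by simp
  then show "r (cl {i}) = 1" using r_cl[OF i(1)] by simp
  show "cl {i} \<subseteq> F \<longleftrightarrow> i \<in> F" if "F \<in> lat {} E" using cl_least[of "{i}" F] i that by auto
qed

lemma atom_below:
  assumes "F \<in> Vp" "r F = 1" "i \<in> F"
  shows "cl {i} = F"
proof -
  have i: "i \<in> E" using assms VpD by blast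
  have "cl {i} \<subseteq> F" using rank_one_flat(3)[OF i VpD(1)[OF assms(1)]] assms by simp
  then show ?thesis using Vp_strict[of "cl {i}" F] rank_one_flat[OF i] assms by auto
qed

lemma flat_covered:
  assumes "G' \<in> lat {} E" "G \<in> lat {} E" "G' \<subset> G"
  obtains G1 where "G1 \<in> lat {} E" "G' \<subseteq> G1" "G1 \<subset> G" "Suc (r G1) = r G"
proof -
  have "\<exists>G1. G1 \<in> lat {} E \<and> G' \<subseteq> G1 \<and> G1 \<subset> G \<and> Suc (r G1) = r G"
    using assms
  proof (induction "r G - r G'" arbitrary: G' rule: less_induct)
    case less
    have lt: "r G' < r G" using lat_strict[OF less.prems(1) _ less.prems(3)] lat_subset(2)[OF less.prems(2)] by blast
    show ?case
    proof (cases "Suc (r G') = r G")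
      case True
      then show ?thesis using less.prems by blast
    next
      case False
      obtain i where i: "i \<in> G" "i \<notin> G'" using less.prems(3) by auto
      have sub: "insert i G' \<subseteq> E" using lat_subset(2)[OF less.prems(2)] less.prems(3) i by auto
      let ?H = "cl (insert i G')"
      have H: "?H \<in> lat {} E" "insert i G' \<subseteq> ?H" "?H \<subseteq> G" "r ?H = r (insert i G')"
        using cl_flat[OF sub] cl_superset[OF sub] cl_least[OF _ less.prems(2), of "insert i G'"] r_cl[OF sub] less.prems(3) i
        by auto
      have rH: "r ?H = Suc (r G')" using H(4) lat_insert_rank[OF less.prems(1), of i] i sub by auto
      then have "?H \<subset> G" using H(3) False by auto
      then obtain G1 where "G1 \<in> lat {} E" "?H \<subseteq> G1" "G1 \<subset> G" "Suc (r G1) = r G"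
        using less.hyps[of ?H] H(1) less.prems(2) rH lt by fastforce
      then show ?thesis using H(2) by blast
    qed
  qed
  then show ?thesis using that by blast
qed

text \<open>The relations between the elements \<open>h\<^sub>F\<close>, the sums of the variables \<open>x\<^sub>G\<close> with \<open>G\<close> above \<open>F\<close>,
  expressed for a linear functional given by its values on monomials.\<close>

definition h_relations :: "('a set multiset \<Rightarrow> real) \<Rightarrow> bool" where
  "h_relations D \<longleftrightarrow> (\<forall>F m. F \<in> Vp \<longrightarrow> r F = 1 \<longrightarrow> D (add_mset F m) = 0) \<and>
    (\<forall>F G m. F \<in> Vp \<longrightarrow> G \<in> Vp \<longrightarrow>
      D (add_mset F (add_mset G m)) + D (add_mset (join F G) (add_mset (join F G) m)) =
      D (add_mset F (add_mset (join F G) m)) + D (add_mset G (add_mset (join F G) m)))"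

section \<open>Powers of the \<open>h_F\<close> modulo the relations\<close>

lemma h_relations_atom: "h_relations D \<Longrightarrow> F \<in> Vp \<Longrightarrow> r F = 1 \<Longrightarrow> D (add_mset F m) = 0"
  unfolding h_relations_def by blast

lemma h_relations_join: "h_relations D \<Longrightarrow> F \<in> Vp \<Longrightarrow> G \<in> Vp \<Longrightarrow>
  D (add_mset F (add_mset G m)) + D (add_mset (join F G) (add_mset (join F G) m)) =
  D (add_mset F (add_mset (join F G) m)) + D (add_mset G (add_mset (join F G) m))"
  unfolding h_relations_def by blast

lemma h_relations_add: "h_relations D \<Longrightarrow> h_relations (\<lambda>n. D (add_mset F n))"
  unfolding h_relations_def by (simp add: add_mset_commute[of F])

text \<open>Choose an atom \<open>a\<close> inside \<open>G\<close> but not inside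
  \<open>G1\<close>. The join of \<open>G1\<close> and \<open>a\<close> is \<open>G\<close>, and as
  \<open>h_a = 0\<close> the relation for this pair reads
  \<open>h_G * h_G = h_G1 * h_G\<close>.\<close>

lemma h_cover:
  assumes D: "h_relations D" and G: "G \<in> Vp" "G1 \<in> Vp" "G1 \<subset> G" "Suc (r G1) = r G"
  shows "D (add_mset G (add_mset G m)) = D (add_mset G1 (add_mset G m))"
proof -
  obtain i where i: "i \<in> G" "i \<notin> G1" using G by auto
  have iE: "i \<in> E" using i G VpD by blast
  let ?a = "cl {i}"
  note a = rank_one_flat[OF iE]
  have "join G1 ?a \<subseteq> G" using join_subset_iff[OF G(2) a(1) VpD(1)[OF G(1)]] a(3)[OF VpD(1)[OF G(1)]] i G by blast
  moreover have "\<not> join G1 ?a \<subset> G"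
  proof
    assume "join G1 ?a \<subset> G"
    then have "r (join G1 ?a) < r G" using Vp_strict join_Vp[OF G(2) a(1)] G by blast
    moreover have "i \<in> join G1 ?a" using join_Vp[OF G(2) a(1)] a(3)[of "join G1 ?a"] VpD by blast
    then have "G1 \<subset> join G1 ?a" using join_Vp[OF G(2) a(1)] i by blast
    then have "r G1 < r (join G1 ?a)" using Vp_strict join_Vp[OF G(2) a(1)] G by blast
    ultimately show False using G(4) by simp
  qed
  ultimately have H: "join G1 ?a = G" by blast
  have "D (add_mset G1 (add_mset ?a m)) = 0" "D (add_mset ?a (add_mset G m)) = 0"
    using h_relations_atom[OF D a(1,2)] by (simp_all add: add_mset_commute[of G1])
  then show ?thesis using h_relations_join[OF D G(2) a(1), of m] unfolding H by simp
qed

lemma h_cover_power: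
  assumes D: "h_relations D" and G: "G \<in> Vp" "G1 \<in> Vp" "G1 \<subset> G" "Suc (r G1) = r G"
  shows "D (replicate_mset k G + add_mset G m) = D (replicate_mset k G1 + add_mset G m)"
proof (induction k arbitrary: m)
  case (Suc k)
  have "D (replicate_mset (Suc k) G + add_mset G m) = D (add_mset G (add_mset G (replicate_mset k G + m)))" by simp
  also have "\<dots> = D (add_mset G1 (add_mset G (replicate_mset k G + m)))" by (rule h_cover[OF D G])
  also have "\<dots> = D (replicate_mset k G + add_mset G (add_mset G1 m))" by (simp add: add_mset_commute)
  also have "\<dots> = D (replicate_mset k G1 + add_mset G (add_mset G1 m))" by (rule Suc)
  finally show ?case by (simp add: add_mset_commute)
qed simp

text \<open>All factors but one are traded for a flat \<open>G1\<close> covered by \<open>G\<close>,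
  which leaves exactly \<open>r G1\<close> factors \<open>h_G1\<close>. The rank drops until an atom
  is reached.\<close>

lemma h_power_zero:
  assumes D: "h_relations D" and "G \<in> Vp"
  shows "D (replicate_mset (r G) G + m) = 0"
  using assms(2)
proof (induction "r G" arbitrary: G m rule: less_induct)
  case less
  show ?case
  proof (cases "r G = 1")
    case True
    then show ?thesis using h_relations_atom[OF D less.prems True, of m] by simp
  next
    case False
    have "{} \<subset> G" using less.prems by (auto simp: Vp_def)
    then obtain G1 where G1: "G1 \<in> lat {} E" "G1 \<subset> G" "Suc (r G1) = r G"
      using flat_covered[OF empty_flat VpD(1)[OF less.prems]] by metis
    have "G1 \<noteq> {}" using G1 False r_empty by auto
    then have G1V: "G1 \<in> Vp" using G1 by (simp add: Vp_def)
    have "replicate_mset (r G) G + m = replicate_mset (r G1) G + add_mset G m"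
      unfolding G1(3)[symmetric] by simp
    then have "D (replicate_mset (r G) G + m) = D (replicate_mset (r G1) G1 + add_mset G m)"
      using h_cover_power[OF D less.prems G1V G1(2,3)] by simp
    also have "\<dots> = 0" using less.hyps[OF _ G1V, of "add_mset G m"] G1 by simp
    finally show ?thesis .
  qed
qed

text \<open>All factors \<open>h_G\<close> but one are moved down to a flat \<open>G1\<close>
  covered by \<open>G\<close> and above \<open>G'\<close>. There the rank difference is smaller, so
  \<open>h_G'\<close> is absorbed by induction, and the factors are moved up again.\<close>

lemma h_power_absorb:
  assumes D: "h_relations D" and "G' \<in> Vp" "G \<in> Vp" "G' \<subset> G"
  shows "D (add_mset G' (replicate_mset (r G - r G') G + m)) = D (add_mset G (replicate_mset (r G - r G') G + m))"
  using assms(3,4)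
proof (induction "r G - r G'" arbitrary: G m rule: less_induct)
  case less
  have lt: "r G' < r G" using Vp_strict assms less.prems by blast
  obtain G1 where G1: "G1 \<in> lat {} E" "G' \<subseteq> G1" "G1 \<subset> G" "Suc (r G1) = r G"
    using flat_covered[OF VpD(1)[OF assms(2)] VpD(1)[OF less.prems(1)] less.prems(2)] by blast
  have G1V: "G1 \<in> Vp" using G1 assms(2) by (auto simp: Vp_def)
  have k: "r G - r G' = Suc (r G1 - r G')" using G1(4) r_mono[OF G1(2)] by simp
  show ?case
  proof (cases "G1 = G'")
    case True
    then show ?thesis unfolding k using h_cover[OF D less.prems(1) G1V G1(3,4)] by simp
  next
    case False
    let ?k = "r G1 - r G'"
    have "D (add_mset G' (replicate_mset (r G - r G') G + m)) = D (replicate_mset ?k G + add_mset G (add_mset G' m))"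
      unfolding k by (simp add: add_mset_commute)
    also have "\<dots> = D (replicate_mset ?k G1 + add_mset G (add_mset G' m))"
      by (rule h_cover_power[OF D less.prems(1) G1V G1(3,4)])
    also have "\<dots> = D (add_mset G' (replicate_mset ?k G1 + add_mset G m))" by (simp add: add_mset_commute)
    also have "\<dots> = D (add_mset G1 (replicate_mset ?k G1 + add_mset G m))"
      by (rule less.hyps) (use k G1V G1 False in auto)
    also have "\<dots> = D (replicate_mset (Suc ?k) G1 + add_mset G m)" by (simp add: add_mset_commute)
    also have "\<dots> = D (replicate_mset (Suc ?k) G + add_mset G m)"
      by (rule h_cover_power[OF D less.prems(1) G1V G1(3,4), symmetric])
    finally show ?thesis unfolding k by (simp add: add_mset_commute)
  qed
qed

text \<open>Used twice: straightening increases it, and it orders the nested monomials so that their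
  dual functionals are triangular.\<close>

definition rank_sum :: "'a set multiset \<Rightarrow> nat" where
  "rank_sum m = (\<Sum>F\<in>#m. r F)"

lemma rank_sum_le:
  assumes "set_mset m \<subseteq> Vp"
  shows "rank_sum m \<le> size m * r E"
  using assms
proof (induction m)
  case (add F m)
  have "r F \<le> r E" using add.prems VpD by (intro r_mono) auto
  then show ?case using add by (auto simp: rank_sum_def)
qed (simp add: rank_sum_def)

text \<open>Each relation rewrites a monomial that is not nested into monomials of larger total rank.\<close>

lemma nested_determine:
  assumes D: "h_relations D" and z: "\<And>m. m \<in> nested r (lat {} E) {} \<Longrightarrow> size m = k \<Longrightarrow> D m = 0"
  shows "set_mset m \<subseteq> Vp \<Longrightarrow> size m = k \<Longrightarrow> D m = 0"
proof (induction "size m * r E - rank_sum m" arbitrary: m rule: less_induct)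
  case less
  have larger: "D m' = 0" if "set_mset m' \<subseteq> Vp" "size m' = k" "rank_sum m < rank_sum m'" for m'
    using less.hyps[of m'] that less.prems rank_sum_le[OF that(1)] by auto
  show ?case
  proof (cases "m \<in> nested r (lat {} E) {}")
    case True
    then show ?thesis using z less.prems by blast
  next
    case False
    have above: "set_mset m \<subseteq> {G \<in> lat {} E. {} \<subset> G}" using less.prems by (auto simp: Vp_def)
    consider (inc) F G where "F \<in># m" "G \<in># m" "\<not> F \<subseteq> G" "\<not> G \<subseteq> F"
      | (chain) G where "\<forall>F\<in>#m. \<forall>G\<in>#m. F \<subseteq> G \<or> G \<subseteq> F" "G \<in># m"
          "r G - r (\<Union>{F \<in> set_mset m. F \<subset> G}) \<le> count m G"
    proof (cases "\<forall>F\<in>#m. \<forall>G\<in>#m. F \<subseteq> G \<or> G \<subseteq> F")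
      case True
      then obtain G where "G \<in># m" "\<not> count m G < r G - r ({} \<union> \<Union>{F \<in> set_mset m. F \<subset> G})"
        using False above unfolding nested_def by blast
      then show ?thesis using chain[OF True] by (simp only: not_less Un_empty_left)
    qed (use inc in blast)
    then show ?thesis
    proof cases
      case inc
      then obtain m' where m': "m = add_mset F (add_mset G m')"
        by (metis insert_DiffM insert_noteq_member order_refl)
      have FG: "F \<in> Vp" "G \<in> Vp" "set_mset m' \<subseteq> Vp" "size m' + 2 = k" using less.prems m' by auto
      let ?H = "join F G"
      note H = join_Vp[OF FG(1,2)]
      have rH: "r F < r ?H" "r G < r ?H" using Vp_strict[OF FG(1) H(1)] Vp_strict[OF FG(2) H(1)] H inc by auto
      have "D (add_mset ?H (add_mset ?H m')) = 0" "D (add_mset F (add_mset ?H m')) = 0" "D (add_mset G (add_mset ?H m')) = 0"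
        by (rule larger; use FG H rH in \<open>auto simp: m' rank_sum_def\<close>)+
      then show ?thesis using h_relations_join[OF D FG(1,2), of m'] by (simp add: m')
    next
      case chain
      have G: "G \<in> Vp" using chain less.prems by auto
      show ?thesis
      proof (cases "{F \<in> set_mset m. F \<subset> G} = {}")
        case True
        then have "r G \<le> count m G" using chain(3) r_empty by (metis Sup_empty diff_zero)
        then have "replicate_mset (r G) G \<subseteq># m" by (simp add: count_le_replicate_mset_subset_eq)
        then obtain m' where "m = replicate_mset (r G) G + m'" by (metis subset_mset.le_iff_add)
        then show ?thesis using h_power_zero[OF D G] by simp
      next
        case False
        let ?B = "{F \<in> set_mset m. F \<subset> G}"
        have "finite ?B" "?B \<noteq> {}" using False by auto
        from finite_has_maximal[OF this]
        obtain M where M: "M \<in> ?B" "\<And>F. F \<in> ?B \<Longrightarrow> M \<subseteq> F \<Longrightarrow> M = F" by metis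
        have "F \<subseteq> M" if F: "F \<in> ?B" for F
        proof -
          have "F \<subseteq> M \<or> M \<subseteq> F" using chain(1) M(1) F by simp
          then show ?thesis using M(2)[OF F] by auto
        qed
        then have U: "\<Union>?B = M" using Sup_least[of ?B M] Sup_upper[OF M(1)] by (intro antisym) auto
        have MV: "M \<in> Vp" "M \<in># m" "M \<subset> G" using M less.prems by auto
        let ?k = "r G - r M"
        have "replicate_mset ?k G \<subseteq># m - {#M#}"
          using chain(3) MV(3) unfolding U by (auto simp: count_le_replicate_mset_subset_eq[symmetric])
        then obtain m' where m': "m - {#M#} = replicate_mset ?k G + m'" by (metis subset_mset.le_iff_add)
        have m: "m = add_mset M (replicate_mset ?k G + m')" using MV(2) m' by (metis insert_DiffM)
        have lt: "r M < r G" using Vp_strict[OF MV(1) G MV(3)] .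
        \<comment> \<open>The exponent of \<open>G\<close> reaches its rank difference to the
          predecessor \<open>M\<close>, so one factor \<open>h_M\<close> can be exchanged for
          \<open>h_G\<close>, which raises the total rank.\<close>
        have "D m = D (add_mset G (replicate_mset ?k G + m'))"
          using h_power_absorb[OF D MV(1) G MV(3), of m'] m by simp
        also have "\<dots> = 0"
        proof (rule larger)
          show "set_mset (add_mset G (replicate_mset ?k G + m')) \<subseteq> Vp"
            using less.prems(1) G by (subst (asm) m) (auto split: if_splits)
          show "size (add_mset G (replicate_mset ?k G + m')) = k"
            using less.prems(2) by (subst (asm) m) simp
          show "rank_sum m < rank_sum (add_mset G (replicate_mset ?k G + m'))"
            by (subst m) (use lt in \<open>simp add: rank_sum_def\<close>)
        qed
        finally show ?thesis .
      qed
    qed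
  qed
qed

end

section \<open>Dual functionals\<close>

context ranked
begin

text \<open>The dragon Hall-Rado condition after contraction by \<open>B\<close>: the rank of each
  nonempty subfamily exceeds its size. In top degree it decides whether a product of the
  \<open>h_F\<close> has degree 1 or 0; here \<open>N\<close> may have any size.\<close>

definition dragon :: "'a set \<Rightarrow> 'a set multiset \<Rightarrow> bool" where
  "dragon B N \<longleftrightarrow> (\<forall>J. J \<subseteq># N \<longrightarrow> J \<noteq> {#} \<longrightarrow> r B + size J + 1 \<le> r (B \<union> \<Union>(set_mset J)))"

lemma all_subseteq_add_mset:
  "(\<forall>J. J \<subseteq># add_mset X N \<longrightarrow> Q J) \<longleftrightarrow> (\<forall>J. J \<subseteq># N \<longrightarrow> Q J) \<and> (\<forall>J. J \<subseteq># N \<longrightarrow> Q (add_mset X J))"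
proof (intro iffI conjI allI impI)
  fix J assume Q: "\<forall>J. J \<subseteq># add_mset X N \<longrightarrow> Q J" and J: "J \<subseteq># N"
  have "J \<subseteq># add_mset X N" using J by (simp add: subset_mset.trans)
  then show "Q J" using Q by blast
  show "Q (add_mset X J)" using Q J by simp
next
  fix J assume Q: "(\<forall>J. J \<subseteq># N \<longrightarrow> Q J) \<and> (\<forall>J. J \<subseteq># N \<longrightarrow> Q (add_mset X J))" and J: "J \<subseteq># add_mset X N"
  show "Q J"
  proof (cases "X \<in># J")
    case True
    then obtain K where K: "J = add_mset X K" by (meson mset_add)
    then show ?thesis using Q J by simp
  next
    case False
    have "J \<subseteq># N"
    proof (rule mset_subset_eqI)
      fix a show "count J a \<le> count N a"
        using mset_subset_eq_count[OF J, of a] False by (cases "a = X") (auto simp: not_in_iff)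
    qed
    then show ?thesis using Q by blast
  qed
qed

lemma dragon_add: "dragon B (add_mset X N) \<longleftrightarrow>
  dragon B N \<and> (\<forall>J. J \<subseteq># N \<longrightarrow> r B + size J + 2 \<le> r (B \<union> X \<union> \<Union>(set_mset J)))"
  unfolding dragon_def all_subseteq_add_mset[of X N] by (simp add: Un_assoc)

lemma dragon_add2: "dragon B (add_mset X (add_mset Y N)) \<longleftrightarrow> dragon B N \<and>
  (\<forall>J. J \<subseteq># N \<longrightarrow> r B + size J + 2 \<le> r (B \<union> X \<union> \<Union>(set_mset J))) \<and>
  (\<forall>J. J \<subseteq># N \<longrightarrow> r B + size J + 2 \<le> r (B \<union> Y \<union> \<Union>(set_mset J))) \<and>
  (\<forall>J. J \<subseteq># N \<longrightarrow> r B + size J + 3 \<le> r (B \<union> X \<union> Y \<union> \<Union>(set_mset J)))"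
  unfolding dragon_add all_subseteq_add_mset[of Y N] by (auto simp: Un_assoc)

text \<open>Suppose \<open>J\<close> violates the condition for \<open>X\<close> and
  \<open>K\<close> the one for \<open>Y\<close>. The union of the two sets has large rank by
  \<open>R\<close>, the intersection by the condition on \<open>N\<close>, and the sum contradicts
  submodularity by one.\<close>

lemma dragon_uncross:
  assumes R: "\<And>J. J \<subseteq># N \<Longrightarrow> r B + size J + 3 \<le> r (B \<union> X \<union> Y \<union> \<Union>(set_mset J))" and N: "dragon B N"
  shows "(\<forall>J. J \<subseteq># N \<longrightarrow> r B + size J + 2 \<le> r (B \<union> X \<union> \<Union>(set_mset J))) \<or>
    (\<forall>J. J \<subseteq># N \<longrightarrow> r B + size J + 2 \<le> r (B \<union> Y \<union> \<Union>(set_mset J)))"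
proof (rule ccontr)
  assume "\<not> ?thesis"
  then obtain J K where J: "J \<subseteq># N" "r (B \<union> X \<union> \<Union>(set_mset J)) < r B + size J + 2"
    and K: "K \<subseteq># N" "r (B \<union> Y \<union> \<Union>(set_mset K)) < r B + size K + 2" by (auto simp: not_le)
  let ?S = "B \<union> X \<union> \<Union>(set_mset J)" and ?T = "B \<union> Y \<union> \<Union>(set_mset K)"
  have "J \<union># K + J \<inter># K = J + K" by (rule multiset_eqI) (simp add: max_def min_def)
  then have size: "size (J \<union># K) + size (J \<inter># K) = size J + size K" by (metis size_union)
  have "r B + size (J \<union># K) + 3 \<le> r (B \<union> X \<union> Y \<union> \<Union>(set_mset (J \<union># K)))" using J K by (intro R) auto
  also have "B \<union> X \<union> Y \<union> \<Union>(set_mset (J \<union># K)) = ?S \<union> ?T" by auto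
  finally have un: "r B + size (J \<union># K) + 3 \<le> r (?S \<union> ?T)" .
  have sub: "J \<inter># K \<subseteq># N" using J(1) by (meson subset_mset.inf_le1 subset_mset.order_trans)
  have "r B + size (J \<inter># K) \<le> r (B \<union> \<Union>(set_mset (J \<inter># K)))"
  proof (cases "J \<inter># K = {#}")
    case True
    then show ?thesis by simp
  next
    case False
    then have "r B + size (J \<inter># K) + 1 \<le> r (B \<union> \<Union>(set_mset (J \<inter># K)))"
      using N sub unfolding dragon_def by blast
    then show ?thesis by simp
  qed
  also have "\<dots> \<le> r (?S \<inter> ?T)" by (intro r_mono) auto
  finally show False using r_submod[of ?S ?T] un size J(2) K(2) by linarith
qed

text \<open>Each indicator is a conjunction of conditions on \<open>N\<close>, on single sets and on
  the pair. The pair condition \<open>R0\<close> is common to all four and implies the one for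
  \<open>H\<close>. What remains is \<open>[X and Y] + 1 = [X] + [Y]\<close>, that is,
  \<open>X\<close> or \<open>Y\<close> satisfies its condition, and this is
  \<open>dragon_uncross\<close>.\<close>

lemma dragon_relation:
  assumes H: "\<And>Z. r (B \<union> H \<union> Z) = r (B \<union> X \<union> Y \<union> Z)" and sub: "X \<subseteq> H" "Y \<subseteq> H"
  shows "of_bool (dragon B (add_mset X (add_mset Y N))) + of_bool (dragon B (add_mset H (add_mset H N))) =
    (of_bool (dragon B (add_mset X (add_mset H N))) + of_bool (dragon B (add_mset Y (add_mset H N))) :: real)"
proof -
  define Q where "Q X \<longleftrightarrow> (\<forall>J. J \<subseteq># N \<longrightarrow> r B + size J + 2 \<le> r (B \<union> X \<union> \<Union>(set_mset J)))" for X
  define R0 where "R0 \<longleftrightarrow> (\<forall>J. J \<subseteq># N \<longrightarrow> r B + size J + 3 \<le> r (B \<union> X \<union> Y \<union> \<Union>(set_mset J)))"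
  have "B \<union> X \<union> H \<union> Z = B \<union> H \<union> Z" "B \<union> Y \<union> H \<union> Z = B \<union> H \<union> Z" "B \<union> H \<union> H \<union> Z = B \<union> H \<union> Z" for Z
    using sub by auto
  then have R: "r (B \<union> X \<union> H \<union> Z) = r (B \<union> X \<union> Y \<union> Z)" "r (B \<union> Y \<union> H \<union> Z) = r (B \<union> X \<union> Y \<union> Z)"
    "r (B \<union> H \<union> H \<union> Z) = r (B \<union> X \<union> Y \<union> Z)" for Z
    using H[of Z] by simp_all
  have RQ: "Q H" if R0
    unfolding Q_def
  proof (intro allI impI)
    fix J assume "J \<subseteq># N"
    then have "r B + size J + 3 \<le> r (B \<union> H \<union> \<Union>(set_mset J))" using that H by (simp add: R0_def)
    then show "r B + size J + 2 \<le> r (B \<union> H \<union> \<Union>(set_mset J))" by simp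
  qed
  have or: "Q X \<or> Q Y" if R0 "dragon B N"
    unfolding Q_def by (rule dragon_uncross) (use that R0_def in blast)+
  have "dragon B (add_mset X (add_mset Y N)) \<longleftrightarrow> dragon B N \<and> Q X \<and> Q Y \<and> R0"
    "dragon B (add_mset H (add_mset H N)) \<longleftrightarrow> dragon B N \<and> Q H \<and> Q H \<and> R0"
    "dragon B (add_mset X (add_mset H N)) \<longleftrightarrow> dragon B N \<and> Q X \<and> Q H \<and> R0"
    "dragon B (add_mset Y (add_mset H N)) \<longleftrightarrow> dragon B N \<and> Q Y \<and> Q H \<and> R0"
    unfolding dragon_add2 R Q_def R0_def by (rule refl)+
  then show ?thesis using RQ or by (cases "Q X"; cases "Q Y"; cases R0; cases "dragon B N") auto
qed

lemma dragon_cong: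
  assumes "\<And>Z. r (B \<union> X \<union> Z) = r (B \<union> Y \<union> Z)"
  shows "dragon B (add_mset X N) = dragon B (add_mset Y N)"
  unfolding dragon_add assms ..

end

context flats
begin

lemma r_cl_Un:
  assumes "X \<subseteq> E"
  shows "r (cl X \<union> Z) = r (X \<union> Z)"
proof -
  have "r ((X \<union> Z) \<union> cl X) = r (X \<union> Z)"
  proof (rule r_Un_same)
    show "finite (cl X)" using cl_subset_E finite_E finite_subset by blast
    fix e assume "e \<in> cl X"
    then show "r (insert e (X \<union> Z)) = r (X \<union> Z)"
      using r_insert_same_mono[of X "X \<union> Z" e] by (simp add: cl_def)
  qed
  moreover have "(X \<union> Z) \<union> cl X = cl X \<union> Z" using cl_superset[OF assms] by auto
  ultimately show ?thesis by simp
qed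

text \<open>The dual functional of a nested monomial \<^term>\<open>m\<close>: the product, over the steps of the flag of
  flats in \<^term>\<open>m\<close>, of the dragon Hall--Rado functionals of the corresponding minors.\<close>

definition flag :: "'a set multiset \<Rightarrow> 'a set set" where
  "flag m = insert E (set_mset m)"

text \<open>For a nested \<open>m\<close> the flag is a chain containing \<open>E\<close>, so for a
  flat \<open>G\<close> this is its smallest member above \<open>G\<close>. It names the minor in
  which \<open>h_G\<close> is tested.\<close>

definition level :: "'a set multiset \<Rightarrow> 'a set \<Rightarrow> 'a set" where
  "level m G = \<Inter>{F \<in> flag m. G \<subseteq> F}"

definition below :: "'a set multiset \<Rightarrow> 'a set \<Rightarrow> 'a set" where
  "below m F = \<Union>{H \<in> flag m. H \<subset> F}"

definition at_level :: "'a set multiset \<Rightarrow> 'a set \<Rightarrow> 'a set multiset \<Rightarrow> 'a set multiset" where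
  "at_level m F n = filter_mset (\<lambda>G. level m G = F) n"

definition dual :: "'a set multiset \<Rightarrow> 'a set multiset \<Rightarrow> real" where
  "dual m n = of_bool (set_mset n \<subseteq> Vp \<and>
     (\<forall>F\<in>flag m. size (at_level m F n) = count m F \<and> dragon (below m F) (at_level m F n)))"

context
  fixes m assumes m: "m \<in> nested r (lat {} E) {}"
begin

lemma flag_Vp: "F \<in> flag m \<Longrightarrow> F \<in> Vp"
  using nested_above[OF m] E_Vp by (auto simp: flag_def Vp_def)

lemma flag_chain: "F \<in> flag m \<Longrightarrow> G \<in> flag m \<Longrightarrow> F \<subseteq> G \<or> G \<subseteq> F"
proof -
  assume FG: "F \<in> flag m" "G \<in> flag m"
  then have "F \<subseteq> E" "G \<subseteq> E" using flag_Vp VpD(2) by auto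
  moreover have "F \<in># m \<Longrightarrow> G \<in># m \<Longrightarrow> F \<subseteq> G \<or> G \<subseteq> F" using m unfolding nested_def by blast
  ultimately show ?thesis using FG unfolding flag_def by blast
qed

lemma level_flag:
  assumes "G \<in> Vp"
  shows "level m G \<in> flag m" "G \<subseteq> level m G" "F \<in> flag m \<Longrightarrow> G \<subseteq> F \<longleftrightarrow> level m G \<subseteq> F"
proof -
  let ?S = "{F \<in> flag m. G \<subseteq> F}"
  have "finite ?S" "?S \<noteq> {}" using assms VpD by (auto simp: flag_def)
  from finite_has_minimal[OF this] obtain M where M: "M \<in> ?S" "\<And>F. F \<in> ?S \<Longrightarrow> F \<subseteq> M \<Longrightarrow> M = F" by metis
  have "M \<subseteq> F" if F: "F \<in> ?S" for F
  proof -
    have "F \<subseteq> M \<or> M \<subseteq> F" using flag_chain M(1) F by simp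
    then show ?thesis using M(2)[OF F] by auto
  qed
  then have "level m G = M" unfolding level_def by (intro antisym Inf_lower Inf_greatest M(1)) auto
  then show "level m G \<in> flag m" "G \<subseteq> level m G" using M(1) by auto
  show "G \<subseteq> F \<longleftrightarrow> level m G \<subseteq> F" if "F \<in> flag m"
    using that \<open>G \<subseteq> level m G\<close> unfolding level_def by auto
qed

lemma level_self: "F \<in> flag m \<Longrightarrow> level m F = F"
  using level_flag[OF flag_Vp, of F] by auto

lemma level_join:
  assumes "F \<in> Vp" "G \<in> Vp" "level m F \<subseteq> level m G"
  shows "level m (join F G) = level m G"
proof -
  have "join F G \<subseteq> H \<longleftrightarrow> G \<subseteq> H" if "H \<in> flag m" for H
    using join_subset_iff[OF assms(1,2) VpD(1)[OF flag_Vp[OF that]]] level_flag(3)[OF assms(1) that]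
      level_flag(3)[OF assms(2) that] assms(3) by auto
  then show ?thesis unfolding level_def by (metis (mono_tags, lifting))
qed

lemma subset_below: "F \<in> Vp \<Longrightarrow> level m F \<subset> L \<Longrightarrow> F \<subseteq> below m L"
  using level_flag(1,2) unfolding below_def by blast

lemma at_level_add: "at_level m L (add_mset F n) = (if level m F = L then add_mset F (at_level m L n) else at_level m L n)"
  by (simp add: at_level_def)

lemma dual_swap:
  assumes X: "X \<in> Vp" "Y \<in> Vp" "level m X = level m Y"
    and r: "\<And>Z. r (below m (level m X) \<union> X \<union> Z) = r (below m (level m X) \<union> Y \<union> Z)"
  shows "dual m (add_mset X n) = dual m (add_mset Y n)"
proof -
  have "size (at_level m F (add_mset X n)) = size (at_level m F (add_mset Y n))"
    "dragon (below m F) (at_level m F (add_mset X n)) = dragon (below m F) (at_level m F (add_mset Y n))" for F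
    using X(3) dragon_cong[OF r] by (auto simp: at_level_add)
  then show ?thesis unfolding dual_def using X(1,2) by simp
qed

text \<open>\<open>F\<close> is already contained in the flat contracted at the level of
  \<open>G\<close>. There \<open>G\<close> and \<open>join F G\<close> have the same rank together
  with any set, so they are interchangeable, and the four terms of the relation cancel in
  pairs.\<close>

lemma dual_h_lower:
  assumes FG: "F \<in> Vp" "G \<in> Vp" "level m F \<subset> level m G"
  shows "dual m (add_mset F (add_mset G n)) = dual m (add_mset F (add_mset (join F G) n))"
    "dual m (add_mset (join F G) (add_mset (join F G) n)) = dual m (add_mset G (add_mset (join F G) n))"
proof -
  note H = join_Vp[OF FG(1,2)]
  have lev: "level m (join F G) = level m G" using level_join FG by blast
  have sub: "F \<subseteq> below m (level m G)" using subset_below FG by blast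
  have FE: "F \<union> G \<subseteq> E" using FG VpD by blast
  have "r (below m (level m G) \<union> G \<union> Z) = r (below m (level m G) \<union> join F G \<union> Z)" for Z
  proof -
    have "below m (level m G) \<union> G \<union> Z = (F \<union> G) \<union> (below m (level m G) \<union> Z)"
      "below m (level m G) \<union> join F G \<union> Z = cl (F \<union> G) \<union> (below m (level m G) \<union> Z)"
      using sub by (auto simp: join_def)
    then show ?thesis using r_cl_Un[OF FE] by simp
  qed
  then have sw: "dual m (add_mset G n) = dual m (add_mset (join F G) n)" for n
    by (intro dual_swap[OF FG(2) H(1) lev[symmetric]])
  show "dual m (add_mset F (add_mset G n)) = dual m (add_mset F (add_mset (join F G) n))"
    using sw[of "add_mset F n"] by (simp add: add_mset_commute)
  show "dual m (add_mset (join F G) (add_mset (join F G) n)) = dual m (add_mset G (add_mset (join F G) n))"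
    using sw by simp
qed

text \<open>Both flats and their join are tested in the same minor, while the other steps contribute
  a common condition \<open>C\<close>. The rest is \<open>dragon_relation\<close>.\<close>

lemma dual_h_equal:
  assumes FG: "F \<in> Vp" "G \<in> Vp" "level m F = level m G"
  shows "dual m (add_mset F (add_mset G n)) + dual m (add_mset (join F G) (add_mset (join F G) n)) =
    dual m (add_mset F (add_mset (join F G) n)) + dual m (add_mset G (add_mset (join F G) n))"
proof -
  let ?L = "level m G" and ?H = "join F G"
  let ?B = "below m ?L" and ?N = "at_level m ?L n"
  note H = join_Vp[OF FG(1,2)]
  have lev: "level m ?H = ?L" using level_join FG by blast
  have FE: "F \<union> G \<subseteq> E" using FG VpD by blast
  define C where "C \<longleftrightarrow> set_mset n \<subseteq> Vp \<and> size ?N + 2 = count m ?L \<and>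
    (\<forall>K\<in>flag m - {?L}. size (at_level m K n) = count m K \<and> dragon (below m K) (at_level m K n))"
  have dual: "dual m (add_mset X (add_mset Y n)) = of_bool (C \<and> dragon ?B (add_mset X (add_mset Y ?N)))"
    if "X \<in> {F, G, ?H}" "Y \<in> {F, G, ?H}" for X Y
  proof -
    have XY: "X \<in> Vp" "Y \<in> Vp" "level m X = ?L" "level m Y = ?L" using that FG H lev by auto
    have at: "at_level m K (add_mset X (add_mset Y n)) = (if K = ?L then add_mset X (add_mset Y ?N) else at_level m K n)" for K
      using XY by (simp add: at_level_add)
    have fl: "flag m = insert ?L (flag m - {?L})" using level_flag(1)[OF FG(2)] by auto
    have "(\<forall>K\<in>flag m. size (at_level m K (add_mset X (add_mset Y n))) = count m K \<and>
        dragon (below m K) (at_level m K (add_mset X (add_mset Y n)))) \<longleftrightarrow>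
      (size ?N + 2 = count m ?L \<and> dragon ?B (add_mset X (add_mset Y ?N))) \<and>
      (\<forall>K\<in>flag m - {?L}. size (at_level m K n) = count m K \<and> dragon (below m K) (at_level m K n))"
      unfolding at by (subst fl) (auto simp del: insert_Diff_single)
    then show ?thesis unfolding dual_def C_def using XY(1,2) by (auto simp: of_bool_def)
  qed
  have rel: "of_bool (dragon ?B (add_mset F (add_mset G ?N))) + of_bool (dragon ?B (add_mset ?H (add_mset ?H ?N))) =
    (of_bool (dragon ?B (add_mset F (add_mset ?H ?N))) + of_bool (dragon ?B (add_mset G (add_mset ?H ?N))) :: real)"
  proof (rule dragon_relation[OF _ H(2,3)])
    fix Z
    have "?B \<union> ?H \<union> Z = cl (F \<union> G) \<union> (?B \<union> Z)" "?B \<union> F \<union> G \<union> Z = (F \<union> G) \<union> (?B \<union> Z)"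
      by (auto simp: join_def)
    then show "r (?B \<union> ?H \<union> Z) = r (?B \<union> F \<union> G \<union> Z)" using r_cl_Un[OF FE] by simp
  qed
  show ?thesis
  proof (cases C)
    case True
    then show ?thesis using rel by (simp add: dual)
  qed (simp add: dual)
qed

lemma dual_h_relations: "h_relations (dual m)"
  unfolding h_relations_def
proof (intro conjI allI impI)
  fix F n assume F: "F \<in> Vp" "r F = 1"
  let ?L = "level m F"
  \<comment> \<open>An atom raises the rank by at most one, but the family consisting of
    \<open>F\<close> alone would need two.\<close>
  have "\<not> dragon (below m ?L) (at_level m ?L (add_mset F n))"
  proof
    assume "dragon (below m ?L) (at_level m ?L (add_mset F n))"
    then have "r (below m ?L) + 2 \<le> r (below m ?L \<union> F)"
      unfolding dragon_def at_level_add by (auto dest!: spec[of _ "{#F#}"])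
    moreover have "r (below m ?L \<union> F) \<le> r (below m ?L) + 1" using r_submod[of "below m ?L" F] F(2) by simp
    ultimately show False by simp
  qed
  then show "dual m (add_mset F n) = 0" unfolding dual_def using level_flag(1)[OF F(1)] by auto
next
  fix F G n assume FG: "F \<in> Vp" "G \<in> Vp"
  consider "level m F = level m G" | "level m F \<subset> level m G" | "level m G \<subset> level m F"
    using flag_chain[OF level_flag(1)[OF FG(1)] level_flag(1)[OF FG(2)]] by blast
  then show "dual m (add_mset F (add_mset G n)) + dual m (add_mset (join F G) (add_mset (join F G) n)) =
    dual m (add_mset F (add_mset (join F G) n)) + dual m (add_mset G (add_mset (join F G) n))"
  proof cases
    case 1
    then show ?thesis by (rule dual_h_equal[OF FG])
  next
    case 2
    then show ?thesis using dual_h_lower[OF FG] by simp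
  next
    case 3
    have "join G F = join F G" by (simp add: join_def Un_commute)
    then show ?thesis using dual_h_lower[OF FG(2,1) 3, of n] by (simp add: add_mset_commute)
  qed
qed

lemma dual_nonzero:
  assumes "dual m n \<noteq> 0"
  shows "set_mset n \<subseteq> Vp" "image_mset (level m) n = m"
proof -
  show n: "set_mset n \<subseteq> Vp" using assms by (auto simp: dual_def)
  show "image_mset (level m) n = m"
  proof (rule multiset_eqI)
    fix F
    have c: "count (image_mset (level m) n) F = size (at_level m F n)"
      by (induction n) (auto simp: at_level_def)
    show "count (image_mset (level m) n) F = count m F"
    proof (cases "F \<in> flag m")
      case True
      then show ?thesis using assms c by (auto simp: dual_def)
    next
      case False
      then have "F \<notin># m" by (auto simp: flag_def)
      moreover have "at_level m F n = {#}" unfolding at_level_def using level_flag(1) n False by auto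
      ultimately show ?thesis using c by (simp add: not_in_iff)
    qed
  qed
qed

lemma dual_size: "dual m n \<noteq> 0 \<Longrightarrow> size n = size m"
  using dual_nonzero(2) by (metis size_image_mset)

text \<open>A nonzero value forces the levels of \<open>n\<close> to form \<open>m\<close>. So
  \<open>n\<close> arises from \<open>m\<close> by shrinking flats, and a proper shrinking loses
  rank.\<close>

lemma dual_triangular:
  assumes "dual m n \<noteq> 0" "n \<noteq> m"
  shows "rank_sum n < rank_sum m"
proof -
  have le: "r G \<le> r (level m G)" if "G \<in># n" for G
    using dual_nonzero(1)[OF assms(1)] that level_flag(2) by (intro r_mono) auto
  obtain G where G: "G \<in># n" "level m G \<noteq> G"
  proof (rule ccontr)
    assume "\<not> thesis"
    then have "image_mset (level m) n = n" using that by (auto intro!: image_mset_cong[of n _ id, simplified])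
    then show False using dual_nonzero(2)[OF assms(1)] assms(2) by simp
  qed
  have GV: "G \<in> Vp" using G dual_nonzero(1)[OF assms(1)] by auto
  have "G \<subset> level m G" using G level_flag(2)[OF GV] by auto
  then have lt: "r G < r (level m G)" using Vp_strict[OF GV flag_Vp[OF level_flag(1)[OF GV]]] by blast
  obtain n' where n': "n = add_mset G n'" using G(1) by (meson mset_add)
  have "(\<Sum>F\<in>#n'. r F) \<le> (\<Sum>F\<in>#n'. r (level m F))" using le n' by (intro sum_mset_mono) auto
  then have "rank_sum n < (\<Sum>F\<in>#n. r (level m F))" using lt by (simp add: n' rank_sum_def)
  also have "(\<Sum>F\<in>#n. r (level m F)) = rank_sum (image_mset (level m) n)"
    by (simp add: rank_sum_def image_mset.compositionality o_def)
  finally show ?thesis using dual_nonzero(2)[OF assms(1)] by simp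
qed

text \<open>At level \<open>F\<close> only copies of \<open>F\<close> occur, and with the
  predecessor they span \<open>F\<close>. The dragon condition is then precisely the exponent bound
  in \<open>nested\<close>.\<close>

lemma dual_self: "dual m m = 1"
proof -
  have sub: "set_mset m \<subseteq> Vp" using flag_Vp by (auto simp: flag_def)
  have "size (at_level m F m) = count m F \<and> dragon (below m F) (at_level m F m)" if F: "F \<in> flag m" for F
  proof -
    have "at_level m F m = filter_mset (\<lambda>G. G = F) m"
      unfolding at_level_def using level_self by (intro filter_mset_cong) (auto simp: flag_def)
    then have at: "at_level m F m = replicate_mset (count m F) F" by (simp add: filter_eq_replicate_mset)
    have "dragon (below m F) (replicate_mset (count m F) F)"
      unfolding dragon_def
    proof (intro allI impI)
      fix J assume J: "J \<subseteq># replicate_mset (count m F) F" "J \<noteq> {#}"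
      have sJ: "size J \<le> count m F" using size_mset_mono[OF J(1)] by simp
      have "set_mset J \<subseteq> {F}" using set_mset_mono[OF J(1)] by (auto split: if_splits)
      then have setJ: "set_mset J = {F}" using J(2) by auto
      then have "F \<in># m" using sJ J(2) by (auto simp: nonempty_has_size[symmetric] intro!: count_inI)
      then have c: "count m F < r F - r ({} \<union> \<Union>{G \<in> set_mset m. G \<subset> F})" using m unfolding nested_def by blast
      have "{G \<in> set_mset m. G \<subset> F} = {H \<in> flag m. H \<subset> F}"
        using flag_Vp[OF F] VpD(2) by (auto simp: flag_def)
      then have "{} \<union> \<Union>{G \<in> set_mset m. G \<subset> F} = below m F" by (simp only: below_def Un_empty_left)
      then have "count m F < r F - r (below m F)" using c by simp
      moreover have "below m F \<union> \<Union>(set_mset J) = F" unfolding setJ by (auto simp: below_def)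
      ultimately show "r (below m F) + size J + 1 \<le> r (below m F \<union> \<Union>(set_mset J))" using sJ by simp
    qed
    then show ?thesis unfolding at by simp
  qed
  then show ?thesis unfolding dual_def using sub by simp
qed

end

end

section \<open>Change of generators\<close>

lemma hat_add_fun: "hat V c (\<lambda>n. L n + L' n) m = hat V c L m + hat V c L' m"
proof (induction m arbitrary: L L')
  case (add F m)
  have "shift V (c F) (\<lambda>n. L n + L' n) = (\<lambda>n. shift V (c F) L n + shift V (c F) L' n)"
    by (simp add: shift_def distrib_left sum.distrib)
  then show ?case using add by (simp add: hat_add)
qed simp

lemma hat_set:
  assumes "\<And>n. set_mset n \<subseteq> V \<Longrightarrow> L n = 0"
  shows "hat V c L m = 0"
  using assms
proof (induction m arbitrary: L)
  case (add F m)
  have "hat V c (shift V (c F) L) m = 0"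
    by (rule add.IH) (auto simp: shift_def add.prems intro!: sum.neutral)
  then show ?case by (simp add: hat_add)
qed simp

context flats
begin

definition i0 :: 'a where "i0 = (SOME i. i \<in> E)"

lemma i0_E: "i0 \<in> E"
  unfolding i0_def using E_nonempty by (simp add: some_in_eq)

text \<open>Coefficients of \<open>h\<^sub>F\<close> in the variables \<open>x\<^sub>G\<close>, \<^term>\<open>G \<in> V\<close>, after eliminating \<open>x\<^sub>E\<close> by
  \<open>h\<^bsub>cl {i0}\<^esub> = 0\<close>.\<close>

definition cf :: "'a set \<Rightarrow> 'a set \<Rightarrow> real" where
  "cf F G = of_bool (F \<subseteq> G) - of_bool (i0 \<in> G)"

text \<open>\<open>L\<close> kills the monomial multiples of the generators of \<open>I + J\<close>,
  that is, it is a functional on the Chow ring.\<close>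

definition x_relations :: "('a set multiset \<Rightarrow> real) \<Rightarrow> bool" where
  "x_relations L \<longleftrightarrow> (\<forall>F G m. F \<in> V \<longrightarrow> G \<in> V \<longrightarrow> \<not> F \<subseteq> G \<longrightarrow> \<not> G \<subseteq> F \<longrightarrow> L (add_mset F (add_mset G m)) = 0) \<and>
    (\<forall>i j m. i \<in> E \<longrightarrow> j \<in> E \<longrightarrow>
      (\<Sum>F\<in>V. of_bool (i \<in> F) * L (add_mset F m)) = (\<Sum>F\<in>V. of_bool (j \<in> F) * L (add_mset F m)))"

lemma x_relations_incomparable:
  "x_relations L \<Longrightarrow> F \<in> V \<Longrightarrow> G \<in> V \<Longrightarrow> \<not> F \<subseteq> G \<Longrightarrow> \<not> G \<subseteq> F \<Longrightarrow> L (add_mset F (add_mset G m)) = 0"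
  unfolding x_relations_def by blast

lemma x_relations_linear:
  "x_relations L \<Longrightarrow> i \<in> E \<Longrightarrow> j \<in> E \<Longrightarrow>
    (\<Sum>F\<in>V. of_bool (i \<in> F) * L (add_mset F m)) = (\<Sum>F\<in>V. of_bool (j \<in> F) * L (add_mset F m))"
  unfolding x_relations_def by blast

lemma VD: "F \<in> V \<Longrightarrow> F \<in> Vp" "F \<in> V \<Longrightarrow> F \<in> lat {} E"
  using VpD by (auto simp: V_def)

text \<open>With \<open>H\<close> the join, \<open>h_F - h_H\<close> is the sum of the variables
  above \<open>F\<close> but not above \<open>G\<close>, and likewise with \<open>F\<close> and
  \<open>G\<close> exchanged; the \<open>i0\<close> corrections cancel. A variable of the one kind
  is incomparable to any of the other, so the product lies in the ideal.\<close>

lemma hat_h_relations: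
  assumes L: "x_relations L"
  shows "h_relations (hat V cf L)"
  unfolding h_relations_def
proof (intro conjI allI impI)
  fix F m assume F: "F \<in> Vp" "r F = 1"
  then obtain i where i: "i \<in> F" by (auto simp: Vp_def)
  have iE: "i \<in> E" using i F VpD by blast
  have sub: "F \<subseteq> G \<longleftrightarrow> i \<in> G" if "G \<in> V" for G
    using rank_one_flat(3)[OF iE VD(2)[OF that]] atom_below[OF F i] by simp
  have "shift V (cf F) L n = 0" for n
  proof -
    have "shift V (cf F) L n = (\<Sum>G\<in>V. of_bool (i \<in> G) * L (add_mset G n)) - (\<Sum>G\<in>V. of_bool (i0 \<in> G) * L (add_mset G n))"
      unfolding shift_def cf_def sum_subtractf[symmetric] using sub by (intro sum.cong) (auto simp: left_diff_distrib)
    then show ?thesis using x_relations_linear[OF L iE i0_E] by simp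
  qed
  then show "hat V cf L (add_mset F m) = 0" unfolding hat_add by (rule hat_eq_0I)
next
  fix F G m assume FG: "F \<in> Vp" "G \<in> Vp"
  let ?H = "join F G"
  let ?S = "\<lambda>X Y. shift V (cf Y) (shift V (cf X) L)"
  have "?S F G n + ?S ?H ?H n = ?S F ?H n + ?S G ?H n" for n
  proof -
    have S: "?S X Y n = (\<Sum>A\<in>V. \<Sum>B\<in>V. cf Y A * (cf X B * L (add_mset B (add_mset A n))))" for X Y
      by (simp add: shift_def sum_distrib_left)
    have "?S G ?H n = ?S ?H G n" using shift_commute[of V "cf ?H" "cf G" L] by simp
    moreover have "?S F G n + ?S ?H ?H n - ?S F ?H n - ?S ?H G n = 0"
    proof -
      have "?S F G n + ?S ?H ?H n - ?S F ?H n - ?S ?H G n =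
        (\<Sum>A\<in>V. \<Sum>B\<in>V. (cf G A - cf ?H A) * (cf F B - cf ?H B) * L (add_mset B (add_mset A n)))"
        unfolding S sum.distrib[symmetric] sum_subtractf[symmetric] by (intro sum.cong refl) (simp add: algebra_simps)
      also have "\<dots> = 0"
      proof (intro sum.neutral ballI)
        fix A B assume AB: "A \<in> V" "B \<in> V"
        have j: "?H \<subseteq> K \<longleftrightarrow> F \<subseteq> K \<and> G \<subseteq> K" if "K \<in> V" for K
          using join_subset_iff[OF FG VD(2)[OF that]] .
        show "(cf G A - cf ?H A) * (cf F B - cf ?H B) * L (add_mset B (add_mset A n)) = 0"
        proof (cases "G \<subseteq> A \<and> \<not> F \<subseteq> A \<and> F \<subseteq> B \<and> \<not> G \<subseteq> B")
          case True
          then have "\<not> A \<subseteq> B" "\<not> B \<subseteq> A" by auto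
          then show ?thesis using x_relations_incomparable[OF L AB(2,1)] by simp
        next
          case False
          then show ?thesis unfolding cf_def using j[OF AB(1)] j[OF AB(2)] by auto
        qed
      qed
      finally show ?thesis .
    qed
    ultimately show ?thesis by simp
  qed
  then have "hat V cf (\<lambda>n. ?S F G n + ?S ?H ?H n) m = hat V cf (\<lambda>n. ?S F ?H n + ?S G ?H n) m" by simp
  then show "hat V cf L (add_mset F (add_mset G m)) + hat V cf L (add_mset ?H (add_mset ?H m)) =
    hat V cf L (add_mset F (add_mset ?H m)) + hat V cf L (add_mset G (add_mset ?H m))"
    unfolding hat_add_fun hat_add .
qed

section \<open>Recovering the variables from the \<open>h_F\<close>\<close>

definition mu :: "'a set \<Rightarrow> 'a set \<Rightarrow> real" where
  "mu = (SOME \<mu>. (\<forall>F\<in>Vp. \<forall>H\<in>Vp. (\<Sum>G\<in>{G \<in> Vp. G \<subseteq> H}. \<mu> F G) = (if F = H then 1 else 0)) \<and>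
    (\<forall>F\<in>Vp. \<forall>H\<in>Vp. (\<Sum>G\<in>{G \<in> Vp. F \<subseteq> G}. \<mu> G H) = (if F = H then 1 else 0)))"

lemma mu:
  "F \<in> Vp \<Longrightarrow> H \<in> Vp \<Longrightarrow> (\<Sum>G\<in>{G \<in> Vp. G \<subseteq> H}. mu F G) = (if F = H then 1 else 0)"
  "F \<in> Vp \<Longrightarrow> H \<in> Vp \<Longrightarrow> (\<Sum>G\<in>{G \<in> Vp. F \<subseteq> G}. mu G H) = (if F = H then 1 else 0)"
proof -
  have "\<exists>\<mu> :: 'a set \<Rightarrow> 'a set \<Rightarrow> real. (\<forall>F\<in>Vp. \<forall>H\<in>Vp. (\<Sum>G\<in>{G \<in> Vp. G \<subseteq> H}. \<mu> F G) = (if F = H then 1 else 0)) \<and>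
    (\<forall>F\<in>Vp. \<forall>H\<in>Vp. (\<Sum>G\<in>{G \<in> Vp. F \<subseteq> G}. \<mu> G H) = (if F = H then 1 else 0))"
    by (rule moebius_exists[OF finite_Vp]) blast
  from someI_ex[OF this, folded mu_def]
  show "F \<in> Vp \<Longrightarrow> H \<in> Vp \<Longrightarrow> (\<Sum>G\<in>{G \<in> Vp. G \<subseteq> H}. mu F G) = (if F = H then 1 else 0)"
    "F \<in> Vp \<Longrightarrow> H \<in> Vp \<Longrightarrow> (\<Sum>G\<in>{G \<in> Vp. F \<subseteq> G}. mu G H) = (if F = H then 1 else 0)"
    by blast+
qed

text \<open>The \<open>i0\<close> correction in \<open>cf\<close> is multiplied by the sum of
  \<open>mu G\<close> over all of \<open>Vp\<close>, which vanishes because \<open>G\<close> is not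
  \<open>E\<close>. The other part is Moebius inversion.\<close>

lemma mu_cf:
  assumes "G \<in> V" "A \<in> V"
  shows "(\<Sum>F\<in>Vp. mu G F * cf F A) = of_bool (G = A)"
proof -
  have Vp: "G \<in> Vp" "A \<in> Vp" "G \<noteq> E" using assms by (auto simp: V_def)
  have "(\<Sum>F\<in>Vp. mu G F * of_bool (F \<subseteq> A)) = (\<Sum>F\<in>{F \<in> Vp. F \<subseteq> A}. mu G F)"
    by (rule sum.mono_neutral_cong_right) (use finite_Vp in auto)
  moreover have "(\<Sum>F\<in>Vp. mu G F) = (\<Sum>F\<in>{F \<in> Vp. F \<subseteq> E}. mu G F)"
    using VpD(2) by (intro sum.cong) auto
  moreover have "(\<Sum>F\<in>Vp. mu G F * cf F A) = (\<Sum>F\<in>Vp. mu G F * of_bool (F \<subseteq> A)) - (\<Sum>F\<in>Vp. mu G F) * of_bool (i0 \<in> A)"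
    by (simp add: cf_def right_diff_distrib sum_subtractf sum_distrib_right)
  ultimately show ?thesis using mu(1)[OF Vp(1,2)] mu(1)[OF Vp(1) E_Vp] Vp(3) by simp
qed

text \<open>By \<open>mu_cf\<close> each variable is a linear combination of the \<open>h_F\<close>;
  the monomial is converted one variable at a time.\<close>

lemma hat_determines:
  assumes "\<And>m. set_mset m \<subseteq> Vp \<Longrightarrow> hat V cf L m = 0" "set_mset n \<subseteq> V"
  shows "L n = 0"
  using assms
proof (induction n arbitrary: L)
  case empty
  then show ?case using empty(1)[of "{#}"] by simp
next
  case (add G n)
  have GV: "G \<in> V" using add.prems by auto
  have eq: "L (add_mset G n) = (\<Sum>F\<in>Vp. mu G F * shift V (cf F) L n)" for n
  proof -
    have "(\<Sum>F\<in>Vp. mu G F * shift V (cf F) L n) = (\<Sum>A\<in>V. \<Sum>F\<in>Vp. mu G F * (cf F A * L (add_mset A n)))"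
      unfolding shift_def sum_distrib_left by (rule sum.swap)
    also have "\<dots> = (\<Sum>A\<in>V. (\<Sum>F\<in>Vp. mu G F * cf F A) * L (add_mset A n))"
      by (simp add: sum_distrib_right mult.assoc)
    also have "\<dots> = (\<Sum>A\<in>V. if A = G then L (add_mset A n) else 0)"
      by (rule sum.cong) (auto simp: mu_cf[OF GV])
    finally show ?thesis using GV finite_V by simp
  qed
  have "hat V cf (\<lambda>n. L (add_mset G n)) m = 0" if m: "set_mset m \<subseteq> Vp" for m
  proof -
    have "hat V cf (\<lambda>n. L (add_mset G n)) m = (\<Sum>F\<in>Vp. mu G F * hat V cf L (add_mset F m))"
      unfolding eq hat_sum hat_add ..
    also have "\<dots> = 0" using add.prems(1) m by (intro sum.neutral) auto
    finally show ?thesis .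
  qed
  then show ?case using add.IH[of "\<lambda>n. L (add_mset G n)"] add.prems(2) by simp
qed

text \<open>Transports a functional on products of the \<open>h_F\<close> to monomials in the
  variables, by substituting the Moebius expression for each variable. Indices outside
  \<open>V\<close> are sent to zero so that the support stays in \<open>V\<close>.\<close>

definition pull :: "('a set multiset \<Rightarrow> real) \<Rightarrow> 'a set multiset \<Rightarrow> real" where
  "pull D n = hat Vp (\<lambda>F. if F \<in> V then mu F else (\<lambda>_. 0)) D n"

lemma pull_add: "F \<in> V \<Longrightarrow> pull D (add_mset F n) = pull (shift Vp (mu F) D) n"
  by (simp add: pull_def hat_add)

lemma pull_add_notin: "F \<notin> V \<Longrightarrow> pull D (add_mset F n) = 0"
  by (simp add: pull_def hat_add shift_def)

lemma pull_eq_0I: "(\<And>n. D n = 0) \<Longrightarrow> pull D n = 0"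
  unfolding pull_def by (rule hat_eq_0I)

lemma pull_sum: "(\<Sum>i\<in>I. a i * pull (D i) n) = pull (\<lambda>n. \<Sum>i\<in>I. a i * D i n) n"
  unfolding pull_def by (rule hat_sum[symmetric])

lemma pull_support:
  assumes "\<And>n. D n \<noteq> 0 \<Longrightarrow> size n = k" "pull D n \<noteq> 0"
  shows "set_mset n \<subseteq> V" "size n = k"
proof -
  show "set_mset n \<subseteq> V"
  proof
    fix F assume "F \<in># n"
    then obtain n' where "n = add_mset F n'" by (meson mset_add)
    then show "F \<in> V" using assms(2) pull_add_notin by auto
  qed
  show "size n = k" using hat_size[of 0 k D n] assms unfolding pull_def by auto
qed

lemma mu_shift_above:
  assumes "A \<in> Vp"
  shows "(\<Sum>F\<in>{F \<in> Vp. A \<subseteq> F}. shift Vp (mu F) D n) = D (add_mset A n)"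
proof -
  have "(\<Sum>F\<in>{F \<in> Vp. A \<subseteq> F}. shift Vp (mu F) D n) = (\<Sum>G\<in>Vp. (\<Sum>F\<in>{F \<in> Vp. A \<subseteq> F}. mu F G) * D (add_mset G n))"
    unfolding shift_def sum_distrib_right by (rule sum.swap)
  also have "\<dots> = (\<Sum>G\<in>Vp. if G = A then D (add_mset G n) else 0)"
    by (rule sum.cong) (auto simp: mu(2)[OF assms])
  finally show ?thesis using assms finite_Vp by simp
qed

lemma mu_shift_V:
  assumes "A \<in> Vp"
  shows "(\<Sum>F\<in>V. of_bool (A \<subseteq> F) * shift Vp (mu F) D n) = D (add_mset A n) - shift Vp (mu E) D n"
proof -
  have "(\<Sum>F\<in>{F \<in> Vp. A \<subseteq> F}. shift Vp (mu F) D n) = (\<Sum>F\<in>Vp. of_bool (A \<subseteq> F) * shift Vp (mu F) D n)"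
    by (rule sum.mono_neutral_cong_left) (use finite_Vp in auto)
  also have "\<dots> = shift Vp (mu E) D n + (\<Sum>F\<in>V. of_bool (A \<subseteq> F) * shift Vp (mu F) D n)"
    unfolding V_def using VpD(2)[OF assms] by (subst sum.remove[OF finite_Vp E_Vp]) simp
  finally show ?thesis using mu_shift_above[OF assms] by simp
qed

text \<open>The sum over all flats through \<open>i\<close>, with \<open>E\<close> included, is
  \<open>h\<close> of the atom of \<open>i\<close> and vanishes. What is left is the term of
  \<open>E\<close>, the same for every \<open>i\<close>; this yields the linear relations.\<close>

lemma mu_shift_element:
  assumes D: "h_relations D" and i: "i \<in> E"
  shows "(\<Sum>F\<in>V. of_bool (i \<in> F) * shift Vp (mu F) D n) = - shift Vp (mu E) D n"
proof -
  note a = rank_one_flat[OF i]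
  have "(\<Sum>F\<in>V. of_bool (i \<in> F) * shift Vp (mu F) D n) = (\<Sum>F\<in>V. of_bool (cl {i} \<subseteq> F) * shift Vp (mu F) D n)"
    using a(3)[OF VD(2)] by (intro sum.cong) auto
  then show ?thesis using mu_shift_V[OF a(1)] h_relations_atom[OF D a(1,2)] by simp
qed

lemma pull_x_relations:
  assumes D: "h_relations D"
  shows "x_relations (pull D)"
  unfolding x_relations_def
proof (intro conjI allI impI)
  fix F G m assume FG: "F \<in> V" "G \<in> V" "\<not> F \<subseteq> G" "\<not> G \<subseteq> F"
  have "shift Vp (mu G) (shift Vp (mu F) D) n = 0" for n
  proof (rule moebius_incomparable[where \<beta> = "\<lambda>F G. shift Vp (mu G) (shift Vp (mu F) D) n" and P = Vp and E = E and j = join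
        and b = "\<lambda>A B. D (add_mset A (add_mset B n))"])
    fix A B assume AB: "A \<in> Vp" "B \<in> Vp"
    show "join A B \<in> Vp" using join_Vp[OF AB] by blast
    show "join A B \<subseteq> K \<longleftrightarrow> A \<subseteq> K \<and> B \<subseteq> K" if "K \<in> Vp" for K using join_subset_iff[OF AB VpD(1)[OF that]] .
    show "D (add_mset A (add_mset B n)) + D (add_mset (join A B) (add_mset (join A B) n)) =
      D (add_mset A (add_mset (join A B) n)) + D (add_mset (join A B) (add_mset B n))"
      using h_relations_join[OF D AB, of n] by (simp add: add_mset_commute)
    show "(\<Sum>F\<in>{F \<in> Vp. A \<subseteq> F}. \<Sum>G\<in>{G \<in> Vp. B \<subseteq> G}. shift Vp (mu G) (shift Vp (mu F) D) n) = D (add_mset A (add_mset B n))"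
      unfolding mu_shift_above[OF AB(2)] by (rule mu_shift_above[OF AB(1)])
  qed (use finite_Vp VpD finite_E FG VD in auto)
  then show "pull D (add_mset F (add_mset G m)) = 0"
    unfolding pull_add[OF FG(1)] pull_add[OF FG(2)] by (rule pull_eq_0I)
next
  fix i j m assume ij: "i \<in> E" "j \<in> E"
  have "(\<Sum>F\<in>V. of_bool (i \<in> F) * pull D (add_mset F m)) = pull (\<lambda>n. - shift Vp (mu E) D n) m" if i: "i \<in> E" for i
  proof -
    have "(\<Sum>F\<in>V. of_bool (i \<in> F) * pull D (add_mset F m)) = (\<Sum>F\<in>V. of_bool (i \<in> F) * pull (shift Vp (mu F) D) m)"
      by (rule sum.cong) (simp_all add: pull_add)
    then show ?thesis unfolding pull_sum mu_shift_element[OF D i] .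
  qed
  then show "(\<Sum>F\<in>V. of_bool (i \<in> F) * pull D (add_mset F m)) = (\<Sum>F\<in>V. of_bool (j \<in> F) * pull D (add_mset F m))"
    using ij by simp
qed

text \<open>Substituting \<open>mu\<close> into \<open>cf\<close> gives back \<open>h_F\<close>: the
  eliminated variable of \<open>E\<close> reappears through the sum over flats containing
  \<open>i0\<close>, by \<open>mu_shift_element\<close>.\<close>

lemma hat_pull:
  assumes "h_relations D" "set_mset m \<subseteq> Vp"
  shows "hat V cf (pull D) m = D m"
  using assms
proof (induction m arbitrary: D)
  case empty
  then show ?case by (simp add: pull_def)
next
  case (add F m)
  have F: "F \<in> Vp" using add.prems by auto
  have "shift V (cf F) (pull D) n = pull (\<lambda>n. D (add_mset F n)) n" for n
  proof -
    have "shift V (cf F) (pull D) n = (\<Sum>G\<in>V. cf F G * pull (shift Vp (mu G) D) n)"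
      unfolding shift_def by (rule sum.cong) (simp_all add: pull_add shift_def)
    also have "\<dots> = pull (\<lambda>n. \<Sum>G\<in>V. cf F G * shift Vp (mu G) D n) n" by (rule pull_sum)
    also have "(\<lambda>n. \<Sum>G\<in>V. cf F G * shift Vp (mu G) D n) = (\<lambda>n. D (add_mset F n))"
    proof
      fix n
      have "(\<Sum>G\<in>V. cf F G * shift Vp (mu G) D n) =
        (\<Sum>G\<in>V. of_bool (F \<subseteq> G) * shift Vp (mu G) D n) - (\<Sum>G\<in>V. of_bool (i0 \<in> G) * shift Vp (mu G) D n)"
        by (simp add: cf_def left_diff_distrib sum_subtractf)
      then show "(\<Sum>G\<in>V. cf F G * shift Vp (mu G) D n) = D (add_mset F n)"
        using mu_shift_V[OF F] mu_shift_element[OF add.prems(1) i0_E] by simp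
    qed
    finally show ?thesis .
  qed
  then have "hat V cf (pull D) (add_mset F m) = hat V cf (pull (\<lambda>n. D (add_mset F n))) m"
    unfolding hat_add by (metis ext)
  also have "\<dots> = D (add_mset F m)"
    using add.IH[OF h_relations_add[OF add.prems(1)]] add.prems(2) by simp
  finally show ?case .
qed

end

section \<open>Dimension of the Chow ring\<close>

lemma vector_space_pscale: "vector_space pscale"
  by unfold_locales (auto simp: pscale_def fun_eq_iff algebra_simps)

interpretation poly_space: vector_space pscale
  by (rule vector_space_pscale)

interpretation poly_functional: vector_space_pair pscale "(*) :: real \<Rightarrow> real \<Rightarrow> real"
  by unfold_locales (auto simp: algebra_simps)

section \<open>Finitely supported polynomials and their functionals\<close>

definition delta :: "'b multiset \<Rightarrow> 'b multiset \<Rightarrow> real" where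
  "delta n = (\<lambda>n'. if n' = n then 1 else 0)"

definition supported :: "'b multiset set \<Rightarrow> ('b multiset \<Rightarrow> real) set" where
  "supported X = {f. \<forall>n. f n \<noteq> 0 \<longrightarrow> n \<in> X}"

lemma delta_supported: "n \<in> X \<Longrightarrow> delta n \<in> supported X"
  by (auto simp: delta_def supported_def split: if_splits)

lemma supported_expand:
  fixes X :: "'b multiset set"
  assumes "finite X" "f \<in> supported X"
  shows "f = (\<Sum>n\<in>X. pscale (f n) (delta n))"
proof
  fix n
  have app: "(\<Sum>n\<in>X. g n) x = (\<Sum>n\<in>X. g n x)" for g :: "'b multiset \<Rightarrow> 'b multiset \<Rightarrow> real" and x
    by (induction X rule: infinite_finite_induct) auto
  have "(\<Sum>n'\<in>X. pscale (f n') (delta n')) n = (\<Sum>n'\<in>X. if n' = n then f n' else 0)"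
    unfolding app by (rule sum.cong) (auto simp: pscale_def delta_def)
  then show "f n = (\<Sum>n'\<in>X. pscale (f n') (delta n')) n"
    using assms by (auto simp: supported_def)
qed

lemma supported_span: "finite X \<Longrightarrow> supported X = poly_space.span (delta ` X)"
proof (intro equalityI subsetI)
  fix f assume X: "finite X" and f: "f \<in> supported X"
  show "f \<in> poly_space.span (delta ` X)"
    by (subst supported_expand[OF X f]) (intro poly_space.span_sum poly_space.span_scale poly_space.span_base imageI)
next
  fix f assume "f \<in> poly_space.span (delta ` X)"
  moreover have "poly_space.span (delta ` X) \<subseteq> supported X"
  proof (rule poly_space.span_minimal)
    show "delta ` X \<subseteq> supported X" using delta_supported by auto
    show "poly_space.subspace (supported X)"
      unfolding poly_space.subspace_def by (auto simp: supported_def pscale_def) (metis add.right_neutral)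
  qed
  ultimately show "f \<in> supported X" by blast
qed

lemma inj_delta: "inj_on delta X"
  by (rule inj_onI) (metis delta_def zero_neq_one)

lemma pairing_delta: "finite X \<Longrightarrow> n \<in> X \<Longrightarrow> (\<Sum>x\<in>X. L x * delta n x) = (L n :: real)"
  by (simp add: delta_def if_distrib[of "\<lambda>x. _ * x"] cong: if_cong)

lemma pairing_span_zero:
  assumes "\<And>u. u \<in> S \<Longrightarrow> (\<Sum>n\<in>X. L n * u n) = (0::real)" "f \<in> poly_space.span S"
  shows "(\<Sum>n\<in>X. L n * f n) = 0"
proof -
  have "poly_space.subspace {f. (\<Sum>n\<in>X. L n * f n) = 0}"
    unfolding poly_space.subspace_def
    by (auto simp: pscale_def distrib_left sum.distrib mult.left_commute sum_distrib_left[symmetric])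
  then have "poly_space.span S \<subseteq> {f. (\<Sum>n\<in>X. L n * f n) = 0}"
    using assms(1) by (intro poly_space.span_minimal) auto
  then show ?thesis using assms(2) by auto
qed

lemma independent_delta: "finite X \<Longrightarrow> poly_space.independent (delta ` X)"
proof (induction X rule: finite_induct)
  case (insert n X)
  have "delta n n \<noteq> 0" by (simp add: delta_def)
  then have "delta n \<notin> supported X" using insert(2) unfolding supported_def by blast
  then have "delta n \<notin> poly_space.span (delta ` X)" using supported_span[OF insert(1)] by simp
  then show ?case using insert by (simp add: poly_space.independent_insert)
qed (simp add: poly_space.independent_empty)

lemma dim_supported: "finite X \<Longrightarrow> poly_space.dim (supported X) = card X"
  using poly_space.dim_eq_card_independent[OF independent_delta, of X]
  by (simp add: supported_span poly_space.dim_span card_image[OF inj_delta])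

text \<open>\<open>w\<close> extends a basis of the span, and its coordinate is the functional. The
  values on the \<open>delta\<close> functions represent it as a pairing over
  \<open>X\<close>.\<close>

lemma functional_separating:
  assumes X: "finite X" and w: "w \<in> supported X" "w \<notin> poly_space.span S"
  obtains L where "L \<in> supported X" "\<And>u. u \<in> S \<Longrightarrow> u \<in> supported X \<Longrightarrow> (\<Sum>n\<in>X. L n * u n) = 0"
    "(\<Sum>n\<in>X. L n * w n) = 1"
proof -
  obtain C where C: "C \<subseteq> S" "poly_space.independent C" "S \<subseteq> poly_space.span C"
    using poly_space.maximal_independent_subset by blast
  have "w \<notin> poly_space.span C" using w(2) poly_space.span_mono[OF C(1)] by blast
  then have ind: "poly_space.independent (insert w C)" and wC: "w \<notin> C"
    using C(2) poly_space.span_base by (auto simp: poly_space.independent_insert)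
  obtain g where g: "Vector_Spaces.linear pscale (*) g" "\<forall>x\<in>insert w C. g x = (if x = w then 1 else 0)"
    using poly_functional.linear_independent_extend[OF ind, of "\<lambda>x. if x = w then 1 else 0"] by blast
  interpret g: Vector_Spaces.linear pscale "(*)" g by (rule g(1))
  define L where "L n = (if n \<in> X then g (delta n) else 0)" for n
  have gL: "g f = (\<Sum>n\<in>X. L n * f n)" if "f \<in> supported X" for f
  proof -
    have "g f = g (\<Sum>n\<in>X. pscale (f n) (delta n))" using supported_expand[OF X that] by simp
    also have "\<dots> = (\<Sum>n\<in>X. f n * g (delta n))" by (simp add: g.sum g.scale)
    also have "\<dots> = (\<Sum>n\<in>X. L n * f n)" by (rule sum.cong) (auto simp: L_def)
    finally show ?thesis .
  qed
  have "g u = 0" if "u \<in> S" for u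
  proof (rule poly_functional.linear_eq_0_on_span[OF g(1)])
    show "g x = 0" if "x \<in> C" for x using g(2) wC that by auto
    show "u \<in> poly_space.span C" using C(3) that by blast
  qed
  note gS = this
  show ?thesis
  proof (rule that[of L])
    show "L \<in> supported X" by (auto simp: L_def supported_def)
    show "(\<Sum>n\<in>X. L n * u n) = 0" if "u \<in> S" "u \<in> supported X" for u using gL[OF that(2)] gS[OF that(1)] by simp
    show "(\<Sum>n\<in>X. L n * w n) = 1" using gL[OF w(1)] g(2) by simp
  qed
qed

text \<open>That \<^term>\<open>P\<close> spans the quotient is assumed in the dual form that no nonzero functional on
  the quotient kills it.\<close>

lemma quotient_dim:
  fixes P D :: "'c \<Rightarrow> 'b multiset \<Rightarrow> real" and w :: "'c \<Rightarrow> nat"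
  assumes X: "finite X" and N: "finite N" and S: "S \<subseteq> supported X"
    and P: "\<And>m. m \<in> N \<Longrightarrow> P m \<in> supported X"
    and spanning: "\<And>L. L \<in> supported X \<Longrightarrow> (\<And>u. u \<in> S \<Longrightarrow> (\<Sum>n\<in>X. L n * u n) = 0) \<Longrightarrow>
      (\<And>m. m \<in> N \<Longrightarrow> (\<Sum>n\<in>X. L n * P m n) = 0) \<Longrightarrow> L = (\<lambda>n. 0)"
    and D0: "\<And>m u. m \<in> N \<Longrightarrow> u \<in> S \<Longrightarrow> (\<Sum>n\<in>X. D m n * u n) = 0"
    and D1: "\<And>m. m \<in> N \<Longrightarrow> (\<Sum>n\<in>X. D m n * P m n) = 1"
    and D2: "\<And>m m'. m \<in> N \<Longrightarrow> m' \<in> N \<Longrightarrow> m' \<noteq> m \<Longrightarrow> w m \<le> w m' \<Longrightarrow> (\<Sum>n\<in>X. D m n * P m' n) = 0"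
  shows "poly_space.dim (supported X) - poly_space.dim (poly_space.span S) = card N"
proof -
  have fd: "finite (delta ` X)" and cd: "card (delta ` X) = card X" using X by (auto simp: card_image[OF inj_delta])
  obtain B where B: "B \<subseteq> S" "poly_space.independent B" "S \<subseteq> poly_space.span B" "card B = poly_space.dim S"
    using poly_space.basis_exists by blast
  have spanB: "poly_space.span B = poly_space.span S"
    using B(1,3) by (metis poly_space.span_eq poly_space.span_superset subset_trans)
  have dimS: "poly_space.dim (poly_space.span S) = card B" using B(4) by (simp add: poly_space.dim_span)
  have BX: "B \<subseteq> poly_space.span (delta ` X)" using B(1) S supported_span[OF X] by auto
  have fB: "finite B" using poly_space.independent_span_bound[OF fd B(2) BX] by blast
  \<comment> \<open>If \<open>B\<close> and the \<open>P m\<close> did not span, a separating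
    functional would kill \<open>S\<close> and every \<open>P m\<close>, hence be zero by
    \<open>spanning\<close>, yet take the value 1.\<close>
  have upper: "card X \<le> card B + card N"
  proof -
    have "supported X \<subseteq> poly_space.span (B \<union> P ` N)"
    proof
      fix f assume f: "f \<in> supported X"
      show "f \<in> poly_space.span (B \<union> P ` N)"
      proof (rule ccontr)
        assume "f \<notin> poly_space.span (B \<union> P ` N)"
        then obtain L where L: "L \<in> supported X"
          "\<And>u. u \<in> B \<union> P ` N \<Longrightarrow> u \<in> supported X \<Longrightarrow> (\<Sum>n\<in>X. L n * u n) = 0" "(\<Sum>n\<in>X. L n * f n) = 1"
          by (rule functional_separating[OF X f]) blast
        have LB: "(\<Sum>n\<in>X. L n * u n) = 0" if "u \<in> B" for u using L(2) B(1) S that by blast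
        have "L = (\<lambda>n. 0)"
        proof (rule spanning[OF L(1)])
          fix u assume "u \<in> S"
          then show "(\<Sum>n\<in>X. L n * u n) = 0" using pairing_span_zero[where S = B and X = X and L = L and f = u] LB B(3) by blast
        next
          fix m assume "m \<in> N"
          then show "(\<Sum>n\<in>X. L n * P m n) = 0" using L(2) P by blast
        qed
        then show False using L(3) by simp
      qed
    qed
    then have "delta ` X \<subseteq> poly_space.span (B \<union> P ` N)"
      using supported_span[OF X] poly_space.span_superset by blast
    moreover have "finite (B \<union> P ` N)" using fB N by simp
    ultimately have "card (delta ` X) \<le> card (B \<union> P ` N)"
      using poly_space.independent_span_bound[OF _ independent_delta[OF X]] by simp
    also have "\<dots> \<le> card B + card (P ` N)" by (rule card_Un_le)
    also have "card (P ` N) \<le> card N" using N by (rule card_image_le)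
    finally show ?thesis using cd by simp
  qed
  \<comment> \<open>The \<open>P m\<close> are added in order of decreasing \<open>w\<close>. Then
    \<open>D m\<close> vanishes on \<open>B\<close> and on all earlier members but not on
    \<open>P m\<close>, so independence is kept.\<close>
  have "M \<subseteq> N \<longrightarrow> (\<exists>C. finite C \<and> poly_space.independent C \<and> card C = card B + card M \<and>
      C \<subseteq> poly_space.span (B \<union> P ` M))" if "finite M" for M
    using that
  proof (induction M rule: finite_ranking_induct[where f = "\<lambda>m. - int (w m)"])
    case empty
    show ?case using fB B(2) poly_space.span_superset by (intro impI exI[of _ B]) auto
  next
    case (insert m M)
    show ?case
    proof (cases "m \<in> M")
      case True
      then show ?thesis using insert by (simp add: insert_absorb)
    next
      case False
      show ?thesis
      proof
        assume sub: "insert m M \<subseteq> N"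
        then obtain C where C: "finite C" "poly_space.independent C" "card C = card B + card M"
          "C \<subseteq> poly_space.span (B \<union> P ` M)" using insert.IH by auto
        have mN: "m \<in> N" using sub by simp
        have zero: "(\<Sum>n\<in>X. D m n * u n) = 0" if u: "u \<in> B \<union> P ` M" for u
        proof (cases "u \<in> B")
          case True
          then show ?thesis using D0[OF mN] B(1) by blast
        next
          case False
          then obtain m' where m': "m' \<in> M" "u = P m'" using u by blast
          then have "w m \<le> w m'" "m' \<noteq> m" "m' \<in> N" using insert.hyps(2)[of m'] \<open>m \<notin> M\<close> sub by auto
          then show ?thesis using D2[OF mN] m' by blast
        qed
        have "P m \<notin> poly_space.span (B \<union> P ` M)"
          using pairing_span_zero[where S = "B \<union> P ` M" and X = X and L = "D m" and f = "P m"] zero D1[OF mN] by auto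
        moreover have "poly_space.span C \<subseteq> poly_space.span (B \<union> P ` M)"
          using C(4) poly_space.span_minimal poly_space.subspace_span by blast
        ultimately have nC: "P m \<notin> poly_space.span C" by blast
        then have "P m \<notin> C" using poly_space.span_base by blast
        moreover have "insert (P m) C \<subseteq> poly_space.span (B \<union> P ` insert m M)"
          using C(4) poly_space.span_mono[of "B \<union> P ` M" "B \<union> P ` insert m M"]
            poly_space.span_base[of "P m" "B \<union> P ` insert m M"] by auto
        ultimately show "\<exists>C. finite C \<and> poly_space.independent C \<and> card C = card B + card (insert m M) \<and>
            C \<subseteq> poly_space.span (B \<union> P ` insert m M)"
          using C(1,2,3) nC False insert.hyps(1)
          by (intro exI[of _ "insert (P m) C"]) (simp add: poly_space.independent_insert)
      qed
    qed
  qed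
  then obtain C where C: "finite C" "poly_space.independent C" "card C = card B + card N"
    "C \<subseteq> poly_space.span (B \<union> P ` N)" using N by blast
  have "B \<union> P ` N \<subseteq> poly_space.span (delta ` X)" using BX P supported_span[OF X] by auto
  then have "C \<subseteq> poly_space.span (delta ` X)"
    using C(4) poly_space.span_minimal[OF _ poly_space.subspace_span] by blast
  then have "card C \<le> card X" using poly_space.independent_span_bound[OF fd C(2)] cd by simp
  then show ?thesis using upper C(3) dimS dim_supported[OF X] by simp
qed

lemma finite_monomials_deg: "finite V \<Longrightarrow> finite (monomials_deg V k)"
proof (induction k)
  case 0
  have "monomials_deg V 0 \<subseteq> {{#}}" by (auto simp: monomials_deg_def)
  then show ?case using finite_subset by blast
next
  case (Suc k)
  have "monomials_deg V (Suc k) \<subseteq> (\<lambda>(F, m). add_mset F m) ` (V \<times> monomials_deg V k)"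
  proof
    fix m assume m: "m \<in> monomials_deg V (Suc k)"
    then have "size m = Suc k" by (simp add: monomials_deg_def)
    then obtain F m' where "m = add_mset F m'" by (metis size_eq_Suc_imp_eq_union add_mset_add_single)
    then show "m \<in> (\<lambda>(F, m). add_mset F m) ` (V \<times> monomials_deg V k)"
      using m by (intro image_eqI[of _ _ "(F, m')"]) (auto simp: monomials_deg_def)
  qed
  then show ?case using Suc finite_subset by blast
qed

lemma mono_mult_delta: "mono_mult m (delta n) = delta (m + n)"
  by (auto simp: mono_mult_def delta_def fun_eq_iff)

context flats
begin

text \<open>\<open>quotient_dim\<close> with \<open>P\<close> the products of the \<open>h_F\<close>
  over nested multisets and \<open>D\<close> the pulled back dual functionals. Spanning is
  \<open>nested_determine\<close> followed by \<open>hat_determines\<close>; triangularity survives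
  since pulling back does not change the values on products of the \<open>h_F\<close>.\<close>

lemma chow_dim_nested:
  assumes V: "chow_vars E indep = V"
  shows "chow_dim E indep k = card {m \<in> nested r (lat {} E) {}. size m = k}"
proof -
  let ?X = "monomials_deg V k" and ?N = "{m \<in> nested r (lat {} E) {}. size m = k}"
  let ?S = "{mono_mult m g | m e g. (e, g) \<in> chow_gens E indep \<and> m \<in> monomials_deg V (k - e) \<and> e \<le> k}"
  let ?lin = "\<lambda>i j m n. \<Sum>F\<in>V. (of_bool (i \<in> F) - of_bool (j \<in> F)) * delta (add_mset F m) n :: real"
  define P where "P m = (\<lambda>n. hat V cf (delta n) m)" for m
  have X: "finite ?X" by (rule finite_monomials_deg[OF finite_V])
  have hom: "homog V k = supported ?X" by (simp add: homog_def supported_def)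
  let ?Q = "\<lambda>u. \<exists>F G m. u = delta (add_mset F (add_mset G m)) \<and> F \<in> V \<and> G \<in> V \<and> \<not> F \<subseteq> G \<and> \<not> G \<subseteq> F \<and>
        m \<in> monomials_deg V (k - 2) \<and> 2 \<le> k"
  let ?R = "\<lambda>u. \<exists>i j m. u = ?lin i j m \<and> i \<in> E \<and> j \<in> E \<and> m \<in> monomials_deg V (k - 1) \<and> 1 \<le> k"
  have gens: "u \<in> ?S \<longleftrightarrow> ?Q u \<or> ?R u" for u
  proof -
    have q: "mono_mult m (\<lambda>n. if n = {#F, G#} then 1 else 0) = delta (add_mset F (add_mset G m))" for m F G
      using mono_mult_delta[of m "{#F, G#}"] by (simp add: delta_def)
    have l: "mono_mult m (\<lambda>n. \<Sum>F\<in>V. if n = {#F#} then (if i \<in> F then 1 else 0) - (if j \<in> F then 1 else 0) else 0) = ?lin i j m"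
      for m i j
    proof
      fix n
      have "mono_mult m (\<lambda>n. \<Sum>F\<in>V. if n = {#F#} then (if i \<in> F then 1 else 0) - (if j \<in> F then 1 else 0) else 0) n =
        (\<Sum>F\<in>V. (of_bool (i \<in> F) - of_bool (j \<in> F)) * mono_mult m (delta {#F#}) n)"
        unfolding mono_mult_def by (cases "m \<subseteq># n") (auto simp: delta_def intro!: sum.cong)
      then show "mono_mult m (\<lambda>n. \<Sum>F\<in>V. if n = {#F#} then (if i \<in> F then 1 else 0) - (if j \<in> F then 1 else 0) else 0) n = ?lin i j m n"
        by (simp add: mono_mult_delta)
    qed
    have g: "(e, g) \<in> chow_gens E indep \<longleftrightarrow>
      (\<exists>F G. e = 2 \<and> g = (\<lambda>n. if n = {#F, G#} then 1 else 0) \<and> F \<in> V \<and> G \<in> V \<and> \<not> F \<subseteq> G \<and> \<not> G \<subseteq> F) \<or>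
      (\<exists>i j. e = 1 \<and> g = (\<lambda>n. \<Sum>F\<in>V. if n = {#F#} then (if i \<in> F then 1 else 0) - (if j \<in> F then 1 else 0) else 0) \<and>
        i \<in> E \<and> j \<in> E)" for e g
      unfolding chow_gens_def V Un_iff mem_Collect_eq prod.inject by blast
    show ?thesis
    proof (intro iffI)
      assume "u \<in> ?S"
      then obtain m e g where u: "u = mono_mult m g" "(e, g) \<in> chow_gens E indep" "m \<in> monomials_deg V (k - e)" "e \<le> k"
        by blast
      from u(2)[unfolded g] show "?Q u \<or> ?R u"
      proof (elim disjE exE conjE)
        fix F G assume *: "e = 2" "g = (\<lambda>n. if n = {#F, G#} then 1 else 0)" "F \<in> V" "G \<in> V" "\<not> F \<subseteq> G" "\<not> G \<subseteq> F"
        then have "u = delta (add_mset F (add_mset G m))" using u(1) q by simp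
        then show ?thesis using * u by blast
      next
        fix i j assume *: "e = 1" "i \<in> E" "j \<in> E"
          "g = (\<lambda>n. \<Sum>F\<in>V. if n = {#F#} then (if i \<in> F then 1 else 0) - (if j \<in> F then 1 else 0) else 0)"
        then have "u = ?lin i j m" using u(1) l by simp
        then show ?thesis using * u by blast
      qed
    next
      assume "?Q u \<or> ?R u"
      then show "u \<in> ?S"
      proof (elim disjE exE conjE)
        fix F G m assume *: "u = delta (add_mset F (add_mset G m))" "F \<in> V" "G \<in> V" "\<not> F \<subseteq> G" "\<not> G \<subseteq> F"
          "m \<in> monomials_deg V (k - 2)" "2 \<le> k"
        have "(2, \<lambda>n. if n = {#F, G#} then 1 else 0) \<in> chow_gens E indep" unfolding g using * by blast
        then show ?thesis unfolding *(1) q[symmetric] using * by blast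
      next
        fix i j m assume *: "u = ?lin i j m" "i \<in> E" "j \<in> E" "m \<in> monomials_deg V (k - 1)" "1 \<le> k"
        have "(1, \<lambda>n. \<Sum>F\<in>V. if n = {#F#} then (if i \<in> F then 1 else 0) - (if j \<in> F then 1 else 0) else 0) \<in> chow_gens E indep"
          unfolding g using * by blast
        then show ?thesis unfolding *(1) l[symmetric] using * by blast
      qed
    qed
  qed
  have pair_lin: "(\<Sum>n\<in>?X. L n * ?lin i j m n) =
      (\<Sum>F\<in>V. of_bool (i \<in> F) * L (add_mset F m)) - (\<Sum>F\<in>V. of_bool (j \<in> F) * L (add_mset F m))"
    if "m \<in> monomials_deg V (k - 1)" "1 \<le> k" for L i j m
  proof -
    have "(\<Sum>n\<in>?X. L n * ?lin i j m n) =
        (\<Sum>F\<in>V. \<Sum>n\<in>?X. L n * ((of_bool (i \<in> F) - of_bool (j \<in> F)) * delta (add_mset F m) n))"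
      unfolding sum_distrib_left by (rule sum.swap)
    also have "\<dots> = (\<Sum>F\<in>V. (of_bool (i \<in> F) - of_bool (j \<in> F)) * (\<Sum>n\<in>?X. L n * delta (add_mset F m) n))"
      by (simp add: sum_distrib_left mult.left_commute)
    also have "\<dots> = (\<Sum>F\<in>V. (of_bool (i \<in> F) - of_bool (j \<in> F)) * L (add_mset F m))"
      using that by (intro sum.cong refl) (subst pairing_delta[OF X], auto simp: monomials_deg_def)
    finally show ?thesis by (simp add: left_diff_distrib sum_subtractf)
  qed
  have S: "?S \<subseteq> supported ?X"
  proof
    fix u assume "u \<in> ?S"
    then show "u \<in> supported ?X" unfolding gens
    proof (elim disjE exE conjE)
      fix F G m assume "u = delta (add_mset F (add_mset G m))" "F \<in> V" "G \<in> V" "m \<in> monomials_deg V (k - 2)" "2 \<le> k"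
      then show ?thesis by (auto simp: supported_def delta_def monomials_deg_def)
    next
      fix i j m assume u: "u = ?lin i j m" and m: "m \<in> monomials_deg V (k - 1)" "1 \<le> k"
      have "add_mset F m \<in> ?X" if "F \<in> V" for F using that m by (auto simp: monomials_deg_def)
      then have "?lin i j m n = 0" if "n \<notin> ?X" for n
        using that by (intro sum.neutral) (auto simp: delta_def)
      then show ?thesis unfolding u supported_def by blast
    qed
  qed
  \<comment> \<open>Only relations of degree \<open>k\<close> have to be read off from
    \<open>?S\<close>; in other degrees they hold because \<open>L\<close> vanishes outside
    \<open>?X\<close>.\<close>
  have ann: "x_relations L" if L: "L \<in> supported ?X" "\<And>u. u \<in> ?S \<Longrightarrow> (\<Sum>n\<in>?X. L n * u n) = 0" for L
    unfolding x_relations_def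
  proof (intro conjI allI impI)
    fix F G m assume FG: "F \<in> V" "G \<in> V" "\<not> F \<subseteq> G" "\<not> G \<subseteq> F"
    show "L (add_mset F (add_mset G m)) = 0"
    proof (cases "add_mset F (add_mset G m) \<in> ?X")
      case True
      then have "m \<in> monomials_deg V (k - 2)" "2 \<le> k" by (auto simp: monomials_deg_def)
      then have "delta (add_mset F (add_mset G m)) \<in> ?S" unfolding gens using FG by blast
      then have "(\<Sum>n\<in>?X. L n * delta (add_mset F (add_mset G m)) n) = 0" by (rule L(2))
      then show ?thesis unfolding pairing_delta[OF X True] .
    next
      case False
      then show ?thesis using L(1) by (auto simp: supported_def)
    qed
  next
    fix i j m assume ij: "i \<in> E" "j \<in> E"
    show "(\<Sum>F\<in>V. of_bool (i \<in> F) * L (add_mset F m)) = (\<Sum>F\<in>V. of_bool (j \<in> F) * L (add_mset F m))"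
    proof (cases "m \<in> monomials_deg V (k - 1) \<and> 1 \<le> k")
      case True
      then have "?lin i j m \<in> ?S" unfolding gens using ij by blast
      then have "(\<Sum>n\<in>?X. L n * ?lin i j m n) = 0" by (rule L(2))
      then show ?thesis unfolding pair_lin[OF conjunct1[OF True] conjunct2[OF True]] by simp
    next
      case False
      then have "add_mset F m \<notin> ?X" for F by (auto simp: monomials_deg_def)
      then have "L (add_mset F m) = 0" for F using L(1) by (auto simp: supported_def)
      then show ?thesis by simp
    qed
  qed
  have ann': "(\<Sum>n\<in>?X. L n * u n) = 0" if L: "x_relations L" and u: "u \<in> ?S" for L u
    using u unfolding gens
  proof (elim disjE exE conjE)
    fix F G m assume u: "u = delta (add_mset F (add_mset G m))" "F \<in> V" "G \<in> V" "\<not> F \<subseteq> G" "\<not> G \<subseteq> F"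
      "m \<in> monomials_deg V (k - 2)" "2 \<le> k"
    then have in_X: "add_mset F (add_mset G m) \<in> ?X" by (auto simp: monomials_deg_def)
    show ?thesis unfolding u(1) pairing_delta[OF X in_X] by (intro x_relations_incomparable[OF L] u)
  next
    fix i j m assume "u = ?lin i j m" "i \<in> E" "j \<in> E" "m \<in> monomials_deg V (k - 1)" "1 \<le> k"
    then show ?thesis using pair_lin[of m L i j] x_relations_linear[OF L, of i j m] by simp
  qed
  have pairP: "(\<Sum>n\<in>?X. L n * P m n) = hat V cf L m" if "L \<in> supported ?X" for L m
  proof -
    have "L n = (\<Sum>n'\<in>?X. L n' * delta n' n)" for n
    proof -
      have "(\<Sum>n'\<in>?X. L n' * delta n' n) = (\<Sum>n'\<in>?X. if n' = n then L n' else 0)"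
        by (rule sum.cong) (auto simp: delta_def)
      then show ?thesis using that X by (auto simp: supported_def)
    qed
    then have "hat V cf L m = hat V cf (\<lambda>n. \<Sum>n'\<in>?X. L n' * delta n' n) m" by (metis ext)
    then show ?thesis unfolding hat_sum P_def by simp
  qed
  have NV: "set_mset m \<subseteq> Vp" if "m \<in> ?N" for m using that nested_above[of m r "lat {} E" "{}"] by (auto simp: Vp_def)
  have pull: "pull (dual m) \<in> supported ?X" if m: "m \<in> ?N" for m
  proof -
    have "size n = k" if "dual m n \<noteq> 0" for n using dual_size[of m n] m that by auto
    then show ?thesis using pull_support[of "dual m" k] by (auto simp: supported_def monomials_deg_def)
  qed
  have "poly_space.dim (supported ?X) - poly_space.dim (poly_space.span ?S) = card ?N"
  proof (rule quotient_dim[where P = P and D = "\<lambda>m. pull (dual m)" and w = rank_sum, OF X _ S])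
    show "finite ?N" using finite_nested[OF finite_lat[OF finite_E]] by auto
    show "P m \<in> supported ?X" if m: "m \<in> ?N" for m
      unfolding supported_def
    proof (intro CollectI allI impI)
      fix n assume n: "P m n \<noteq> 0"
      have "size n = k"
      proof (rule ccontr)
        assume "size n \<noteq> k"
        then have "hat V cf (delta n) m = 0"
          using m by (intro hat_size[of 0 "size n"]) (auto simp: delta_def)
        then show False using n by (simp add: P_def)
      qed
      moreover have "set_mset n \<subseteq> V"
      proof (rule ccontr)
        assume "\<not> set_mset n \<subseteq> V"
        then have "hat V cf (delta n) m = 0" by (intro hat_set) (auto simp: delta_def)
        then show False using n by (simp add: P_def)
      qed
      ultimately show "n \<in> ?X" by (simp add: monomials_deg_def)
    qed
    show "L = (\<lambda>n. 0)" if L: "L \<in> supported ?X" "\<And>u. u \<in> ?S \<Longrightarrow> (\<Sum>n\<in>?X. L n * u n) = 0"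
      "\<And>m. m \<in> ?N \<Longrightarrow> (\<Sum>n\<in>?X. L n * P m n) = 0" for L
    proof
      fix n
      have rel: "h_relations (hat V cf L)" using hat_h_relations[OF ann[OF L(1,2)]] .
      have "hat V cf L m = 0" if m: "set_mset m \<subseteq> Vp" for m
      proof (cases "size m = k")
        case True
        show ?thesis
          by (rule nested_determine[OF rel _ m True]) (use L(3) pairP[OF L(1)] in auto)
      next
        case False
        have "L n = 0" if "size n + 0 \<noteq> k" for n using L(1) that by (auto simp: supported_def monomials_deg_def)
        then show ?thesis using hat_size[of 0 k L m] False by auto
      qed
      then have "L n = 0" if "set_mset n \<subseteq> V" using hat_determines[of L n] that by blast
      then show "L n = 0" using L(1) by (auto simp: supported_def monomials_deg_def)
    qed
    fix m assume m: "m \<in> ?N"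
    then have mn: "m \<in> nested r (lat {} E) {}" by simp
    show "(\<Sum>n\<in>?X. pull (dual m) n * u n) = 0" if "u \<in> ?S" for u
      using ann'[OF pull_x_relations[OF dual_h_relations[OF mn]] that] .
    have val: "(\<Sum>n\<in>?X. pull (dual m) n * P m' n) = dual m m'" if "m' \<in> ?N" for m'
      using pairP[OF pull[OF m]] hat_pull[OF dual_h_relations[OF mn] NV[OF that]] by simp
    show "(\<Sum>n\<in>?X. pull (dual m) n * P m n) = 1" using val[OF m] dual_self[OF mn] by simp
    fix m' assume "m' \<in> ?N" "m' \<noteq> m" "rank_sum m \<le> rank_sum m'"
    then show "(\<Sum>n\<in>?X. pull (dual m) n * P m' n) = 0"
      using val[of m'] dual_triangular[OF mn, of m'] by fastforce
  qed
  then show ?thesis unfolding chow_dim_def chow_ideal_deg_def V hom .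
qed

text \<open>Each exponent is smaller than its rank step, and the steps telescope. Hence no degree
  above \<open>d\<close> occurs and the sum up to \<open>d\<close> covers all nested
  monomials.\<close>

lemma nested_size:
  assumes "m \<in> nested r (lat {} E) A" "A \<subseteq> E" "m \<noteq> {#}"
  shows "size m < r E - r A"
proof -
  have "\<forall>m\<in>nested r (lat {} E) A. A \<subseteq> E \<longrightarrow> m = {#} \<or> size m < r E - r A"
  proof (rule upward_induct[OF finite_lat[OF finite_E, of "{}"]], intro ballI impI)
    fix A m
    assume IH: "\<And>G. G \<in> lat {} E \<Longrightarrow> A \<subset> G \<Longrightarrow> \<forall>m\<in>nested r (lat {} E) G. G \<subseteq> E \<longrightarrow> m = {#} \<or> size m < r E - r G"
      and m: "m \<in> nested r (lat {} E) A" and AE: "A \<subseteq> E"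
    show "m = {#} \<or> size m < r E - r A"
    proof (cases "m = {#}")
      case False
      then obtain G a m' where G: "G \<in> lat {} E" "A \<subset> G" "a < r G - r A" "m' \<in> nested r (lat {} E) G" "m = replicate_mset a G + m'"
        using m unfolding nested_rec[of r "lat {} E" A] by fastforce
      have "r G \<le> r E" using lat_subset(2)[OF G(1)] by (rule r_mono)
      moreover have "m' = {#} \<or> size m' < r E - r G" using IH[OF G(1,2)] G(4) lat_subset(2)[OF G(1)] by blast
      ultimately show ?thesis using G(3,5) by auto
    qed simp
  qed
  then show ?thesis using assms by blast
qed

end

text \<open>At \<open>j = 0\<close> the subtraction truncates to 0 and \<open>dfact 0 = 1\<close>,
  in line with the convention that the double factorial of -1 is 1.\<close>

lemma fact_double: "fact (2 * j) = dfact (2 * j - 1) * 2 ^ j * fact j"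
proof (induction j)
  case (Suc j)
  have "dfact (2 * Suc j - 1) = (2 * j + 1) * dfact (2 * j - 1)"
    by (cases j) (simp_all add: numeral_2_eq_2)
  moreover have "fact (2 * Suc j) = (2 * j + 2) * ((2 * j + 1) * fact (2 * j) :: nat)" by (simp add: algebra_simps)
  ultimately show ?case using Suc by (simp add: algebra_simps)
qed simp

section \<open>Moments of the normal law and conclusion\<close>

lemma normal_moment:
  "(LINT x|lborel. normal_density 0 (sqrt ((real d + 2) / 12)) x * x ^ k) =
    (if odd k then 0 else ((real d + 2) / 12) ^ (k div 2) * real (dfact (k - 1)))"
proof (cases "odd k")
  case True
  then obtain j where k: "k = 2 * j + 1" by (auto elim: oddE)
  show ?thesis using integral_normal_moment_odd[of "sqrt ((real d + 2) / 12)" 0 j] True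
    unfolding k by simp
next
  case False
  then obtain j where k: "k = 2 * j" by auto
  define v where "v = (real d + 2) / 12"
  have v: "v > 0" "(sqrt v)\<^sup>2 = v" by (auto simp: v_def)
  have "real (fact (2 * j)) = real (dfact (2 * j - 1)) * 2 ^ j * fact j"
    unfolding fact_double by simp
  then have "fact (2 * j) / ((2 / v) ^ j * fact j) = v ^ j * real (dfact (2 * j - 1))"
    using v(1) by (simp add: power_divide field_simps)
  then show ?thesis
    using integral_normal_moment_even[of "sqrt v" 0 j] v(1) False unfolding k v(2) v_def[symmetric] by simp
qed

theorem theorem3p18:
  fixes E :: "'a set" and indep :: "'a set \<Rightarrow> bool" and d k :: nat
  assumes "matroid E indep" and "loopless E indep" and "mrank indep E = d + 1"
  shows "(\<Sum>i\<le>d. real (chow_dim E indep i) * (real i - real d / 2) ^ k)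
           / (\<Sum>i\<le>d. real (chow_dim E indep i))
         \<le> (LINT x|lborel. normal_density 0 (sqrt ((real d + 2) / 12)) x * x ^ k)
       \<and> (LINT x|lborel. normal_density 0 (sqrt ((real d + 2) / 12)) x * x ^ k)
         = (if odd k then 0 else ((real d + 2) / 12) ^ (k div 2) * real (dfact (k - 1)))"
proof -
  interpret ranked "mrank indep" by (rule ranked_mrank[OF assms(1)])
  have empty: "{} \<in> lat {} E"
  proof (rule latI)
    fix e assume "e \<in> E"
    then have "card {e} \<le> mrank indep {e}"
      using assms(2) mrank_ge[OF assms(1)] unfolding loopless_def by blast
    then show "mrank indep {} < mrank indep (insert e {})" by (simp add: r_empty)
  qed auto
  interpret flats "mrank indep" E
    using assms(1,3) empty r_empty by unfold_locales (auto simp: matroid_def)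
  have V: "chow_vars E indep = V"
    by (auto simp: chow_vars_def is_flat_def V_def Vp_def lat_def)
  let ?N = "nested (mrank indep) (lat {} E) {}"
  have fin: "finite ?N" by (rule finite_nested[OF finite_lat[OF finite_E]])
  have "?N \<noteq> {}" using nested_empty[of "mrank indep" "lat {} E" "{}"] by blast
  then have pos: "0 < real (card ?N)" using fin by (simp add: card_gt_0_iff)
  have size: "size m \<le> d" if "m \<in> ?N" for m
    using nested_size[OF that] assms(3) r_empty by (cases "m = {#}") auto
  \<comment> \<open>Grouping nested multisets by size serves both parts of the quotient: the centred
    power as \<open>f\<close> gives the numerator, the constant 1 the denominator.\<close>
  have sum: "(\<Sum>i\<le>d. real (chow_dim E indep i) * f i) = (\<Sum>m\<in>?N. f (size m))" for f :: "nat \<Rightarrow> real"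
  proof -
    have "(\<Sum>m\<in>?N. f (size m)) = (\<Sum>i\<le>d. \<Sum>m\<in>{m \<in> ?N. size m = i}. f (size m))"
      by (rule sum.group[symmetric]) (use fin size in auto)
    also have "\<dots> = (\<Sum>i\<le>d. real (chow_dim E indep i) * f i)"
      by (rule sum.cong) (simp_all add: chow_dim_nested[OF V])
    finally show ?thesis by simp
  qed
  have "(\<Sum>m\<in>?N. (real (size m) - real d / 2) ^ k) \<le> real (card ?N) *
      (if even k then fact k * ((real d + 2) / 24) ^ (k div 2) / fact (k div 2) else 0)"
    by (rule nested_moment_bound[OF finite_E empty assms(3)])
  also have "(if even k then fact k * ((real d + 2) / 24) ^ (k div 2) / fact (k div 2) else 0) =
      (if odd k then 0 else ((real d + 2) / 12) ^ (k div 2) * real (dfact (k - 1)))"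
  proof (cases "even k")
    case True
    then obtain j where k: "k = 2 * j" by auto
    have "real (fact (2 * j)) = real (dfact (2 * j - 1)) * 2 ^ j * fact j" unfolding fact_double by simp
    \<comment> \<open>The factor \<open>2 ^ j\<close> left over from the factorials turns 24, which
      comes from half the variance, into 12.\<close>
    moreover have "2 ^ j * ((real d + 2) / 24) ^ j = ((real d + 2) / 12) ^ j"
      unfolding power_mult_distrib[symmetric] by (rule arg_cong[of _ _ "\<lambda>x. x ^ j"]) simp
    ultimately show ?thesis by (simp add: k mult_ac)
  qed simp
  finally have "(\<Sum>m\<in>?N. (real (size m) - real d / 2) ^ k) / real (card ?N) \<le>
      (if odd k then 0 else ((real d + 2) / 12) ^ (k div 2) * real (dfact (k - 1)))"
    using pos by (simp add: field_simps)
  then show ?thesis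
    unfolding normal_moment sum using sum[of "\<lambda>_. 1"] by simp
qed

end
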